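(* Fix $\theta_0\in(0,\pi/2)$. Say that a function $\omega:S^2\to\mathbb{R}$ is admissible if it is smooth, $\min\omega=0$, $\omega(\bar{\mathbf{x}})=\omega(-\bar{\mathbf{x}})$, and $\omega$ is axisymmetric with respect to the $x_3$-axis. For $0<s<3$ let $\tilde\omega$ denote the angle function of the Fourier transform of $|\mathbf{x}|^{-s}\omega(\bar{\mathbf{x}})$. Assume $1<s<2$. Then: (1) there exists an admissible $\omega_1$ which achieves its minimal value $\omega_1(\theta)=0$ on $\theta\in[0,\pi/2-\theta_0]$ and for which $\tilde\omega_1$ is strictly positive; (2) there exists an admissible $\omega_2$ which achieves its minimal value $\omega_2(\theta)=0$ on $\theta\in[0,\pi/2-\theta_0]$ and for which $\tilde\omega_2$ is sign-changing (takes both positive and negative values). If $s=1$, then the same two statements hold with "strictly positive" in (1) replaced by "nonnegative"; moreover, for $s=1$ statement (1) would be false without this replacement.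
   Context: For $\mathbf{x}\in\mathbb{R}^3\setminus\{0\}$, $\bar{\mathbf{x}}=\mathbf{x}/|\mathbf{x}|=(\sin\theta\cos\mu,\sin\theta\sin\mu,\cos\theta)\in S^2$ with $0\le\theta\le\pi$, $0\le\mu<2\pi$; an axisymmetric function on $S^2$ is regarded as a function of $\theta$. Fourier transform: $\mathcal{F}[f](\xi)=\int_{\mathbb{R}^3}f(\mathbf{x})e^{-2\pi i\mathbf{x}\cdot\xi}\,d\mathbf{x}$, extended to tempered distributions. For smooth even $\omega$ on $S^2$ and $0<s<3$, $\mathcal{F}[|\mathbf{x}|^{-s}\omega(\bar{\mathbf{x}})]=|\xi|^{-3+s}\tilde\omega(\bar\xi)$ with $\bar\xi=\xi/|\xi|$ and $\tilde\omega$ smooth on $S^2$; this defines $\tilde\omega$ (which depends on $s$). *)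

theory Defs
  imports "HOL-Analysis.Analysis"
begin

section \<open>Smooth functions\<close>

text \<open>\<open>iter_deriv [v\<^sub>1, \<dots>, v\<^sub>n] f\<close> is the iterated directional derivative
  \<open>\<partial>\<^bsub>v\<^sub>1\<^esub> \<dots> \<partial>\<^bsub>v\<^sub>n\<^esub> f\<close>.\<close>

primrec iter_deriv ::
  "'a::euclidean_space list \<Rightarrow> ('a \<Rightarrow> 'b::real_normed_vector) \<Rightarrow> 'a \<Rightarrow> 'b" where
  "iter_deriv [] f = f"
| "iter_deriv (v # vs) f = (\<lambda>x. frechet_derivative (iter_deriv vs f) (at x) v)"

text \<open>For open \<open>U\<close> this is \<open>C\<^sup>\<infinity>\<close> on \<open>U\<close>: every iterated partial derivative exists and is
  Frechet differentiable, hence continuous.\<close>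

definition smooth_on :: "'a::euclidean_space set \<Rightarrow> ('a \<Rightarrow> 'b::real_normed_vector) \<Rightarrow> bool" where
  "smooth_on U f \<longleftrightarrow>
     (\<forall>vs. set vs \<subseteq> Basis \<longrightarrow> (\<forall>x\<in>U. iter_deriv vs f differentiable (at x)))"

abbreviation S2 :: "(real^3) set" where
  "S2 \<equiv> sphere 0 1"

text \<open>Functions on the sphere are functions on \<open>real^3\<close> of which only the values on \<open>S2\<close> matter.
  Smoothness on the embedded submanifold \<open>S2\<close> is the existence of a smooth extension to an open
  neighbourhood.\<close>

definition smooth_on_S2 :: "(real^3 \<Rightarrow> real) \<Rightarrow> bool" where
  "smooth_on_S2 \<omega> \<longleftrightarrow>
     (\<exists>U F. open U \<and> S2 \<subseteq> U \<and> smooth_on U F \<and> (\<forall>x\<in>S2. F x = \<omega> x))"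


section \<open>The Fourier transform of tempered distributions\<close>

definition fourier :: "('a::euclidean_space \<Rightarrow> complex) \<Rightarrow> 'a \<Rightarrow> complex" where
  "fourier f \<xi> = (LINT x|lborel. f x * exp (- 2 * of_real pi * \<i> * of_real (x \<bullet> \<xi>)))"

definition schwartz :: "('a::euclidean_space \<Rightarrow> complex) \<Rightarrow> bool" where
  "schwartz \<phi> \<longleftrightarrow> smooth_on UNIV \<phi> \<and>
     (\<forall>k::nat. \<forall>vs. set vs \<subseteq> Basis \<longrightarrow> bounded (range (\<lambda>x. norm x ^ k *\<^sub>R iter_deriv vs \<phi> x)))"

text \<open>Distributions are functionals, of which only the values on Schwartz functions matter.
  \<open>regular_distr f\<close> is the distribution given by a function \<open>f\<close>; it is tempered if \<open>f\<close> is
  locally integrable and bounded near infinity, as are all functions it is applied to below.\<close>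

definition regular_distr ::
  "('a::euclidean_space \<Rightarrow> complex) \<Rightarrow> ('a \<Rightarrow> complex) \<Rightarrow> complex" where
  "regular_distr f \<phi> = (LINT x|lborel. f x * \<phi> x)"

definition fourier_distr ::
  "(('a::euclidean_space \<Rightarrow> complex) \<Rightarrow> complex) \<Rightarrow> ('a \<Rightarrow> complex) \<Rightarrow> complex" where
  "fourier_distr T \<phi> = T (fourier \<phi>)"

text \<open>The function \<open>|x|\<^sup>a \<omega>(x/|x|)\<close>, where \<open>sgn x = x /\<^sub>R norm x\<close>; the value at
  the origin is irrelevant.\<close>

definition homog :: "real \<Rightarrow> (real^3 \<Rightarrow> real) \<Rightarrow> real^3 \<Rightarrow> complex" where
  "homog a \<omega> x = of_real (norm x powr a * \<omega> (sgn x))"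

text \<open>\<open>angle_fourier s \<omega> \<omega>'\<close>: \<open>\<omega>'\<close> is the angle function of the Fourier transform of
  \<open>|x|\<^bsup>-s\<^esup> \<omega>(x/|x|)\<close>. By continuity its values on \<open>S2\<close> are determined by \<open>s\<close> and \<open>\<omega>\<close>. It is
  real-valued because the transform of a real even distribution is real.\<close>

definition angle_fourier :: "real \<Rightarrow> (real^3 \<Rightarrow> real) \<Rightarrow> (real^3 \<Rightarrow> real) \<Rightarrow> bool" where
  "angle_fourier s \<omega> \<omega>' \<longleftrightarrow> smooth_on_S2 \<omega>' \<and>
     (\<forall>\<phi>. schwartz \<phi> \<longrightarrow>
        fourier_distr (regular_distr (homog (- s) \<omega>)) \<phi> = regular_distr (homog (- 3 + s) \<omega>') \<phi>)"


section \<open>Admissible angle functions\<close>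

definition sph :: "real \<Rightarrow> real \<Rightarrow> real^3" where
  "sph \<theta> \<mu> = vector [sin \<theta> * cos \<mu>, sin \<theta> * sin \<mu>, cos \<theta>]"

definition rot3 :: "real \<Rightarrow> real^3 \<Rightarrow> real^3" where
  "rot3 \<alpha> x = vector [cos \<alpha> * x$1 - sin \<alpha> * x$2, sin \<alpha> * x$1 + cos \<alpha> * x$2, x$3]"

definition axisymmetric :: "(real^3 \<Rightarrow> real) \<Rightarrow> bool" where
  "axisymmetric \<omega> \<longleftrightarrow> (\<forall>\<alpha>. \<forall>x\<in>S2. \<omega> (rot3 \<alpha> x) = \<omega> x)"

definition admissible :: "(real^3 \<Rightarrow> real) \<Rightarrow> bool" where
  "admissible \<omega> \<longleftrightarrow>
     smooth_on_S2 \<omega> \<and>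
     (\<forall>x\<in>S2. 0 \<le> \<omega> x) \<and> (\<exists>x\<in>S2. \<omega> x = 0) \<and>
     (\<forall>x\<in>S2. \<omega> (- x) = \<omega> x) \<and>
     axisymmetric \<omega>"

definition vanishes_upto :: "real \<Rightarrow> (real^3 \<Rightarrow> real) \<Rightarrow> bool" where
  "vanishes_upto \<beta> \<omega> \<longleftrightarrow> (\<forall>\<theta>\<in>{0..\<beta>}. \<forall>\<mu>\<in>{0..<2*pi}. \<omega> (sph \<theta> \<mu>) = 0)"

end

theory Submission
  imports Defs "HOL-Probability.Characteristic_Functions" "HOL-Probability.Sinc_Integral"
begin

text \<open>
  Write \<open>x = (x', x\<^sub>3)\<close> with \<open>x'\<close> in the plane, and \<open>\<xi> = (y, \<tau>)\<close> accordingly. The building blocks are the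
  homogeneous distributions \<open>D\<^sub>a = |x'| powr (1 - s) * \<delta>(x\<^sub>3 - a \<bullet> x')\<close>, carried by the planes \<open>x\<^sub>3 = a \<bullet> x'\<close>.
  Restricting a transform to such a plane gives the two-dimensional transform of the integrals of the
  original function along lines of direction \<open>(-a, 1)\<close>; so the transform of \<open>D\<^sub>a\<close> is
  \<open>C\<^sub>s |y + \<tau> a| powr (s - 3)\<close> with \<open>C\<^sub>s > 0\<close> if \<open>1 < s < 3\<close>, and the measure on the line \<open>y = -\<tau> a\<close> if \<open>s = 1\<close>.

  Superposing the \<open>D\<^sub>a\<close> with a radial density \<open>h(|a|\<^sup>2)\<close> supported in \<open>|a| \<le> T\<close> gives the function
  \<open>|x'| powr (-s) * g(x\<^sub>3 / |x'|)\<close>, where \<open>g(p) = \<integral> h(p\<^sup>2 + q\<^sup>2) dq\<close> is the line integral of the density at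
  distance \<open>p\<close> from the origin. It is axisymmetric and even, and it vanishes for \<open>|x\<^sub>3| \<ge> T |x'|\<close>, which for
  \<open>T = tan \<theta>\<^sub>0\<close> is the region in which the angle function has to vanish, together with its mirror image. Its transform is
  \<open>C\<^sub>s \<integral> h(|a|\<^sup>2) |y + \<tau> a| powr (s - 3) da\<close> (\<open>fourier_cone\<close>), and \<open>h(|y|\<^sup>2 / \<tau>\<^sup>2) / \<tau>\<^sup>2\<close> for \<open>s = 1\<close>
  (\<open>fourier_cone_1\<close>).

  A nonnegative bump \<open>h\<close> gives the first claim. For the second, a bump of width \<open>T\<close> is dented at the centre by
  a bump of width \<open>e\<close> and height of order \<open>1 / e\<close>. The line integrals of the dent stay bounded as \<open>e\<close> tends
  to \<open>0\<close>, and can be kept below those of the wide bump (\<open>radon_dented_nonneg\<close>), whereas its contribution to the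
  transform at the pole is of order \<open>e powr (s - 2)\<close>, which is unbounded because \<open>s < 2\<close>
  (\<open>cone_hat_dented_pole\<close>).

  For \<open>s = 1\<close> strict positivity is impossible (\<open>no_positive_transform\<close>): tested against the Gaussians
  \<open>exp (- pi t |y|\<^sup>2 - pi \<tau>\<^sup>2)\<close>, whose transforms concentrate on the axis as \<open>t\<close> tends to \<open>0\<close>, the function that
  vanishes near the axis gives a bounded result, while a transform bounded below by a positive multiple of
  \<open>|\<xi>| powr (-2)\<close> gives one that grows like \<open>ln (1 / t)\<close>. Informally, the integral of the transform over the
  equator is a multiple of the value at the pole, which is \<open>0\<close>.
\<close>

type_synonym plane = "real \<times> real"

section \<open>Differentiability of finite order\<close>

text \<open>The list in \<open>iter_deriv\<close> adds derivatives on the outside. Here the first derivative is split off on the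
inside instead, so that the product rule and the chain rule become inductions on the order.\<close>

primrec ndiff :: "'a::euclidean_space set \<Rightarrow> nat \<Rightarrow> ('a \<Rightarrow> 'b::real_normed_vector) \<Rightarrow> bool" where
  "ndiff U 0 f \<longleftrightarrow> (\<forall>x\<in>U. f differentiable (at x))"
| "ndiff U (Suc n) f \<longleftrightarrow> (\<forall>x\<in>U. f differentiable (at x)) \<and>
     (\<forall>v\<in>Basis. ndiff U n (\<lambda>x. frechet_derivative f (at x) v))"

lemma ndiff_differentiable: "ndiff U n f \<Longrightarrow> x \<in> U \<Longrightarrow> f differentiable (at x)"
  by (cases n) auto

lemma ndiff_has_derivative:
  "ndiff U n f \<Longrightarrow> x \<in> U \<Longrightarrow> (f has_derivative frechet_derivative f (at x)) (at x)"
  using ndiff_differentiable frechet_derivative_works by blast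

lemma ndiff_Suc_imp: "ndiff U (Suc n) f \<Longrightarrow> ndiff U n f"
  by (induction n arbitrary: f) auto

lemma ndiff_cong:
  assumes "open U" "\<And>x. x \<in> U \<Longrightarrow> f x = g x" "ndiff U n f"
  shows "ndiff U n g"
  using assms(2,3)
proof (induction n arbitrary: f g)
  case (0 f g)
  show ?case unfolding ndiff.simps
  proof
    fix x assume x: "x \<in> U"
    then have "(f has_derivative frechet_derivative f (at x)) (at x)"
      using 0 ndiff_has_derivative by blast
    then have "(g has_derivative frechet_derivative f (at x)) (at x)"
      using has_derivative_transform_within_open[OF _ assms(1) x] 0(1) by blast
    then show "g differentiable (at x)" using differentiable_def by blast
  qed
next
  case (Suc n f g)
  have *: "(g has_derivative frechet_derivative f (at x)) (at x)" if x: "x \<in> U" for x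
    using has_derivative_transform_within_open[OF _ assms(1) x] Suc.prems ndiff_has_derivative x
    by blast
  have eq: "frechet_derivative f (at x) = frechet_derivative g (at x)" if "x \<in> U" for x
    using *[OF that] frechet_derivative_at by blast
  show ?case unfolding ndiff.simps
  proof (intro conjI ballI)
    fix x assume "x \<in> U" then show "g differentiable (at x)" using * differentiable_def by blast
  next
    fix v :: 'a assume "v \<in> Basis"
    then show "ndiff U n (\<lambda>x. frechet_derivative g (at x) v)"
      using Suc.prems(2) eq
      by (intro Suc.IH[of "\<lambda>x. frechet_derivative f (at x) v" "\<lambda>x. frechet_derivative g (at x) v"]) auto
  qed
qed

lemma ndiff_SucI:
  assumes "open U" "\<And>x. x \<in> U \<Longrightarrow> (f has_derivative D x) (at x)"
    "\<And>v. v \<in> Basis \<Longrightarrow> ndiff U n (\<lambda>x. D x v)"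
  shows "ndiff U (Suc n) f"
  unfolding ndiff.simps
proof (intro conjI ballI)
  fix x assume "x \<in> U" then show "f differentiable (at x)" using assms(2) differentiable_def by blast
next
  fix v :: 'a assume v: "v \<in> Basis"
  have "D x v = frechet_derivative f (at x) v" if "x \<in> U" for x
    using frechet_derivative_at[OF assms(2)[OF that]] by simp
  then show "ndiff U n (\<lambda>x. frechet_derivative f (at x) v)"
    by (rule ndiff_cong[OF assms(1) _ assms(3)[OF v]])
qed

lemma iter_deriv_snoc:
  "iter_deriv (vs @ [v]) f = iter_deriv vs (\<lambda>x. frechet_derivative f (at x) v)"
  by (induction vs) auto

lemma ndiff_iter_deriv:
  "ndiff U n f \<Longrightarrow> set vs \<subseteq> Basis \<Longrightarrow> length vs \<le> n \<Longrightarrow> x \<in> U \<Longrightarrow>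
    iter_deriv vs f differentiable (at x)"
proof (induction n arbitrary: f vs)
  case 0 then show ?case by auto
next
  case (Suc n)
  show ?case
  proof (cases vs rule: rev_cases)
    case Nil then show ?thesis using Suc.prems by auto
  next
    case (snoc ws w)
    then show ?thesis using Suc.prems unfolding snoc iter_deriv_snoc
      by (intro Suc.IH) auto
  qed
qed

lemma smooth_on_ndiff: "(\<And>n. ndiff U n f) \<Longrightarrow> smooth_on U f"
  unfolding smooth_on_def using ndiff_iter_deriv by blast

lemma ndiff_const: "open U \<Longrightarrow> ndiff U n (\<lambda>x. c)"
proof (induction n arbitrary: c)
  case (Suc n) show ?case by (rule ndiff_SucI[where D="\<lambda>_ _. 0"]) (use Suc in auto)
qed auto

lemma ndiff_linear: "open U \<Longrightarrow> bounded_linear f \<Longrightarrow> ndiff U n f"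
proof (cases n)
  case (Suc m)
  assume "open U" "bounded_linear f"
  then show ?thesis unfolding Suc
    by (intro ndiff_SucI[where D="\<lambda>_. f"] ndiff_const bounded_linear_imp_has_derivative)
qed (auto intro: bounded_linear_imp_differentiable)

lemma ndiff_add: 
  "open U \<Longrightarrow> ndiff U n f \<Longrightarrow> ndiff U n g \<Longrightarrow> ndiff U n (\<lambda>x. f x + g x)"
proof (induction n arbitrary: f g)
  case 0 then show ?case by auto
next
  case (Suc n)
  show ?case
    by (rule ndiff_SucI[OF Suc.prems(1) has_derivative_add[OF
          ndiff_has_derivative[OF Suc.prems(2)] ndiff_has_derivative[OF Suc.prems(3)]]])
       (use Suc in auto)
qed

lemma ndiff_mult: 
  fixes f g :: "'a::euclidean_space \<Rightarrow> real"
  shows "open U \<Longrightarrow> ndiff U n f \<Longrightarrow> ndiff U n g \<Longrightarrow> ndiff U n (\<lambda>x. f x * g x)"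
proof (induction n arbitrary: f g)
  case 0 then show ?case by (auto intro: differentiable_mult)
next
  case (Suc n)
  show ?case
    by (rule ndiff_SucI[OF Suc.prems(1) has_derivative_mult[OF
          ndiff_has_derivative[OF Suc.prems(2)] ndiff_has_derivative[OF Suc.prems(3)]]])
       (use Suc.prems Suc.prems(2,3)[THEN ndiff_Suc_imp] in \<open>auto intro!: ndiff_add Suc.IH\<close>)
qed

text \<open>A partial derivative of the composition is \<open>(h' \<circ> f) * \<partial>f\<close>, a product of functions of one order less.\<close>

lemma ndiff_compose:
  fixes f :: "'a::euclidean_space \<Rightarrow> real" and h :: "real \<Rightarrow> real"
  assumes "open U" "f ` U \<subseteq> V"
  shows "ndiff V n h \<Longrightarrow> ndiff U n f \<Longrightarrow> ndiff U n (\<lambda>x. h (f x))"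
proof (induction n arbitrary: h)
  case (0 h)
  show ?case unfolding ndiff.simps
  proof
    fix x assume "x \<in> U"
    then have "f differentiable (at x)" "h differentiable (at (f x))" using 0 assms by auto
    then show "(\<lambda>x. h (f x)) differentiable (at x)"
      using differentiable_chain_at[of f x h] by (simp add: o_def)
  qed
next
  case (Suc n h)
  let ?h' = "\<lambda>y. frechet_derivative h (at y) 1"
  show ?case
  proof (rule ndiff_SucI[OF assms(1), where D="\<lambda>x v. ?h' (f x) * frechet_derivative f (at x) v"])
    fix x assume x: "x \<in> U"
    then have hd: "(h has_derivative frechet_derivative h (at (f x))) (at (f x))"
      using Suc.prems(1) assms ndiff_has_derivative by blast
    have lin: "frechet_derivative h (at (f x)) c = c * ?h' (f x)" for c
      using linear_scale[OF has_derivative_linear[OF hd], of c 1] by simp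
    have "(h \<circ> f has_derivative frechet_derivative h (at (f x)) \<circ> frechet_derivative f (at x)) (at x)"
      using diff_chain_at[OF ndiff_has_derivative[OF Suc.prems(2) x] hd] .
    moreover have "(\<lambda>v. ?h' (f x) * frechet_derivative f (at x) v) =
        frechet_derivative h (at (f x)) \<circ> frechet_derivative f (at x)"
      by (rule ext, subst o_apply, subst lin, rule mult.commute)
    ultimately show "((\<lambda>x. h (f x)) has_derivative (\<lambda>v. ?h' (f x) * frechet_derivative f (at x) v)) (at x)"
      by (simp add: o_def)
  next
    fix v :: 'a assume v: "v \<in> Basis"
    have "ndiff U n (\<lambda>x. ?h' (f x))"
      by (rule Suc.IH[OF _ ndiff_Suc_imp[OF Suc.prems(2)]]) (use Suc.prems in auto)
    then show "ndiff U n (\<lambda>x. ?h' (f x) * frechet_derivative f (at x) v)"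
      using v Suc.prems by (intro ndiff_mult[OF assms(1)]) auto
  qed
qed

lemma ndiff_real_SucI:
  fixes f :: "real \<Rightarrow> real"
  assumes "open U" "\<And>x. x \<in> U \<Longrightarrow> (f has_real_derivative f' x) (at x)" "ndiff U n f'"
  shows "ndiff U (Suc n) f"
  by (rule ndiff_SucI[where D="\<lambda>x v. f' x * v"])
     (use assms in \<open>auto simp: has_field_derivative_def\<close>)

lemma ndiff_powr: "ndiff {0<..} n (\<lambda>t::real. t powr r)"
proof (induction n arbitrary: r)
  have D: "((\<lambda>t. t powr r) has_real_derivative r * t powr (r - 1)) (at t)" if "t > 0" for t r :: real
    using that by (rule has_real_derivative_powr)
  case 0
  show ?case using D unfolding ndiff.simps has_field_derivative_def differentiable_def by auto
next
  case (Suc n)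
  show ?case
    by (rule ndiff_real_SucI[where f'="\<lambda>t. r * t powr (r - 1)"])
       (use Suc in \<open>auto intro!: has_real_derivative_powr ndiff_mult ndiff_const\<close>)
qed

text \<open>The functions below are given by different formulas on different overlapping regions; this glues them.\<close>

lemma ndiff_local:
  assumes "open U"
    and "\<And>x. x \<in> U \<Longrightarrow> \<exists>V g. open V \<and> x \<in> V \<and> ndiff V n g \<and> (\<forall>y\<in>V. g y = f y)"
  shows "ndiff U n f"
proof -
  have "\<exists>V. open V \<and> x \<in> V \<and> ndiff V n f" if x: "x \<in> U" for x
  proof -
    obtain V g where V: "open V" "x \<in> V" "ndiff V n g" "\<forall>y\<in>V. g y = f y" using assms(2)[OF x] by blast
    show ?thesis using ndiff_cong[OF V(1) _ V(3), of f] V by blast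
  qed
  then show ?thesis using assms(1)
  proof (induction n arbitrary: f)
    case 0 then show ?case by (metis ndiff_differentiable ndiff.simps(1))
  next
    case (Suc n)
    show ?case unfolding ndiff.simps
    proof (intro conjI ballI)
      fix x assume "x \<in> U" then show "f differentiable (at x)" 
        using Suc.prems(1) ndiff_differentiable by blast
    next
      fix v :: 'a assume "v \<in> Basis"
      then have "\<exists>V. open V \<and> x \<in> V \<and> ndiff V n (\<lambda>x. frechet_derivative f (at x) v)" if "x \<in> U" for x
        using Suc.prems(1)[OF that] unfolding ndiff.simps by blast
      then show "ndiff U n (\<lambda>x. frechet_derivative f (at x) v)"
        using Suc.prems(2) by (rule Suc.IH)
    qed
  qed
qed

lemma ndiff_continuous_on: "ndiff U n f \<Longrightarrow> continuous_on U f"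
  using ndiff_differentiable differentiable_imp_continuous_within
  by (metis continuous_at_imp_continuous_on)

section \<open>Differentiation under the integral sign\<close>

lemma integrable_mult_continuous_compact_support:
  fixes k w :: "'b::euclidean_space \<Rightarrow> real"
  assumes L: "compact L" and w: "integrable lborel (\<lambda>b. indicator L b *\<^sub>R w b)"
    and k: "continuous_on UNIV k" and k0: "\<And>b. b \<notin> L \<Longrightarrow> k b = 0"
  shows "integrable lborel (\<lambda>b. k b * w b)"
proof -
  have "bounded (k ` L)"
    using L k by (meson compact_continuous_image compact_imp_bounded continuous_on_subset subset_UNIV)
  then obtain C where C: "\<And>b. b \<in> L \<Longrightarrow> norm (k b) \<le> C" by (auto simp: bounded_iff)
  have eq: "k b * w b = k b * (indicator L b *\<^sub>R w b)" for b
    using k0 by (cases "b \<in> L") auto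
  have [measurable]: "k \<in> borel_measurable borel" using k by (rule borel_measurable_continuous_onI)
  have [measurable]: "(\<lambda>b. indicator L b *\<^sub>R w b) \<in> borel_measurable lborel" using w by auto
  show ?thesis unfolding eq
  proof (rule Bochner_Integration.integrable_bound[OF integrable_mult_right[OF integrable_norm[OF w], of C]])
    show "AE b in lborel. norm (k b * (indicator L b *\<^sub>R w b)) \<le> norm (C * norm (indicator L b *\<^sub>R w b))"
      using C by (auto intro!: AE_I2 mult_right_mono simp: abs_mult indicator_def)
         (metis abs_ge_self order_trans)
  qed measurable
qed

text \<open>The derivative of \<open>\<Phi>\<close> is uniformly continuous on the product of a closed ball around \<open>x\<close> with \<open>L\<close>. Hence the
error of the linearization in \<open>x\<close> is \<open>o(|y - x|)\<close> uniformly in \<open>b\<close>, and remains so after integration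
against \<open>|w|\<close> over \<open>L\<close>.\<close>

lemma has_derivative_parametric_integral:
  fixes \<Phi> :: "'a::euclidean_space \<times> 'b::euclidean_space \<Rightarrow> real" and w :: "'b \<Rightarrow> real"
  assumes U: "open U" and L: "compact L" and w: "integrable lborel (\<lambda>b. indicator L b *\<^sub>R w b)"
    and \<Phi>: "ndiff (U \<times> UNIV) (Suc 0) \<Phi>" and \<Phi>0: "\<And>x b. x \<in> U \<Longrightarrow> b \<notin> L \<Longrightarrow> \<Phi> (x, b) = 0"
    and x: "x \<in> U"
  shows "((\<lambda>x. LBINT b. \<Phi> (x, b) * w b) has_derivative
     (\<lambda>v. LBINT b. frechet_derivative \<Phi> (at (x, b)) (v, 0) * w b)) (at x)"
proof -
  let ?D = "\<lambda>x b v. frechet_derivative \<Phi> (at (x, b)) (v, 0)"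
  have hd: "(\<Phi> has_derivative frechet_derivative \<Phi> (at (x, b))) (at (x, b))" if "x \<in> U" for x b
    using ndiff_has_derivative[OF \<Phi>] that by auto
  have lin: "bounded_linear (?D x b)" if "x \<in> U" for x b
    by (rule bounded_linear_compose[OF has_derivative_bounded_linear[OF hd[OF that]]])
       (intro bounded_linear_Pair bounded_linear_ident bounded_linear_zero)
  have part: "((\<lambda>x. \<Phi> (x, b)) has_derivative ?D x b) (at x)" if "x \<in> U" for x b
  proof -
    have "((\<lambda>x. (x, b)) has_derivative (\<lambda>v. (v, 0))) (at x)"
      by (auto intro!: derivative_eq_intros)
    from diff_chain_at[OF this hd[OF that]] show ?thesis by (simp add: o_def)
  qed
  have Dsum: "?D x b v = (\<Sum>e\<in>Basis. (v \<bullet> e) * ?D x b e)" if "x \<in> U" for x b v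
  proof -
    have l: "linear (?D x b)" using bounded_linear.linear[OF lin[OF that]] .
    have "?D x b (\<Sum>e\<in>Basis. (v \<bullet> e) *\<^sub>R e) = (\<Sum>e\<in>Basis. ?D x b ((v \<bullet> e) *\<^sub>R e))"
      by (rule linear_sum[OF l])
    also have "\<dots> = (\<Sum>e\<in>Basis. (v \<bullet> e) * ?D x b e)"
      using linear_scale[OF l] by simp
    finally show ?thesis by (simp only: euclidean_representation)
  qed
  have contB: "continuous_on (U \<times> UNIV) (\<lambda>z. frechet_derivative \<Phi> (at z) (e, 0))" if "e \<in> Basis" for e
    using \<Phi> that by (intro ndiff_continuous_on[where n=0]) (auto simp: Basis_prod_def)
  have contD: "continuous_on UNIV (\<lambda>b. ?D x b v)" if "x \<in> U" for x v
  proof -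
    have "(\<lambda>b. ?D x b v) = (\<lambda>b. \<Sum>e\<in>Basis. (v \<bullet> e) * ?D x b e)"
      by (rule ext, rule Dsum[OF that])
    then show ?thesis
      by (simp only:) (intro continuous_intros continuous_on_compose2[OF contB], use that in auto)
  qed
  have cont\<Phi>: "continuous_on UNIV (\<lambda>b. \<Phi> (x, b))" if "x \<in> U" for x
    by (intro continuous_on_compose2[OF ndiff_continuous_on[OF \<Phi>]] continuous_intros) (use that in auto)
  have D0: "?D x b v = 0" if "x \<in> U" "b \<notin> L" for x b v
  proof -
    have "((\<lambda>x. \<Phi> (x, b)) has_derivative (\<lambda>_. 0)) (at x)"
      by (rule has_derivative_transform_within_open[OF _ U that(1), of "\<lambda>_. 0"])
         (use \<Phi>0 that in auto)
    from has_derivative_unique[OF this part[OF that(1)]] show ?thesis by metis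
  qed
  have int\<Phi>: "integrable lborel (\<lambda>b. \<Phi> (x, b) * w b)" if "x \<in> U" for x
    by (rule integrable_mult_continuous_compact_support[OF L w cont\<Phi>[OF that]]) (use \<Phi>0 that in auto)
  have intD: "integrable lborel (\<lambda>b. ?D x b v * w b)" if "x \<in> U" for x v
    by (rule integrable_mult_continuous_compact_support[OF L w contD[OF that]]) (use D0 that in auto)
  obtain r where r: "r > 0" "cball x r \<subseteq> U" using U x open_contains_cball by blast
  define W where "W = (LBINT b. norm (indicator L b *\<^sub>R w b))"
  have W: "W \<ge> 0" unfolding W_def by simp
  have uc: "uniformly_continuous_on (cball x r \<times> L) (\<lambda>z. frechet_derivative \<Phi> (at z) (e, 0))"
    if "e \<in> Basis" for e
    by (intro compact_uniformly_continuous continuous_on_subset[OF contB[OF that]] compact_Times L)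
       (use r in auto)
  show ?thesis unfolding has_derivative_at_alt
  proof (intro conjI allI impI)
    have "linear (\<lambda>v. LBINT b. ?D x b v * w b)"
    proof (rule linearI)
      fix u v :: 'a
      show "(LBINT b. ?D x b (u + v) * w b) = (LBINT b. ?D x b u * w b) + (LBINT b. ?D x b v * w b)"
        unfolding linear_add[OF bounded_linear.linear[OF lin[OF x]]] distrib_right
        by (rule Bochner_Integration.integral_add[OF intD[OF x] intD[OF x]])
    next
      fix c :: real and v :: 'a
      show "(LBINT b. ?D x b (c *\<^sub>R v) * w b) = c *\<^sub>R (LBINT b. ?D x b v * w b)"
        unfolding linear_scale[OF bounded_linear.linear[OF lin[OF x]]] real_scaleR_def mult.assoc
        by (rule integral_mult_right_zero)
    qed
    then show "bounded_linear (\<lambda>v. LBINT b. ?D x b v * w b)"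
      by (rule linear_conv_bounded_linear[THEN iffD1])
  next
    fix \<epsilon> :: real assume \<epsilon>: "0 < \<epsilon>"
    define \<eta> where "\<eta> = \<epsilon> / ((W + 1) * real DIM('a))"
    have \<eta>: "\<eta> > 0" unfolding \<eta>_def using \<epsilon> W by (auto intro!: divide_pos_pos mult_pos_pos)
    have "\<forall>e\<in>Basis. \<exists>d>0. \<forall>z\<in>cball x r \<times> L. \<forall>z'\<in>cball x r \<times> L. dist z' z < d \<longrightarrow>
        dist (frechet_derivative \<Phi> (at z') (e, 0)) (frechet_derivative \<Phi> (at z) (e::'a, 0)) < \<eta>"
      using uc \<eta> unfolding uniformly_continuous_on_def by blast
    then obtain d where d: "\<And>e. e \<in> Basis \<Longrightarrow> d e > (0::real)"
      and dd: "\<And>e z z'. e \<in> (Basis::'a set) \<Longrightarrow> z\<in>cball x r \<times> L \<Longrightarrow> z'\<in>cball x r \<times> L \<Longrightarrow> dist z' z < d e \<Longrightarrow>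
        dist (frechet_derivative \<Phi> (at z') (e, 0)) (frechet_derivative \<Phi> (at z) (e, 0)) < \<eta>"
      by metis
    define \<delta> where "\<delta> = min r (Min (d ` Basis))"
    have \<delta>: "\<delta> > 0" unfolding \<delta>_def using r d by (auto simp: Min_gr_iff)
    have \<delta>d: "\<delta> \<le> d e" if "e \<in> Basis" for e unfolding \<delta>_def using that by (auto intro!: min.coboundedI2)
    have R: "\<bar>\<Phi> (y, b) - \<Phi> (x, b) - ?D x b (y - x)\<bar> \<le> norm (y - x) * (real DIM('a) * \<eta>)"
      if y: "norm (y - x) < \<delta>" and b: "b \<in> L" for y b
    proof -
      have sub: "ball x \<delta> \<subseteq> cball x r" unfolding \<delta>_def by auto
      have "norm (\<Phi> (y, b) - \<Phi> (x, b) - ?D x b (y - x)) \<le> norm (y - x) * (real DIM('a) * \<eta>)"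
      proof (rule differentiable_bound_linearization[where S="ball x \<delta>" and f="\<lambda>x. \<Phi> (x, b)" and f'="\<lambda>x. ?D x b"])
        fix t :: real assume "t \<in> {0..1}"
        moreover have "convex (ball x \<delta>)" "x \<in> ball x \<delta>" "y \<in> ball x \<delta>"
          using \<delta> y by (auto simp: dist_norm norm_minus_commute)
        ultimately have "(1 - t) *\<^sub>R x + t *\<^sub>R y \<in> ball x \<delta>" unfolding convex_alt by auto
        then show "x + t *\<^sub>R (y - x) \<in> ball x \<delta>" by (simp add: algebra_simps)
      next
        fix z assume "z \<in> ball x \<delta>"
        then show "((\<lambda>x. \<Phi> (x, b)) has_derivative ?D z b) (at z within ball x \<delta>)"
          using part sub r has_derivative_at_withinI by blast
      next
        fix z assume z: "z \<in> ball x \<delta>"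
        then have zU: "z \<in> U" using sub r by auto
        have e: "\<bar>?D z b e - ?D x b e\<bar> \<le> \<eta>" if "e \<in> Basis" for e
          using dd[OF that, of "(x, b)" "(z, b)"] z sub b r \<delta>d[OF that]
          by (auto simp: dist_Pair_Pair dist_commute dist_real_def)
        show "onorm (?D z b - ?D x b) \<le> real DIM('a) * \<eta>" unfolding fun_diff_def
        proof (rule onorm_le)
          fix v :: 'a
          have "norm (?D z b v - ?D x b v) = \<bar>\<Sum>e\<in>Basis. (v \<bullet> e) * (?D z b e - ?D x b e)\<bar>"
            unfolding Dsum[OF zU, of b v] Dsum[OF x, of b v] by (simp add: sum_subtractf right_diff_distrib)
          also have "\<dots> \<le> (\<Sum>e\<in>Basis. \<bar>v \<bullet> e\<bar> * \<bar>?D z b e - ?D x b e\<bar>)"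
            by (rule order_trans[OF sum_abs]) (simp add: abs_mult)
          also have "\<dots> \<le> (\<Sum>e\<in>(Basis::'a set). norm v * \<eta>)"
            using e by (intro sum_mono mult_mono Basis_le_norm) auto
          finally show "norm (?D z b v - ?D x b v) \<le> real DIM('a) * \<eta> * norm v" by (simp add: mult_ac)
        qed
      next
        show "x \<in> ball x \<delta>" using \<delta> by simp
      qed
      then show ?thesis by simp
    qed
    show "\<exists>d>0. \<forall>y. norm (y - x) < d \<longrightarrow>
       norm ((LBINT b. \<Phi> (y, b) * w b) - (LBINT b. \<Phi> (x, b) * w b)
          - (LBINT b. ?D x b (y - x) * w b)) \<le> \<epsilon> * norm (y - x)"
    proof (intro exI[of _ \<delta>] conjI allI impI \<delta>)
      fix y assume y: "norm (y - x) < \<delta>"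
      then have "y \<in> cball x r" unfolding \<delta>_def by (auto simp: dist_norm norm_minus_commute)
      then have yU: "y \<in> U" using r by auto
      let ?R = "\<lambda>b. \<Phi> (y, b) - \<Phi> (x, b) - ?D x b (y - x)"
      have "(LBINT b. \<Phi> (y, b) * w b) - (LBINT b. \<Phi> (x, b) * w b)
          - (LBINT b. ?D x b (y - x) * w b) = (LBINT b. ?R b * w b)"
        using int\<Phi>[OF x] int\<Phi>[OF yU] intD[OF x] by (simp add: left_diff_distrib)
      also have "norm \<dots> \<le> (LBINT b. norm (y - x) * (real DIM('a) * \<eta>) * norm (indicator L b *\<^sub>R w b))"
      proof (rule Bochner_Integration.integral_norm_bound_integral)
        show "integrable lborel (\<lambda>b. ?R b * w b)"
          using int\<Phi>[OF x] int\<Phi>[OF yU] intD[OF x] by (simp add: left_diff_distrib)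
        fix b
        show "norm (?R b * w b) \<le> norm (y - x) * (real DIM('a) * \<eta>) * norm (indicator L b *\<^sub>R w b)"
        proof (cases "b \<in> L")
          case True then show ?thesis using R[OF y True] by (auto simp: abs_mult intro: mult_right_mono)
        next
          case False then show ?thesis using \<Phi>0 x yU D0 by auto
        qed
      qed (use w in auto)
      also have "\<dots> = norm (y - x) * (real DIM('a) * \<eta>) * W"
        unfolding W_def using w by simp
      also have "\<dots> = norm (y - x) * \<epsilon> * (W / (W + 1))" 
      proof -
        have "real DIM('a) * \<eta> = \<epsilon> / (W + 1)" unfolding \<eta>_def by simp
        then show ?thesis by simp
      qed
      also have "\<dots> \<le> norm (y - x) * \<epsilon> * 1" 
        using W \<epsilon> by (intro mult_left_mono) auto
      finally show "norm ((LBINT b. \<Phi> (y, b) * w b) - (LBINT b. \<Phi> (x, b) * w b)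
          - (LBINT b. ?D x b (y - x) * w b)) \<le> \<epsilon> * norm (y - x)" by (simp add: mult.commute)
    qed
  qed
qed

text \<open>All derivatives fall on \<open>\<Phi>\<close>, so \<open>w\<close> may be singular. Order \<open>n + 1\<close> of \<open>\<Phi>\<close> is used for order \<open>n\<close> of the
integral because \<open>ndiff\<close> of order \<open>n\<close> says nothing about continuity of the highest derivative.\<close>

lemma ndiff_parametric_integral:
  fixes \<Phi> :: "'a::euclidean_space \<times> 'b::euclidean_space \<Rightarrow> real" and w :: "'b \<Rightarrow> real"
  assumes U: "open U" and L: "compact L" and w: "integrable lborel (\<lambda>b. indicator L b *\<^sub>R w b)"
  shows "ndiff (U \<times> UNIV) (Suc n) \<Phi> \<Longrightarrow> (\<And>x b. x \<in> U \<Longrightarrow> b \<notin> L \<Longrightarrow> \<Phi> (x, b) = 0) \<Longrightarrow>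
    ndiff U n (\<lambda>x. LBINT b. \<Phi> (x, b) * w b)"
proof (induction n arbitrary: \<Phi>)
  case 0
  then show ?case using has_derivative_parametric_integral[OF U L w 0(1) 0(2)] 
    by (auto simp: differentiable_def)
next
  case (Suc n)
  have 1: "ndiff (U \<times> UNIV) (Suc 0) \<Phi>" using Suc.prems(1) ndiff_differentiable by (auto simp: Basis_prod_def)
  show ?case
  proof (rule ndiff_SucI[OF U has_derivative_parametric_integral[OF U L w 1 Suc.prems(2)]])
    fix v :: 'a assume v: "v \<in> Basis"
    show "ndiff U n (\<lambda>x. LBINT b. frechet_derivative \<Phi> (at (x, b)) (v, 0) * w b)"
    proof (rule Suc.IH)
      show "ndiff (U \<times> UNIV) (Suc n) (\<lambda>z. frechet_derivative \<Phi> (at z) (v, 0))"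
        using Suc.prems(1) v unfolding ndiff.simps(2)[of _ "Suc n"] by (auto simp: Basis_prod_def)
    next
      fix x b assume xb: "x \<in> U" "b \<notin> L"
      have op: "open (U \<times> (- L))" using U L by (intro open_Times) (auto simp: compact_imp_closed)
      have "(\<Phi> has_derivative (\<lambda>_. 0)) (at (x, b))"
        by (rule has_derivative_transform_within_open[OF _ op, of "\<lambda>_. 0"])
           (use xb Suc.prems(2) in auto)
      then show "frechet_derivative \<Phi> (at (x, b)) (v, 0) = 0"
        using frechet_derivative_at by metis
    qed
  qed
qed

section \<open>Iterated integrals and affine substitutions\<close>

lemma lborel_fubini_integrable:
  fixes f :: "'a::euclidean_space \<times> 'b::euclidean_space \<Rightarrow> 'c::{banach, second_countable_topology}"
  assumes "f \<in> borel_measurable borel" "integrable lborel (\<lambda>x. LBINT y. norm (f (x, y)))"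
    and "AE x in lborel. integrable lborel (\<lambda>y. f (x, y))"
  shows "integrable lborel f"
  using lborel_pair.Fubini_integrable[of f] assms by (simp add: lborel_prod)

lemma lborel_fubini_fst:
  fixes f :: "'a::euclidean_space \<times> 'b::euclidean_space \<Rightarrow> 'c::{banach, second_countable_topology}"
  assumes "integrable lborel f"
  shows "(LBINT x. LBINT y. f (x, y)) = (LBINT z. f z)"
  using lborel_pair.integral_fst'[of f] assms by (simp add: lborel_prod)

lemma lborel_fubini_snd:
  fixes f :: "'a::euclidean_space \<times> 'b::euclidean_space \<Rightarrow> 'c::{banach, second_countable_topology}"
  assumes "integrable lborel f"
  shows "(LBINT y. LBINT x. f (x, y)) = (LBINT z. f z)"
  using lborel_pair.integral_snd[of "\<lambda>x y. f (x, y)"] assms by (simp add: lborel_prod split_beta')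

lemma lborel_fubini_integrable_fst:
  fixes f :: "'a::euclidean_space \<times> 'b::euclidean_space \<Rightarrow> 'c::{banach, second_countable_topology}"
  assumes "integrable lborel f"
  shows "integrable lborel (\<lambda>x. LBINT y. f (x, y))"
  using lborel_pair.integrable_fst'[of f] assms by (simp add: lborel_prod)

lemma lborel_fubini_swap:
  fixes f :: "'a::euclidean_space \<Rightarrow> 'b::euclidean_space \<Rightarrow> 'c::{banach, second_countable_topology}"
  assumes "integrable lborel (\<lambda>(x, y). f x y)"
  shows "(LBINT x. LBINT y. f x y) = (LBINT y. LBINT x. f x y)"
  using lborel_fubini_fst[OF assms] lborel_fubini_snd[OF assms] by simp

lemma lborel_nn_integral_fst:
  fixes f :: "'a::euclidean_space \<times> 'b::euclidean_space \<Rightarrow> ennreal"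
  assumes "f \<in> borel_measurable borel"
  shows "(\<integral>\<^sup>+x. \<integral>\<^sup>+y. f (x, y) \<partial>lborel \<partial>lborel) = (\<integral>\<^sup>+z. f z \<partial>lborel)"
  using lborel.nn_integral_fst[of f lborel] assms by (simp add: lborel_prod)

lemma lborel_nn_integral_snd:
  fixes f :: "'a::euclidean_space \<times> 'b::euclidean_space \<Rightarrow> ennreal"
  assumes "f \<in> borel_measurable borel"
  shows "(\<integral>\<^sup>+y. \<integral>\<^sup>+x. f (x, y) \<partial>lborel \<partial>lborel) = (\<integral>\<^sup>+z. f z \<partial>lborel)"
  using lborel_pair.nn_integral_snd[of f] assms by (simp add: lborel_prod split_beta')

lemma integrable_dominated:
  fixes f :: "'a \<Rightarrow> 'c::{banach, second_countable_topology}"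
  assumes "integrable M g" "f \<in> borel_measurable M" "\<And>x. norm (f x) \<le> g x"
  shows "integrable M f"
proof (rule Bochner_Integration.integrable_bound[OF assms(1,2)])
  show "AE x in M. norm (f x) \<le> norm (g x)"
    unfolding real_norm_def by (rule AE_I2, rule order_trans[OF assms(3) abs_ge_self])
qed

lemma integrable_dominated_nn:
  fixes f :: "'a \<Rightarrow> 'c::{banach, second_countable_topology}"
  assumes f: "f \<in> borel_measurable M" and B: "integrable N B" "AE x in N. 0 \<le> B x"
    and le: "(\<integral>\<^sup>+x. norm (f x) \<partial>M) \<le> (\<integral>\<^sup>+x. B x \<partial>N)"
  shows "integrable M f" and "(\<integral>x. norm (f x) \<partial>M) \<le> (\<integral>x. B x \<partial>N)"
proof -
  have B': "(\<integral>\<^sup>+x. B x \<partial>N) = ennreal (\<integral>x. B x \<partial>N)" by (rule nn_integral_eq_integral[OF B])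
  show i: "integrable M f" using f order.strict_trans1[OF le] unfolding B' by (intro integrableI_bounded) auto
  have "ennreal (\<integral>x. norm (f x) \<partial>M) \<le> ennreal (\<integral>x. B x \<partial>N)"
    using le unfolding B' by (subst (asm) nn_integral_eq_integral[OF integrable_norm[OF i]]) auto
  then show "(\<integral>x. norm (f x) \<partial>M) \<le> (\<integral>x. B x \<partial>N)"
    using integral_nonneg_AE[OF B(2)] by (simp add: ennreal_le_iff)
qed

lemma nn_integral_le_dominating:
  fixes g :: "'a \<Rightarrow> real"
  assumes "integrable M g" "(\<integral>x. g x \<partial>M) \<le> b" "\<And>x. norm (f x) \<le> g x"
  shows "(\<integral>\<^sup>+x. norm (f x) \<partial>M) \<le> ennreal b" and "0 \<le> b"
proof -
  have g0: "0 \<le> g x" for x using order_trans[OF norm_ge_zero assms(3)] .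
  have "(\<integral>\<^sup>+x. norm (f x) \<partial>M) \<le> (\<integral>\<^sup>+x. g x \<partial>M)" by (intro nn_integral_mono ennreal_leI assms(3))
  also have "\<dots> = ennreal (\<integral>x. g x \<partial>M)" using g0 by (intro nn_integral_eq_integral assms(1)) auto
  also have "\<dots> \<le> ennreal b" by (rule ennreal_leI[OF assms(2)])
  finally show "(\<integral>\<^sup>+x. norm (f x) \<partial>M) \<le> ennreal b" .
  show "0 \<le> b" using order_trans[OF _ assms(2)] g0 by simp
qed

text \<open>Tonelli with a majorant \<open>g x\<close> for every slice and a bound \<open>B\<close> for the integrals of the majorants. Working with
nonnegative integrals means that the slice integrals of \<open>f\<close> itself never have to be shown measurable.\<close>

lemma lborel_integrable_iterated_fst:
  fixes f :: "'a::euclidean_space \<times> 'b::euclidean_space \<Rightarrow> 'c::{banach, second_countable_topology}"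
  assumes f[measurable]: "f \<in> borel_measurable borel" and B: "integrable lborel B"
    and g: "AE x in lborel. integrable lborel (g x) \<and> (LBINT y. g x y) \<le> B x \<and> (\<forall>y. norm (f (x, y)) \<le> g x y)"
  shows "integrable lborel f" and "(LBINT u. norm (f u)) \<le> (LBINT x. B x)"
proof -
  have "(\<integral>\<^sup>+u. norm (f u) \<partial>lborel) = (\<integral>\<^sup>+x. \<integral>\<^sup>+y. norm (f (x, y)) \<partial>lborel \<partial>lborel)"
    by (rule lborel_nn_integral_fst[symmetric]) measurable
  also have "\<dots> \<le> (\<integral>\<^sup>+x. B x \<partial>lborel)"
  proof (rule nn_integral_mono_AE)
    show "AE x in lborel. (\<integral>\<^sup>+y. norm (f (x, y)) \<partial>lborel) \<le> ennreal (B x)" using g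
    proof eventually_elim
      case (elim x)
      then show ?case using nn_integral_le_dominating(1)[of lborel "g x" "B x" "\<lambda>y. f (x, y)"] by simp
    qed
  qed
  finally have le: "(\<integral>\<^sup>+u. norm (f u) \<partial>lborel) \<le> (\<integral>\<^sup>+x. B x \<partial>lborel)" .
  have B0: "AE x in lborel. 0 \<le> B x"
    using g
  proof eventually_elim
    case (elim x)
    then show ?case using nn_integral_le_dominating(2)[of lborel "g x" "B x" "\<lambda>y. f (x, y)"] by simp
  qed
  show "integrable lborel f" "(LBINT u. norm (f u)) \<le> (LBINT x. B x)"
    by (rule integrable_dominated_nn[OF _ B B0 le]; simp)+
qed

lemma lborel_integrable_iterated_snd:
  fixes f :: "'a::euclidean_space \<times> 'b::euclidean_space \<Rightarrow> 'c::{banach, second_countable_topology}"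
  assumes f[measurable]: "f \<in> borel_measurable borel" and B: "integrable lborel B"
    and g: "AE y in lborel. integrable lborel (g y) \<and> (LBINT x. g y x) \<le> B y \<and> (\<forall>x. norm (f (x, y)) \<le> g y x)"
  shows "integrable lborel f" and "(LBINT u. norm (f u)) \<le> (LBINT y. B y)"
proof -
  have "(\<integral>\<^sup>+u. norm (f u) \<partial>lborel) = (\<integral>\<^sup>+y. \<integral>\<^sup>+x. norm (f (x, y)) \<partial>lborel \<partial>lborel)"
    by (rule lborel_nn_integral_snd[symmetric]) measurable
  also have "\<dots> \<le> (\<integral>\<^sup>+y. B y \<partial>lborel)"
  proof (rule nn_integral_mono_AE)
    show "AE y in lborel. (\<integral>\<^sup>+x. norm (f (x, y)) \<partial>lborel) \<le> ennreal (B y)" using g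
    proof eventually_elim
      case (elim y)
      then show ?case using nn_integral_le_dominating(1)[of lborel "g y" "B y" "\<lambda>x. f (x, y)"] by simp
    qed
  qed
  finally have le: "(\<integral>\<^sup>+u. norm (f u) \<partial>lborel) \<le> (\<integral>\<^sup>+y. B y \<partial>lborel)" .
  have B0: "AE y in lborel. 0 \<le> B y"
    using g
  proof eventually_elim
    case (elim y)
    then show ?case using nn_integral_le_dominating(2)[of lborel "g y" "B y" "\<lambda>x. f (x, y)"] by simp
  qed
  show "integrable lborel f" "(LBINT u. norm (f u)) \<le> (LBINT y. B y)"
    by (rule integrable_dominated_nn[OF _ B B0 le]; simp)+
qed

lemma lborel_integrable_product:
  fixes f :: "'a::euclidean_space \<Rightarrow> 'c::{banach, second_countable_topology, real_normed_field}"
    and g :: "'b::euclidean_space \<Rightarrow> 'c"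
  assumes f: "integrable lborel f" and g: "integrable lborel g"
  shows "integrable lborel (\<lambda>(x, y). f x * g y)"
proof (rule lborel_fubini_integrable)
  have [measurable]: "f \<in> borel_measurable borel" "g \<in> borel_measurable borel" using f g by auto
  show "(\<lambda>(x, y). f x * g y) \<in> borel_measurable borel" unfolding borel_prod[symmetric] by measurable
qed (use f g in \<open>auto simp: norm_mult\<close>)

lemma lborel_integral_product:
  fixes f :: "'a::euclidean_space \<Rightarrow> 'c::{banach, second_countable_topology, real_normed_field}"
    and g :: "'b::euclidean_space \<Rightarrow> 'c"
  assumes f: "integrable lborel f" and g: "integrable lborel g"
  shows "(LBINT z. f (fst z) * g (snd z)) = (LBINT x. f x) * (LBINT y. g y)"
  using lborel_fubini_fst[OF lborel_integrable_product[OF f g]] f g by (simp add: split_beta')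

lemma lborel_nn_integral_product:
  fixes f :: "'a::euclidean_space \<Rightarrow> ennreal" and g :: "'b::euclidean_space \<Rightarrow> ennreal"
  assumes [measurable]: "f \<in> borel_measurable borel" "g \<in> borel_measurable borel"
  shows "(\<integral>\<^sup>+z. f (fst z) * g (snd z) \<partial>lborel) = (\<integral>\<^sup>+x. f x \<partial>lborel) * (\<integral>\<^sup>+y. g y \<partial>lborel)"
proof -
  have "(\<lambda>z. f (fst z) * g (snd z)) \<in> borel_measurable borel" unfolding borel_prod[symmetric] by measurable
  from lborel_nn_integral_fst[OF this, symmetric] show ?thesis
    by (simp add: nn_integral_cmult nn_integral_multc)
qed

lemma integrable_scaleR_iff:
  fixes f :: "'a \<Rightarrow> 'c::{banach, second_countable_topology}"
  assumes "c \<noteq> 0"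
  shows "integrable M (\<lambda>x. c *\<^sub>R f x) \<longleftrightarrow> integrable M f"
proof
  assume "integrable M (\<lambda>x. c *\<^sub>R f x)"
  from integrable_scaleR_right[OF this, of "1/c"] show "integrable M f" using assms by simp
qed simp

lemma lborel_integrable_affine:
  fixes f :: "'a::euclidean_space \<Rightarrow> 'c::{banach, second_countable_topology}"
  assumes "c \<noteq> 0" and [measurable]: "f \<in> borel_measurable borel"
  shows "integrable lborel (\<lambda>x. f (t + c *\<^sub>R x)) \<longleftrightarrow> integrable lborel f"
proof -
  have "integrable lborel f \<longleftrightarrow> integrable (density (distr lborel borel (\<lambda>x. t + c *\<^sub>R x)) (\<lambda>_. \<bar>c\<bar>^DIM('a))) f"
    using lborel_affine[OF assms(1), of t] by metis
  also have "\<dots> \<longleftrightarrow> integrable lborel (\<lambda>x. f (t + c *\<^sub>R x))"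
    using assms(1) by (subst integrable_density) (auto simp: integrable_distr_eq integrable_scaleR_iff)
  finally show ?thesis ..
qed

lemma lborel_integral_affine:
  fixes f :: "'a::euclidean_space \<Rightarrow> 'c::{banach, second_countable_topology}"
  assumes "c \<noteq> 0" and [measurable]: "f \<in> borel_measurable borel"
  shows "(LBINT x. f x) = \<bar>c\<bar>^DIM('a) *\<^sub>R (LBINT x. f (t + c *\<^sub>R x))"
proof -
  have "(LBINT x. f x) = (\<integral>x. f x \<partial>density (distr lborel borel (\<lambda>x. t + c *\<^sub>R x)) (\<lambda>_. \<bar>c\<bar>^DIM('a)))"
    using lborel_affine[OF assms(1), of t] by metis
  also have "\<dots> = \<bar>c\<bar>^DIM('a) *\<^sub>R (LBINT x. f (t + c *\<^sub>R x))"
    by (subst integral_density) (auto simp: integral_distr)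
  finally show ?thesis .
qed

section \<open>Coordinates on three-space\<close>

text \<open>The product type carries the Euclidean norm, so the horizontal part of a vector has its usual length.\<close>

definition coords :: "plane\<times>real \<Rightarrow> real^3" where
  "coords u = vector [fst (fst u), snd (fst u), snd u]"

lemma coords_nth [simp]: "coords u $ 1 = fst (fst u)" "coords u $ 2 = snd (fst u)" "coords u $ 3 = snd u"
  by (simp_all add: coords_def)

lemma UNIV_3_set: "(UNIV :: 3 set) = {1, 2, 3}" using UNIV_3 by blast

lemma linear_coords: "linear coords"
  by (rule linearI) (simp_all add: vec_eq_iff forall_3)

lemma measurable_coords [measurable]: "coords \<in> borel_measurable borel"
  using linear_coords by (intro borel_measurable_continuous_onI linear_continuous_on linear_conv_bounded_linear[THEN iffD1])

lemma prod_Basis_vec3: "(\<Prod>b\<in>(Basis::(real^3) set). f b) = f (axis 1 1) * f (axis 2 1) * f (axis 3 1)"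
proof -
  have B: "(Basis::(real^3) set) = {axis 1 1, axis 2 1, axis 3 1}"
    unfolding Basis_vec_def Basis_real_def UNIV_3_set by auto
  have ne: "axis 1 1 \<noteq> (axis 2 1::real^3)" "axis 1 1 \<noteq> (axis 3 1::real^3)" "axis 2 1 \<noteq> (axis 3 1::real^3)"
    by (auto simp: axis_eq_axis)
  show ?thesis unfolding B using ne by (simp add: mult.assoc)
qed

lemma distr_coords: "distr lborel borel coords = (lborel :: (real^3) measure)"
proof (rule lborel_eqI[symmetric])
  fix l u :: "real^3" assume "\<And>b. b \<in> Basis \<Longrightarrow> l \<bullet> b \<le> u \<bullet> b"
  then have le: "l $ i \<le> u $ i" for i 
    by (metis axis_in_Basis_iff inner_axis' inner_commute inner_real_def mult.right_neutral Basis_real_def singletonI mult_1)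
  have "coords -` box l u = (box (l$1) (u$1) \<times> box (l$2) (u$2)) \<times> box (l$3) (u$3)"
    by (auto simp: box_def Basis_vec_def UNIV_3_set inner_axis)
  then have "emeasure (distr lborel borel coords) (box l u) =
     emeasure lborel ((box (l$1) (u$1) \<times> box (l$2) (u$2)) \<times> box (l$3) (u$3))"
    by (subst emeasure_distr) auto
  also have "\<dots> = ennreal (u$1 - l$1) * ennreal (u$2 - l$2) * ennreal (u$3 - l$3)"
    using le unfolding lborel_prod[symmetric]
    by (subst lborel.emeasure_pair_measure_Times; simp)+
  also have "\<dots> = ennreal (\<Prod>b\<in>Basis. (u - l) \<bullet> b)"
    using le by (simp add: prod_Basis_vec3 inner_axis ennreal_mult)
  finally show "emeasure (distr lborel borel coords) (box l u) = (\<Prod>b\<in>Basis. (u - l) \<bullet> b)" .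
qed simp

lemma lborel_integral_coords:
  fixes f :: "real^3 \<Rightarrow> 'c::{banach, second_countable_topology}"
  assumes [measurable]: "f \<in> borel_measurable borel"
  shows "(LBINT x. f x) = (LBINT u. f (coords u))"
  by (subst distr_coords[symmetric]) (simp add: integral_distr)

lemma lborel_nn_integral_coords:
  fixes f :: "real^3 \<Rightarrow> ennreal"
  assumes [measurable]: "f \<in> borel_measurable borel"
  shows "(\<integral>\<^sup>+x. f x \<partial>lborel) = (\<integral>\<^sup>+u. f (coords u) \<partial>lborel)"
  by (subst distr_coords[symmetric]) (simp add: nn_integral_distr)

lemma lborel_integrable_coords:
  fixes f :: "real^3 \<Rightarrow> 'c::{banach, second_countable_topology}"
  assumes [measurable]: "f \<in> borel_measurable borel"
  shows "integrable lborel f \<longleftrightarrow> integrable lborel (\<lambda>u. f (coords u))"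
  by (subst distr_coords[symmetric]) (simp add: integrable_distr_eq)

section \<open>Rotations of the plane\<close>

lemma distr_shear_fst: "distr lborel borel (\<lambda>(x, y). (x + k * y, y)) = (lborel :: plane measure)"
proof (rule measure_eqI)
  fix A :: "plane set" assume "A \<in> sets (distr lborel borel (\<lambda>(x, y). (x + k * y, y)))"
  then have [measurable]: "A \<in> sets borel" by simp
  have m[measurable]: "(\<lambda>(x::real, y::real). (x + k * y, y)) \<in> borel_measurable borel"
    by (intro borel_measurable_continuous_onI) (auto simp: split_beta' intro!: continuous_intros)
  have i: "(\<lambda>z. indicator A z :: ennreal) \<in> borel_measurable borel" by measurable
  have "emeasure (distr lborel borel (\<lambda>(x, y). (x + k * y, y))) A =
      (\<integral>\<^sup>+z. indicator A z \<partial>distr lborel borel (\<lambda>(x, y). (x + k * y, y)))"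
    by simp
  also have "\<dots> = (\<integral>\<^sup>+z. indicator A (case z of (x, y) \<Rightarrow> (x + k * y, y)) \<partial>lborel)"
    by (subst nn_integral_distr) auto
  also have "\<dots> = (\<integral>\<^sup>+y. \<integral>\<^sup>+x. indicator A (x + k * y, y) \<partial>lborel \<partial>lborel)"
    using lborel_nn_integral_snd[OF measurable_compose[OF m i]] by simp
  also have "\<dots> = (\<integral>\<^sup>+y. \<integral>\<^sup>+x. indicator A (x, y) \<partial>lborel \<partial>lborel)"
  proof (rule nn_integral_cong)
    fix y
    have "(\<lambda>x. indicator A (x, y) :: ennreal) \<in> borel_measurable borel"
      by (rule measurable_compose[OF _ i]) (auto intro!: borel_measurable_continuous_onI continuous_intros)
    from nn_integral_real_affine[OF this, of 1 "k * y"]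
    show "(\<integral>\<^sup>+x. indicator A (x + k * y, y) \<partial>lborel) = (\<integral>\<^sup>+x. indicator A (x, y) \<partial>lborel)"
      by (simp add: add.commute)
  qed
  also have "\<dots> = emeasure lborel A" using lborel_nn_integral_snd[OF i] by simp
  finally show "emeasure (distr lborel borel (\<lambda>(x, y). (x + k * y, y))) A = emeasure lborel A" .
qed simp

lemma distr_shear_snd: "distr lborel borel (\<lambda>(x, y). (x, y + k * x)) = (lborel :: plane measure)"
proof (rule measure_eqI)
  fix A :: "plane set" assume "A \<in> sets (distr lborel borel (\<lambda>(x, y). (x, y + k * x)))"
  then have [measurable]: "A \<in> sets borel" by simp
  have m[measurable]: "(\<lambda>(x::real, y::real). (x, y + k * x)) \<in> borel_measurable borel"
    by (intro borel_measurable_continuous_onI) (auto simp: split_beta' intro!: continuous_intros)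
  have i: "(\<lambda>z. indicator A z :: ennreal) \<in> borel_measurable borel" by measurable
  have "emeasure (distr lborel borel (\<lambda>(x, y). (x, y + k * x))) A =
      (\<integral>\<^sup>+z. indicator A z \<partial>distr lborel borel (\<lambda>(x, y). (x, y + k * x)))"
    by simp
  also have "\<dots> = (\<integral>\<^sup>+z. indicator A (case z of (x, y) \<Rightarrow> (x, y + k * x)) \<partial>lborel)"
    by (subst nn_integral_distr) auto
  also have "\<dots> = (\<integral>\<^sup>+x. \<integral>\<^sup>+y. indicator A (x, y + k * x) \<partial>lborel \<partial>lborel)"
    using lborel_nn_integral_fst[OF measurable_compose[OF m i]] by simp
  also have "\<dots> = (\<integral>\<^sup>+x. \<integral>\<^sup>+y. indicator A (x, y) \<partial>lborel \<partial>lborel)"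
  proof (rule nn_integral_cong)
    fix x
    have "(\<lambda>y. indicator A (x, y) :: ennreal) \<in> borel_measurable borel"
      by (rule measurable_compose[OF _ i]) (auto intro!: borel_measurable_continuous_onI continuous_intros)
    from nn_integral_real_affine[OF this, of 1 "k * x"]
    show "(\<integral>\<^sup>+y. indicator A (x, y + k * x) \<partial>lborel) = (\<integral>\<^sup>+y. indicator A (x, y) \<partial>lborel)"
      by (simp add: add.commute)
  qed
  also have "\<dots> = emeasure lborel A" using lborel_nn_integral_fst[OF i] by simp
  finally show "emeasure (distr lborel borel (\<lambda>(x, y). (x, y + k * x))) A = emeasure lborel A" .
qed simp

text \<open>A rotation by an angle other than \<open>0\<close> and \<open>pi\<close> is the composition of three shears, and shears preserve the
measure by Fubini and invariance under translations.\<close>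

lemma distr_rotation:
  fixes c d :: real
  assumes cd: "c\<^sup>2 + d\<^sup>2 = 1"
  shows "distr lborel borel (\<lambda>(x, y). (c * x + d * y, c * y - d * x)) = (lborel :: plane measure)"
proof (cases "d = 0")
  case True
  with cd have "c = 1 \<or> c = -1" by (simp add: power2_eq_1_iff)
  then have "(\<lambda>(x, y). (c * x + d * y, c * y - d * x)) = (\<lambda>z. 0 + c *\<^sub>R z)" "c \<noteq> 0" "\<bar>c\<bar> = 1"
    using True by (auto simp: fun_eq_iff)
  then show ?thesis using lborel_affine[of c "0::plane"] by (simp add: density_1)
next
  case False
  \<comment> \<open>the tangent of half the angle\<close>
  define k where "k = (1 - c) / d"
  have kd: "k * d = 1 - c" "k * (1 + c) = d"
  proof -
    show "k * d = 1 - c" unfolding k_def using False by simp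
    have "(1 - c) * (1 + c) = d * d" using cd by (simp add: algebra_simps power2_eq_square)
    then show "k * (1 + c) = d" unfolding k_def using False by (simp add: field_simps)
  qed
  have [measurable]: "(\<lambda>(x::real, y::real). (x + k * y, y)) \<in> borel_measurable borel"
    "(\<lambda>(x::real, y::real). (x, y + - d * x)) \<in> borel_measurable borel"
    by (intro borel_measurable_continuous_onI; auto simp: split_beta' intro!: continuous_intros)+
  have eq: "(\<lambda>(x, y). (c * x + d * y, c * y - d * x)) =
     (\<lambda>(x, y). (x + k * y, y)) \<circ> ((\<lambda>(x, y). (x, y + - d * x)) \<circ> (\<lambda>(x, y). (x + k * y, y)))"
  proof (rule ext, clarify)
    fix x y :: real
    have "x + k * y + k * (y + - d * (x + k * y)) = (1 - k * d) * x + (k * (1 + (1 - k * d))) * y"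
      by (simp add: algebra_simps)
    also have "\<dots> = c * x + d * y" unfolding kd(1) using kd(2) by simp
    finally have 1: "x + k * y + k * (y + - d * (x + k * y)) = c * x + d * y" .
    have "y + - d * (x + k * y) = (1 - k * d) * y - d * x"
      by (simp add: algebra_simps)
    also have "\<dots> = c * y - d * x" unfolding kd(1) by simp
    finally have 2: "y + - d * (x + k * y) = c * y - d * x" .
    show "(c * x + d * y, c * y - d * x) = ((\<lambda>(x, y). (x + k * y, y)) \<circ>
       ((\<lambda>(x, y). (x, y + - d * x)) \<circ> (\<lambda>(x, y). (x + k * y, y)))) (x, y)"
      using 1 2 by simp
  qed
  have "distr lborel borel (\<lambda>(x, y). (c * x + d * y, c * y - d * x)) =
     distr (distr (distr lborel borel (\<lambda>(x, y). (x + k * y, y))) borel (\<lambda>(x, y). (x, y + - d * x)))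
       borel (\<lambda>(x, y). (x + k * y, y))"
    unfolding eq by (subst distr_distr, measurable)+ (simp add: o_assoc)
  then show ?thesis unfolding distr_shear_fst distr_shear_snd .
qed

section \<open>Fourier transforms of Gaussians\<close>

definition phase :: "real \<Rightarrow> complex" where
  "phase r = exp (- 2 * of_real pi * \<i> * of_real r)"

lemma norm_phase [simp]: "norm (phase r) = 1"
proof -
  have "phase r = exp (\<i> * of_real (- 2 * pi * r))" unfolding phase_def by (simp add: mult_ac)
  then show ?thesis using norm_exp_i_times by metis
qed

lemma phase_add: "phase (a + b) = phase a * phase b"
  unfolding phase_def by (simp add: algebra_simps flip: exp_add)

lemma continuous_on_phase [continuous_intros]:
  "continuous_on S f \<Longrightarrow> continuous_on S (\<lambda>x. phase (f x))"
  unfolding phase_def by (intro continuous_intros)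

lemma measurable_phase [measurable]: "phase \<in> borel_measurable borel"
  by (intro borel_measurable_continuous_onI continuous_intros)

lemma gauss_eq_normal_density:
  assumes "t > 0"
  shows "exp (- pi * t * x\<^sup>2) = 1 / sqrt t * normal_density 0 (1 / sqrt (2 * pi * t)) x"
  using assms by (simp add: normal_density_def field_simps real_sqrt_divide real_sqrt_mult)

lemma integrable_gauss: "t > 0 \<Longrightarrow> integrable lborel (\<lambda>x::real. exp (- pi * t * x\<^sup>2))"
  by (subst gauss_eq_normal_density) (auto intro!: integrable_mult_right)

lemma integral_gauss:
  assumes "t > 0"
  shows "(LBINT x. exp (- pi * t * x\<^sup>2)) = 1 / sqrt t"
proof -
  have "(LBINT x. exp (- pi * t * x\<^sup>2)) = (LBINT x. 1 / sqrt t * normal_density 0 (1 / sqrt (2 * pi * t)) x)"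
    using gauss_eq_normal_density[OF assms] by simp
  also have "\<dots> = 1 / sqrt t * (LBINT x. normal_density 0 (1 / sqrt (2 * pi * t)) x)"
    by (rule integral_mult_right_zero)
  also have "\<dots> = 1 / sqrt t" using assms by simp
  finally show ?thesis .
qed

lemma integrable_gauss_phase:
  assumes "t > 0"
  shows "integrable lborel (\<lambda>x. of_real (exp (- pi * t * x\<^sup>2)) * phase (x * y))"
  by (rule Bochner_Integration.integrable_bound[OF integrable_gauss[OF assms]]) (auto simp: norm_mult)

text \<open>This is the characteristic function of the standard normal distribution after scaling by \<open>sqrt (2 * pi * t)\<close>.\<close>

lemma integral_gauss_phase:
  assumes t: "t > 0"
  shows "(LBINT x. of_real (exp (- pi * t * x\<^sup>2)) * phase (x * y)) =
    of_real (exp (- pi * y\<^sup>2 / t) / sqrt t)"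
proof -
  define c where "c = sqrt (2 * pi * t)"
  have c: "c > 0" "c\<^sup>2 = 2 * pi * t" "c = sqrt (2 * pi) * sqrt t"
    using t unfolding c_def by (simp, simp, simp only: real_sqrt_mult)
  define Y where "Y = - 2 * pi * y / c"
  let ?I = "LBINT x. of_real (exp (- pi * t * x\<^sup>2)) * phase (x * y)"
  have "of_real (exp (- (Y\<^sup>2) / 2)) = char std_normal_distribution Y"
    by (simp add: char_std_normal_distribution)
  also have "\<dots> = (LBINT x. std_normal_density x *\<^sub>R iexp (Y * x))"
    unfolding char_def by (subst integral_density) (auto simp: normal_density_nonneg)
  also have "\<dots> = \<bar>c\<bar> *\<^sub>R (LBINT x. std_normal_density (0 + c * x) *\<^sub>R iexp (Y * (0 + c * x)))"
    by (rule lborel_integral_real_affine) (use c in auto)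
  also have "(LBINT x. std_normal_density (0 + c * x) *\<^sub>R iexp (Y * (0 + c * x))) =
      (LBINT x. of_real (1 / sqrt (2 * pi)) * (of_real (exp (- pi * t * x\<^sup>2)) * phase (x * y)))"
  proof (rule Bochner_Integration.integral_cong[OF refl])
    fix x
    have "(c * x)\<^sup>2 / 2 = pi * t * x\<^sup>2" using c by (simp add: power_mult_distrib)
    then have "std_normal_density (0 + c * x) = 1 / sqrt (2 * pi) * exp (- pi * t * x\<^sup>2)"
      by (simp add: std_normal_density_def)
    moreover have "Y * (0 + c * x) = - 2 * pi * (x * y)" using c(1) unfolding Y_def by simp
    then have "iexp (Y * (0 + c * x)) = phase (x * y)"
      unfolding phase_def by (simp add: mult_ac)
    ultimately show "std_normal_density (0 + c * x) *\<^sub>R iexp (Y * (0 + c * x)) =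
      of_real (1 / sqrt (2 * pi)) * (of_real (exp (- pi * t * x\<^sup>2)) * phase (x * y))"
      by (simp add: scaleR_conv_of_real)
  qed
  also have "\<dots> = of_real (1 / sqrt (2 * pi)) * ?I" by (rule integral_mult_right_zero)
  also have "\<bar>c\<bar> *\<^sub>R (of_real (1 / sqrt (2 * pi)) * ?I) = of_real (sqrt t) * ?I"
    using c by (simp add: scaleR_conv_of_real)
  finally have "?I = of_real (exp (- (Y\<^sup>2) / 2)) / of_real (sqrt t)" using t by (simp add: field_simps)
  moreover have "- (Y\<^sup>2) / 2 = - pi * y\<^sup>2 / t"
    unfolding Y_def power_divide c(2) using t by (simp add: field_simps power2_eq_square)
  ultimately show ?thesis by simp
qed

lemma norm_plane: "norm (z::plane)^2 = (fst z)\<^sup>2 + (snd z)\<^sup>2"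
  by (simp add: norm_prod_def)

lemma integrable_gauss2: "t > 0 \<Longrightarrow> integrable lborel (\<lambda>z::plane. exp (- pi * t * (norm z)\<^sup>2))"
  using lborel_integrable_product[OF integrable_gauss integrable_gauss, of t t]
  by (simp add: norm_plane split_beta' algebra_simps flip: exp_add)

lemma integral_gauss2:
  assumes "t > 0" shows "(LBINT z. exp (- pi * t * (norm (z::plane))\<^sup>2)) = 1 / t"
proof -
  have "(LBINT z. exp (- pi * t * (norm (z::plane))\<^sup>2))
    = (LBINT z. exp (- pi * t * (fst (z::plane))\<^sup>2) * exp (- pi * t * (snd z)\<^sup>2))"
    by (simp add: norm_plane algebra_simps flip: exp_add)
  also have "\<dots> = 1 / sqrt t * (1 / sqrt t)" 
    using assms by (subst lborel_integral_product) (simp_all only: integrable_gauss integral_gauss)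
  finally show ?thesis using assms by simp
qed

lemma integral_gauss2_phase:
  fixes w :: "plane"
  assumes t: "t > 0"
  shows "(LBINT z. of_real (exp (- pi * t * (norm z)\<^sup>2)) * phase (z \<bullet> w)) =
    of_real (exp (- pi * (norm w)\<^sup>2 / t) / t)"
proof -
  let ?f = "\<lambda>y x. of_real (exp (- pi * t * x\<^sup>2)) * phase (x * y)"
  have eq: "of_real (exp (- pi * t * (norm z)\<^sup>2)) * phase (z \<bullet> w) = ?f (fst w) (fst z) * ?f (snd w) (snd z)" for z
  proof -
    have "exp (- pi * t * (norm z)\<^sup>2) = exp (- pi * t * (fst z)\<^sup>2) * exp (- pi * t * (snd z)\<^sup>2)"
      unfolding norm_plane by (simp add: algebra_simps flip: exp_add)
    moreover have "phase (z \<bullet> w) = phase (fst z * fst w) * phase (snd z * snd w)"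
      by (simp add: inner_prod_def flip: phase_add)
    ultimately show ?thesis by simp
  qed
  have "(LBINT z. of_real (exp (- pi * t * (norm z)\<^sup>2)) * phase (z \<bullet> w))
     = of_real (exp (- pi * (fst w)\<^sup>2 / t) / sqrt t) * of_real (exp (- pi * (snd w)\<^sup>2 / t) / sqrt t)"
    unfolding eq using lborel_integral_product[OF integrable_gauss_phase[OF t] integrable_gauss_phase[OF t]]
      integral_gauss_phase[OF t] by simp
  also have "\<dots> = of_real ((exp (- pi * (fst w)\<^sup>2 / t) * exp (- pi * (snd w)\<^sup>2 / t)) / (sqrt t * sqrt t))"
    by (simp only: of_real_mult of_real_divide times_divide_times_eq)
  also have "exp (- pi * (fst w)\<^sup>2 / t) * exp (- pi * (snd w)\<^sup>2 / t) = exp (- pi * (norm w)\<^sup>2 / t)"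
    unfolding norm_plane by (simp add: distrib_left add_divide_distrib diff_divide_distrib flip: exp_add)
  finally show ?thesis using t by (simp only: real_sqrt_mult_self abs_of_pos)
qed

section \<open>Powers as superpositions of Gaussians\<close>

lemma nn_integral_gamma:
  assumes r: "r > 0" and A: "A > 0"
  shows "(\<integral>\<^sup>+t. ennreal (indicator {0<..} t * t powr (r - 1) * exp (- A * t)) \<partial>lborel)
     = ennreal (Gamma r * A powr (- r))"
proof -
  have eq: "indicator {0<..} t * t powr (r - 1) * exp (- t) = indicator {0..} t * t powr (r - 1) / exp t" for t :: real
    by (auto simp: indicator_def exp_minus field_simps)
  have "(\<integral>\<^sup>+t. ennreal (indicator {0<..} t * t powr (r - 1) * exp (- A * t)) \<partial>lborel)
     = ennreal \<bar>1/A\<bar> * (\<integral>\<^sup>+t. ennreal (indicator {0<..} (0 + (1/A) * t) * (0 + (1/A) * t) powr (r - 1) * exp (- A * (0 + (1/A) * t))) \<partial>lborel)"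
    by (rule nn_integral_real_affine) (use A in auto)
  also have "(\<integral>\<^sup>+t. ennreal (indicator {0<..} (0 + (1/A) * t) * (0 + (1/A) * t) powr (r - 1) * exp (- A * (0 + (1/A) * t))) \<partial>lborel)
     = (\<integral>\<^sup>+t. ennreal ((1/A) powr (r - 1)) * ennreal (indicator {0<..} t * t powr (r - 1) * exp (- t)) \<partial>lborel)"
  proof (rule nn_integral_cong)
    fix t :: real
    have "indicator {0<..} (0 + (1/A) * t) = (indicator {0<..} t :: real)" 
      using A by (auto simp: indicator_def zero_less_divide_iff)
    then have "indicator {0<..} (0 + (1/A) * t) * (0 + (1/A) * t) powr (r - 1) * exp (- A * (0 + (1/A) * t))
       = (1/A) powr (r - 1) * (indicator {0<..} t * t powr (r - 1) * exp (- t))"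
      using A by (auto simp: powr_mult powr_divide indicator_def)
    then show "ennreal (indicator {0<..} (0 + (1/A) * t) * (0 + (1/A) * t) powr (r - 1) * exp (- A * (0 + (1/A) * t)))
      = ennreal ((1/A) powr (r - 1)) * ennreal (indicator {0<..} t * t powr (r - 1) * exp (- t))"
      by (simp add: ennreal_mult')
  qed
  also have "\<dots> = ennreal ((1/A) powr (r - 1)) * ennreal (Gamma r)"
    unfolding eq Gamma_conv_nn_integral_real[OF r] by (rule nn_integral_cmult) measurable
  also have "ennreal \<bar>1/A\<bar> * (ennreal ((1/A) powr (r - 1)) * ennreal (Gamma r)) 
     = ennreal (Gamma r * ((1/A) * (1/A) powr (r - 1)))"
    using A Gamma_real_pos[OF r] by (simp add: ennreal_mult'[symmetric] mult_ac)
  also have "(1/A) * (1/A) powr (r - 1) = A powr (- r)"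
    using A by (simp add: powr_diff powr_minus powr_divide field_simps)
  finally show ?thesis .
qed

text \<open>The substitution \<open>u = pi / t\<close> shows that the value is \<open>Gamma r * pi powr (- r)\<close>.\<close>

definition inv_gamma :: "real \<Rightarrow> real" where
  "inv_gamma r = enn2real (\<integral>\<^sup>+t. ennreal (indicator {0<..} t * t powr (- r - 1) * exp (- pi / t)) \<partial>lborel)"

text \<open>Near \<open>0\<close> the exponential beats the singularity, since \<open>exp (- pi / t) \<le> 2 * t\<^sup>2\<close>; near infinity
\<open>t powr (- r - 1)\<close> is integrable.\<close>

lemma inv_gamma:
  assumes r: "0 < r" "r < 1"
  shows "(\<integral>\<^sup>+t. ennreal (indicator {0<..} t * t powr (- r - 1) * exp (- pi / t)) \<partial>lborel) = ennreal (inv_gamma r)"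
    and "0 < inv_gamma r"
proof -
  let ?f = "\<lambda>t. indicator {0<..} t * t powr (- r - 1) * exp (- pi / t)"
  have bd: "?f t \<le> 2 * indicator {0..1} t + t powr (- r - 1) * indicator {1..} t" for t
  proof (cases "0 < t \<and> t < 1")
    case True
    have "t powr (- r - 1) = t powr (1 - r) / t\<^sup>2" using True by (simp add: powr_diff powr_minus field_simps power2_eq_square)
    moreover have "t powr (1 - r) \<le> 1" using True r by (intro powr_le1) auto
    ultimately have 1: "t powr (- r - 1) \<le> 1 / t\<^sup>2" using True by (simp add: divide_right_mono)
    have "1 + pi / t + (pi / t)\<^sup>2 / 2 \<le> exp (pi / t)"
      using exp_lower_Taylor_quadratic[of "pi / t"] True by simp
    moreover have "(1/t)\<^sup>2 / 2 \<le> (pi / t)\<^sup>2 / 2" using True pi_gt3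
      by (intro divide_right_mono power_mono) (auto simp: divide_right_mono)
    moreover have "0 \<le> pi / t" using True by simp
    ultimately have "1 / (2 * t\<^sup>2) \<le> exp (pi / t)" by (simp add: power_divide)
    then have 2: "exp (- pi / t) \<le> 2 * t\<^sup>2" using True by (simp add: exp_minus field_simps)
    have "t powr (- r - 1) * exp (- pi / t) \<le> (1 / t\<^sup>2) * (2 * t\<^sup>2)" using 1 2 by (rule mult_mono) auto
    then show ?thesis using True by (auto simp: indicator_def)
  next
    case False
    moreover have "exp (- pi) \<le> 3" by (rule order_trans[of _ 1]) auto
    ultimately show ?thesis by (auto simp: indicator_def mult_left_le)
  qed
  have "(\<integral>\<^sup>+t. ennreal (?f t) \<partial>lborel) \<le> 
     (\<integral>\<^sup>+t. ennreal (2 * indicator {0..1} t + t powr (- r - 1) * indicator {1..} t) \<partial>lborel)"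
    by (intro nn_integral_mono ennreal_leI bd)
  also have "\<dots> = (\<integral>\<^sup>+t. ennreal 2 * indicator {0..1} t + ennreal (t powr (- r - 1)) * indicator {1..} t \<partial>lborel)"
    by (intro nn_integral_cong) (auto simp: indicator_def ennreal_plus[symmetric] simp del: ennreal_plus)
  also have "\<dots> = ennreal 2 * emeasure lborel {0..1::real} + (\<integral>\<^sup>+t. ennreal (t powr (- r - 1)) * indicator {1..} t \<partial>lborel)"
    by (subst nn_integral_add) (auto simp: nn_integral_cmult)
  also have "(\<integral>\<^sup>+t. ennreal (t powr (- r - 1)) * indicator {1..} t \<partial>lborel) = ennreal (0 - (- 1 / r))"
  proof -
    have "(\<integral>\<^sup>+t. ennreal (t powr (- r - 1)) * indicator {1..} t \<partial>lborel) = ennreal (0 - (- (1 powr (- r)) / r))"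
    proof (rule nn_integral_FTC_atLeast)
      fix x :: real assume "1 \<le> x"
      then show "DERIV (\<lambda>x. - (x powr (- r)) / r) x :> x powr (- r - 1)"
        using r by (auto intro!: derivative_eq_intros simp: powr_diff powr_minus field_simps)
    next
      have "((\<lambda>x. x powr (- r)) \<longlongrightarrow> 0) at_top" using r by (intro tendsto_neg_powr filterlim_ident) auto
      from tendsto_minus[OF tendsto_divide[OF this tendsto_const[of r]]]
      show "((\<lambda>x. - (x powr (- r)) / r) \<longlongrightarrow> 0) at_top" using r by simp
    qed auto
    then show ?thesis by simp
  qed
  finally have fin: "(\<integral>\<^sup>+t. ennreal (?f t) \<partial>lborel) < top"
    by (rule order.strict_trans1) (simp add: ennreal_mult_less_top)
  show 1: "(\<integral>\<^sup>+t. ennreal (?f t) \<partial>lborel) = ennreal (inv_gamma r)"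
    unfolding inv_gamma_def using fin by simp
  have "(\<integral>\<^sup>+t. ennreal (?f t) \<partial>lborel) \<noteq> 0"
  proof
    assume "(\<integral>\<^sup>+t. ennreal (?f t) \<partial>lborel) = 0"
    then have "AE t in lborel. ennreal (?f t) = 0" by (subst (asm) nn_integral_0_iff_AE) auto
    then have "AE t in lborel. t \<notin> {0<..<1::real}" 
    proof eventually_elim
      case (elim t)
      have "0 < t powr (- r - 1) * exp (- pi / t)" if "0 < t" using that by simp
      then show ?case using elim by (auto simp: ennreal_eq_0_iff simp flip: not_less)
    qed
    then have "{0<..<1::real} \<in> null_sets lborel"
      by (subst (asm) AE_iff_null) (auto simp: greaterThanLessThan_def greaterThan_def lessThan_def Int_def)
    then show False by (simp add: null_sets_def)
  qed
  then show "0 < inv_gamma r" using 1 by (metis ennreal_neg not_le)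
qed

lemma nn_integral_inv_gamma:
  assumes r: "0 < r" "r < 1" and A: "A > 0"
  shows "(\<integral>\<^sup>+t. ennreal (indicator {0<..} t * t powr (- r - 1) * exp (- pi * A / t)) \<partial>lborel)
     = ennreal (inv_gamma r * A powr (- r))"
proof -
  have "(\<integral>\<^sup>+t. ennreal (indicator {0<..} t * t powr (- r - 1) * exp (- pi * A / t)) \<partial>lborel)
     = ennreal \<bar>A\<bar> * (\<integral>\<^sup>+t. ennreal (indicator {0<..} (0 + A * t) * (0 + A * t) powr (- r - 1) * exp (- pi * A / (0 + A * t))) \<partial>lborel)"
    by (rule nn_integral_real_affine) (use A in auto)
  also have "(\<integral>\<^sup>+t. ennreal (indicator {0<..} (0 + A * t) * (0 + A * t) powr (- r - 1) * exp (- pi * A / (0 + A * t))) \<partial>lborel)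
     = (\<integral>\<^sup>+t. ennreal (A powr (- r - 1)) * ennreal (indicator {0<..} t * t powr (- r - 1) * exp (- pi / t)) \<partial>lborel)"
  proof (rule nn_integral_cong)
    fix t :: real
    have "indicator {0<..} (0 + A * t) = (indicator {0<..} t :: real)" 
      using A by (auto simp: indicator_def zero_less_mult_iff)
    then have "indicator {0<..} (0 + A * t) * (0 + A * t) powr (- r - 1) * exp (- pi * A / (0 + A * t))
       = A powr (- r - 1) * (indicator {0<..} t * t powr (- r - 1) * exp (- pi / t))"
      using A by (auto simp: powr_mult indicator_def)
    then show "ennreal (indicator {0<..} (0 + A * t) * (0 + A * t) powr (- r - 1) * exp (- pi * A / (0 + A * t)))
      = ennreal (A powr (- r - 1)) * ennreal (indicator {0<..} t * t powr (- r - 1) * exp (- pi / t))"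
      by (simp add: ennreal_mult')
  qed
  also have "\<dots> = ennreal (A powr (- r - 1)) * ennreal (inv_gamma r)"
    unfolding inv_gamma(1)[OF r, symmetric] by (rule nn_integral_cmult) measurable
  also have "ennreal \<bar>A\<bar> * (ennreal (A powr (- r - 1)) * ennreal (inv_gamma r)) 
     = ennreal (inv_gamma r * (A * A powr (- r - 1)))"
    using A inv_gamma(2)[OF r] by (simp add: ennreal_mult' mult_ac)
  also have "A * A powr (- r - 1) = A powr (- r)"
    using A by (simp add: powr_diff field_simps)
  finally show ?thesis .
qed

text \<open>If a weight \<open>W\<close> is a superposition of nonnegative weights \<open>K(\<cdot>, t)\<close>, integrals against \<open>W\<close> are superpositions of
integrals against \<open>K(\<cdot>, t)\<close>. Since \<open>K \<ge> 0\<close>, integrability of \<open>W * \<Psi>\<close> is all that Fubini requires. It is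
used in both directions: to split a power into Gaussians, and to reassemble the transformed Gaussians.\<close>

lemma integral_swap_weight:
  fixes K :: "'a::euclidean_space \<Rightarrow> 'b::euclidean_space \<Rightarrow> real" and \<Psi> :: "'a \<Rightarrow> complex"
  assumes K[measurable]: "(\<lambda>(z, t). K z t) \<in> borel_measurable borel" and K0: "\<And>z t. 0 \<le> K z t"
    and W: "AE z in lborel. (\<integral>\<^sup>+t. ennreal (K z t) \<partial>lborel) = ennreal (W z)" and W0: "\<And>z. 0 \<le> W z"
    and \<Psi>[measurable]: "\<Psi> \<in> borel_measurable borel"
    and int: "integrable lborel (\<lambda>z. of_real (W z) * \<Psi> z)"
  shows "(LBINT z. of_real (W z) * \<Psi> z) = (LBINT t. LBINT z. of_real (K z t) * \<Psi> z)"
proof -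
  note K[unfolded borel_prod[symmetric], measurable]
  have Kz[measurable]: "K z \<in> borel_measurable borel" for z
    using measurable_compose[OF _ K, of "\<lambda>t. (z, t)" borel] 
    by (auto intro!: borel_measurable_continuous_onI continuous_intros)
  have iK: "AE z in lborel. integrable lborel (K z) \<and> (LBINT t. K z t) = W z"
    using W
  proof eventually_elim
    case (elim z)
    have "has_bochner_integral lborel (K z) (W z)"
      by (rule has_bochner_integral_nn_integral) (use elim K0 W0 in auto)
    then show ?case by (simp add: has_bochner_integral_iff)
  qed
  have I: "integrable lborel (\<lambda>(z, t). of_real (K z t) * \<Psi> z)"
  proof (rule lborel_fubini_integrable)
    show "(\<lambda>(z, t). of_real (K z t) * \<Psi> z) \<in> borel_measurable borel"
      unfolding borel_prod[symmetric] by measurable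
    have "AE z in lborel. norm (of_real (W z) * \<Psi> z) = (LBINT t. norm (case (z, t) of (z, t) \<Rightarrow> of_real (K z t) * \<Psi> z))"
      using iK by eventually_elim (simp add: norm_mult K0 W0)
    then show "integrable lborel (\<lambda>z. LBINT t. norm (case (z, t) of (z, t) \<Rightarrow> of_real (K z t) * \<Psi> z))"
      by (rule integrable_cong_AE_imp[OF integrable_norm[OF int], rotated -1])
        (use int in \<open>auto simp: borel_prod[symmetric]\<close>)
    show "AE z in lborel. integrable lborel (\<lambda>t. case (z, t) of (z, t) \<Rightarrow> of_real (K z t) * \<Psi> z)"
      using iK by eventually_elim simp
  qed
  have "(LBINT z. of_real (W z) * \<Psi> z) = (LBINT z. LBINT t. of_real (K z t) * \<Psi> z)"
  proof (rule integral_cong_AE)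
    show "AE z in lborel. of_real (W z) * \<Psi> z = (LBINT t. of_real (K z t) * \<Psi> z)"
      using iK by eventually_elim simp
  qed (use int in auto)
  then show ?thesis using lborel_fubini_swap[OF I] by simp
qed

section \<open>Integrable singularities\<close>

text \<open>The Gaussian is dominated by \<open>exp (- |x|)\<close>, because \<open>|x| \<le> pi * t * x\<^sup>2 + 1 / (4 * pi * t)\<close>; then the Gamma
integral applies on each half-line.\<close>

lemma integrable_powr_gauss:
  assumes r: "r < 1" and t: "t > 0"
  shows "integrable lborel (\<lambda>x. \<bar>x\<bar> powr (- r) * exp (- pi * t * x\<^sup>2))"
proof -
  let ?g = "\<lambda>x. indicator {0<..} x * x powr (1 - r - 1) * exp (- 1 * x) :: real"
  have g: "integrable lborel ?g"
    by (rule integrableI_nonneg) (use nn_integral_gamma[of "1 - r" 1] r in auto)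
  have g': "integrable lborel (\<lambda>x. ?g (0 + (-1) * x))"
    by (rule lborel_integrable_real_affine[OF g]) simp
  let ?c = "exp (1 / (4 * pi * t))"
  show ?thesis
  proof (rule Bochner_Integration.integrable_bound[OF integrable_mult_right[OF Bochner_Integration.integrable_add[OF g g'], of ?c]])
    show "AE x in lborel. norm (\<bar>x\<bar> powr (- r) * exp (- pi * t * x\<^sup>2)) \<le> norm (?c * (?g x + ?g (0 + (-1) * x)))"
    proof (rule AE_I2)
      fix x :: real
      have pt: "pi * t > 0" using t by simp
      have "0 \<le> (pi * t * \<bar>x\<bar> - 1/2)\<^sup>2 / (pi * t)" using pt by simp
      also have "\<dots> = pi * t * x\<^sup>2 - \<bar>x\<bar> + 1 / (4 * pi * t)"
        using t by (simp add: power2_eq_square field_simps)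
      finally have "exp (- pi * t * x\<^sup>2) \<le> exp (1 / (4 * pi * t) + - \<bar>x\<bar>)" by simp
      then have "exp (- pi * t * x\<^sup>2) \<le> ?c * exp (- \<bar>x\<bar>)" by (simp only: exp_add)
      then have "\<bar>x\<bar> powr (- r) * exp (- pi * t * x\<^sup>2) \<le> \<bar>x\<bar> powr (- r) * (?c * exp (- \<bar>x\<bar>))"
        by (rule mult_left_mono) simp
      also have "\<dots> = ?c * (?g x + ?g (0 + (-1) * x))" by (auto simp: indicator_def)
      finally show "norm (\<bar>x\<bar> powr (- r) * exp (- pi * t * x\<^sup>2)) \<le> norm (?c * (?g x + ?g (0 + (-1) * x)))"
        by simp
    qed
  qed simp
qed

lemma AE_inner_neq:
  fixes k :: "'a::euclidean_space"
  assumes "k \<in> Basis"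
  shows "AE x in lborel. x \<bullet> k \<noteq> c"
proof -
  have "{x. x \<bullet> k = c} \<in> null_sets lebesgue"
    using negligible_standard_hyperplane[OF assms] by (simp add: negligible_iff_null_sets)
  moreover have "{x. x \<bullet> k = c} \<in> sets borel" by measurable
  ultimately have "{x. x \<bullet> k = c} \<in> null_sets lborel" by (simp add: null_sets_completion_iff)
  then show ?thesis using AE_not_in by force
qed

lemma AE_plane_neq: "AE z::plane in lborel. fst z \<noteq> 0 \<and> snd z \<noteq> 0"
proof -
  have "AE z::plane in lborel. z \<bullet> (1, 0) \<noteq> 0" "AE z::plane in lborel. z \<bullet> (0, 1) \<noteq> 0"
    by (rule AE_inner_neq; simp add: Basis_prod_def)+
  then show ?thesis by eventually_elim (simp add: inner_prod_def)
qed

lemma AE_space_neq: "AE u::plane\<times>real in lborel. fst (fst u) \<noteq> 0 \<and> snd (fst u) \<noteq> 0 \<and> snd u \<noteq> 0"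
proof -
  have "AE z::plane\<times>real in lborel. z \<bullet> ((1, 0), 0) \<noteq> 0"
     "AE z::plane\<times>real in lborel. z \<bullet> ((0, 1), 0) \<noteq> 0"
     "AE z::plane\<times>real in lborel. z \<bullet> ((0, 0), 1) \<noteq> 0"
    by (rule AE_inner_neq; simp add: Basis_prod_def zero_prod_def)+
  then show ?thesis by eventually_elim (simp add: inner_prod_def)
qed

text \<open>Polar coordinates are replaced by \<open>|z|\<^sup>2 \<ge> |x| * |y|\<close> for \<open>z = (x, y)\<close>: off the axes the function is bounded by a
product of two functions of one variable.\<close>

lemma integrable_powr_gauss2:
  assumes r: "0 < r" "r < 1" and t: "t > 0"
  shows "integrable lborel (\<lambda>z::plane. norm z powr (- 2 * r) * exp (- pi * t * (norm z)\<^sup>2))"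
proof -
  let ?f = "\<lambda>x::real. \<bar>x\<bar> powr (- r) * exp (- pi * t * x\<^sup>2)"
  have i: "integrable lborel (\<lambda>(x, y). ?f x * ?f y)"
    by (intro lborel_integrable_product integrable_powr_gauss r t)
  show ?thesis
  proof (rule Bochner_Integration.integrable_bound[OF i])
    show "AE z::plane in lborel. norm (norm z powr (- 2 * r) * exp (- pi * t * (norm z)\<^sup>2)) \<le> norm (case z of (x, y) \<Rightarrow> ?f x * ?f y)"
      using AE_plane_neq
    proof eventually_elim
      case (elim z)
      obtain x y where z: "z = (x, y)" by (cases z)
      have n: "\<bar>x\<bar> \<le> norm z" "\<bar>y\<bar> \<le> norm z" unfolding z 
        using norm_fst_le[of x y] norm_snd_le[of y x] by auto
      have "norm z powr (- 2 * r) = norm z powr (- r) * norm z powr (- r)" by (simp flip: powr_add)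
      also have "\<dots> \<le> \<bar>x\<bar> powr (- r) * \<bar>y\<bar> powr (- r)"
        using elim n z r by (intro mult_mono powr_mono2') auto
      finally have 1: "norm z powr (- 2 * r) \<le> \<bar>x\<bar> powr (- r) * \<bar>y\<bar> powr (- r)" .
      have "exp (- pi * t * (norm z)\<^sup>2) = exp (- pi * t * x\<^sup>2) * exp (- pi * t * y\<^sup>2)"
        unfolding norm_plane z by (simp add: algebra_simps flip: exp_add)
      then show ?case using mult_right_mono[OF 1, of "exp (- pi * t * (norm z)\<^sup>2)"] z
        by (simp add: abs_mult mult_ac)
    qed
  qed measurable
qed

lemma norm_space: "norm (u::plane\<times>real)^2 = (fst (fst u))\<^sup>2 + (snd (fst u))\<^sup>2 + (snd u)\<^sup>2"
  by (simp add: norm_prod_def)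

text \<open>As in the plane, now with \<open>|u| powr (-2)\<close> bounded by the product of the powers \<open>-2/3\<close> of the coordinates.\<close>

lemma integrable_powr_gauss3:
  assumes t: "t > 0"
  shows "integrable lborel (\<lambda>u::plane\<times>real. norm u powr (- 2) * exp (- pi * t * (norm u)\<^sup>2))"
proof -
  let ?f = "\<lambda>x::real. \<bar>x\<bar> powr (- (2/3)) * exp (- pi * t * x\<^sup>2)"
  have f: "integrable lborel ?f" by (intro integrable_powr_gauss t) simp
  have i: "integrable lborel (\<lambda>(z, w). (case z of (x, y) \<Rightarrow> ?f x * ?f y) * ?f w)"
    by (rule lborel_integrable_product[OF lborel_integrable_product[OF f f] f])
  show ?thesis
  proof (rule Bochner_Integration.integrable_bound[OF i])
    show "AE u::plane\<times>real in lborel. norm (norm u powr (- 2) * exp (- pi * t * (norm u)\<^sup>2)) \<le>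
      norm (case u of (z, w) \<Rightarrow> (case z of (x, y) \<Rightarrow> ?f x * ?f y) * ?f w)"
      using AE_space_neq
    proof eventually_elim
      case (elim u)
      obtain x y w where u: "u = ((x, y), w)" by (metis prod.exhaust)
      have n: "\<bar>x\<bar> \<le> norm u" "\<bar>y\<bar> \<le> norm u" "\<bar>w\<bar> \<le> norm u" unfolding u
        using norm_fst_le[of x y] norm_snd_le[of y x] norm_fst_le[of "(x,y)" w] norm_snd_le[of w "(x,y)"] by auto
      have "norm u powr (- 2) = norm u powr (- (2/3)) * norm u powr (- (2/3)) * norm u powr (- (2/3))"
        by (simp flip: powr_add)
      also have "\<dots> \<le> \<bar>x\<bar> powr (- (2/3)) * \<bar>y\<bar> powr (- (2/3)) * \<bar>w\<bar> powr (- (2/3))"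
        using elim n u by (intro mult_mono powr_mono2') auto
      finally have 1: "norm u powr (- 2) \<le> \<bar>x\<bar> powr (- (2/3)) * \<bar>y\<bar> powr (- (2/3)) * \<bar>w\<bar> powr (- (2/3))" .
      have "exp (- pi * t * (norm u)\<^sup>2) = exp (- pi * t * x\<^sup>2) * exp (- pi * t * y\<^sup>2) * exp (- pi * t * w\<^sup>2)"
        unfolding norm_space u by (simp add: algebra_simps flip: exp_add)
      then show ?case using mult_right_mono[OF 1, of "exp (- pi * t * (norm u)\<^sup>2)"] u
        by (simp add: abs_mult mult_ac)
    qed
  qed measurable
qed

lemma integrable_inverse_square: "integrable lborel (\<lambda>x::real. 1 / (1 + x\<^sup>2))"
  using integrable_inverse_1_plus_square by (simp add: set_integrable_def inverse_eq_divide)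

text \<open>This splits a kernel into an integrable part that carries the singularity and a bounded part. The constant is
the inverse of the smallest value of the Gaussian on the unit ball.\<close>

lemma powr_le_gauss:
  assumes "0 \<le> a"
  shows "norm z powr (- a) \<le> exp pi * (norm z powr (- a) * exp (- pi * 1 * (norm z)\<^sup>2)) + 1"
proof (cases "norm z \<le> 1")
  case True
  then have "(norm z)\<^sup>2 \<le> 1" by (simp add: power_le_one)
  then have "1 \<le> exp pi * exp (- pi * 1 * (norm z)\<^sup>2)" by (simp flip: exp_add)
  from mult_left_mono[OF this, of "norm z powr (- a)"] show ?thesis by (simp add: mult_ac)
next
  case False
  then have "norm z powr (- a) \<le> 1" using powr_mono[of "-a" 0 "norm z"] assms by (auto split: if_splits)
  then show ?thesis by (simp add: add_increasing)
qed

section \<open>Decay of the Fourier transform of a Schwartz function\<close>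

lemma schwartz_frechet:
  assumes "schwartz \<phi>" "e \<in> Basis"
  shows "schwartz (\<lambda>x. frechet_derivative \<phi> (at x) e)"
proof -
  have eq: "iter_deriv vs (\<lambda>x. frechet_derivative \<phi> (at x) e) = iter_deriv (vs @ [e]) \<phi>" for vs
    by (simp add: iter_deriv_snoc)
  show ?thesis using assms unfolding schwartz_def smooth_on_def eq by simp
qed

lemma schwartz_has_derivative:
  fixes \<phi> :: "'a::euclidean_space \<Rightarrow> complex"
  assumes "schwartz \<phi>"
  shows "(\<phi> has_derivative frechet_derivative \<phi> (at x)) (at x)"
proof -
  have "set [] \<subseteq> (Basis :: 'a set)" by simp
  then have "iter_deriv [] \<phi> differentiable (at x)" using assms unfolding schwartz_def smooth_on_def by blast
  then show ?thesis by (simp add: frechet_derivative_works)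
qed

lemma schwartz_continuous: "schwartz \<phi> \<Longrightarrow> continuous_on S \<phi>"
  by (meson schwartz_has_derivative has_derivative_continuous continuous_at_imp_continuous_on)

lemma schwartz_measurable: "schwartz \<phi> \<Longrightarrow> \<phi> \<in> borel_measurable borel"
  using schwartz_continuous borel_measurable_continuous_onI by blast

text \<open>The product of the three factors \<open>1 + x\<^sub>i\<^sup>2\<close> is at most \<open>(1 + |x|\<^sup>2) ^ 3\<close>. A bound of product form is what
the iterated integrals below call for.\<close>

lemma schwartz_decay:
  fixes \<phi> :: "real^3 \<Rightarrow> complex"
  assumes "schwartz \<phi>"
  shows "\<exists>C>0. \<forall>u. norm (\<phi> (coords u)) \<le>
     C * (1 / (1 + (fst (fst u))\<^sup>2) * (1 / (1 + (snd (fst u))\<^sup>2)) * (1 / (1 + (snd u)\<^sup>2)))"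
proof -
  have "\<exists>B. \<forall>x. norm x ^ k * norm (\<phi> x) \<le> B" for k
  proof -
    have "bounded (range (\<lambda>x. norm x ^ k *\<^sub>R iter_deriv [] \<phi> x))"
    proof -
      have "set [] \<subseteq> (Basis :: (real^3) set)" by simp
      then show ?thesis using assms unfolding schwartz_def by blast
    qed
    then show ?thesis unfolding bounded_iff by auto
  qed
  then obtain B where B: "\<And>k x. norm x ^ k * norm (\<phi> x) \<le> B k" by metis
  define C where "C = \<bar>B 0 + 3 * B 2 + 3 * B 4 + B 6\<bar> + 1"
  show ?thesis
  proof (intro exI[of _ C] conjI allI)
    show "C > 0" unfolding C_def by simp
    fix u :: "plane\<times>real"
    obtain a b c where u: "u = ((a, b), c)" by (metis prod.exhaust)
    let ?n = "norm (coords u)"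
    have n: "?n\<^sup>2 = a\<^sup>2 + b\<^sup>2 + c\<^sup>2" 
      by (simp add: norm_vec_def L2_set_def sum_3 u)
    have "(1 + a\<^sup>2) * (1 + b\<^sup>2) * (1 + c\<^sup>2) \<le> (1 + ?n\<^sup>2) * (1 + ?n\<^sup>2) * (1 + ?n\<^sup>2)"
      unfolding n by (intro mult_mono) auto
    then have "norm (\<phi> (coords u)) * ((1 + a\<^sup>2) * (1 + b\<^sup>2) * (1 + c\<^sup>2))
      \<le> norm (\<phi> (coords u)) * ((1 + ?n\<^sup>2) * (1 + ?n\<^sup>2) * (1 + ?n\<^sup>2))"
      by (rule mult_left_mono) simp
    also have "\<dots> = ?n ^ 0 * norm (\<phi> (coords u)) + 3 * (?n ^ 2 * norm (\<phi> (coords u)))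
       + 3 * (?n ^ 4 * norm (\<phi> (coords u))) + ?n ^ 6 * norm (\<phi> (coords u))"
      by (simp add: algebra_simps power2_eq_square power4_eq_xxxx power_numeral_reduce)
    also have "\<dots> \<le> B 0 + 3 * B 2 + 3 * B 4 + B 6"
      by (intro add_mono mult_left_mono B) auto
    also have "\<dots> \<le> C" unfolding C_def by simp
    finally have *: "norm (\<phi> (coords u)) * ((1 + a\<^sup>2) * (1 + b\<^sup>2) * (1 + c\<^sup>2)) \<le> C" .
    have pos: "0 < (1 + a\<^sup>2) * (1 + b\<^sup>2) * (1 + c\<^sup>2)" by (intro mult_pos_pos) (auto simp: add_pos_nonneg)
    have "norm (\<phi> (coords u)) \<le> C / ((1 + a\<^sup>2) * (1 + b\<^sup>2) * (1 + c\<^sup>2))"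
      using * pos by (simp only: pos_le_divide_eq)
    then show "norm (\<phi> (coords u)) \<le>
      C * (1 / (1 + (fst (fst u))\<^sup>2) * (1 / (1 + (snd (fst u))\<^sup>2)) * (1 / (1 + (snd u)\<^sup>2)))"
      by (simp add: u)
  qed
qed

lemma integrable_space_weight:
  "integrable lborel (\<lambda>u::plane\<times>real. 1 / (1 + (fst (fst u))\<^sup>2) * (1 / (1 + (snd (fst u))\<^sup>2)) * (1 / (1 + (snd u)\<^sup>2)))"
  using lborel_integrable_product[OF lborel_integrable_product[OF integrable_inverse_square integrable_inverse_square]
      integrable_inverse_square] by (simp add: split_beta')

lemma integrable_plane_weight:
  "integrable lborel (\<lambda>z::plane. 1 / (1 + (fst z)\<^sup>2) * (1 / (1 + (snd z)\<^sup>2)))"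
  using lborel_integrable_product[OF integrable_inverse_square integrable_inverse_square] by (simp add: split_beta')

lemma schwartz_coords_measurable: "schwartz \<phi> \<Longrightarrow> (\<lambda>u. \<phi> (coords u)) \<in> borel_measurable borel"
  using measurable_compose[OF measurable_coords schwartz_measurable] by simp

lemma schwartz_integrable_coords:
  fixes \<phi> :: "real^3 \<Rightarrow> complex"
  assumes "schwartz \<phi>" shows "integrable lborel (\<lambda>u. \<phi> (coords u))"
proof -
  obtain C where C: "C > 0" "\<And>u. norm (\<phi> (coords u)) \<le>
     C * (1 / (1 + (fst (fst u))\<^sup>2) * (1 / (1 + (snd (fst u))\<^sup>2)) * (1 / (1 + (snd u)\<^sup>2)))"
    using schwartz_decay[OF assms] by blast
  show ?thesis
    by (rule Bochner_Integration.integrable_bound[OF integrable_mult_right[OF integrable_space_weight, of C]])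
       (use schwartz_coords_measurable[OF assms] in simp, rule AE_I2, rule order_trans[OF C(2)],
         simp only: real_norm_def abs_ge_self)
qed

lemma schwartz_integrable:
  fixes \<phi> :: "real^3 \<Rightarrow> complex"
  assumes "schwartz \<phi>" shows "integrable lborel \<phi>"
  using lborel_integrable_coords[OF schwartz_measurable[OF assms]] schwartz_integrable_coords[OF assms] by simp

text \<open>By invariance under translations the integral of \<open>\<psi>(x + v) - \<psi>(x)\<close> is \<open>0\<close>. That difference is the integral
of \<open>D (x + s v) v\<close> over \<open>s \<in> [0, 1]\<close>, and each of these \<open>s\<close> contributes the same integral over \<open>x\<close>.\<close>

lemma integral_directional_derivative_eq_0:
  fixes \<psi> :: "'a::euclidean_space \<Rightarrow> complex"
  assumes der: "\<And>x. (\<psi> has_derivative D x) (at x)"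
    and cont: "continuous_on UNIV (\<lambda>x. D x v)"
    and \<psi>: "integrable lborel \<psi>" and Dv: "integrable lborel (\<lambda>x. D x v)"
  shows "(LBINT x. D x v) = 0"
proof -
  let ?H = "\<lambda>(s, x). indicator {0..1::real} s *\<^sub>R D (x + s *\<^sub>R v) v"
  have [measurable]: "(\<lambda>x. D x v) \<in> borel_measurable borel" using Dv by auto
  have [measurable]: "(\<lambda>z::real\<times>'a. D (snd z + fst z *\<^sub>R v) v) \<in> borel_measurable borel"
    by (intro borel_measurable_continuous_onI continuous_on_compose2[OF cont] continuous_intros) auto
  have mH: "?H \<in> borel_measurable borel"
    unfolding split_beta'
    by (rule borel_measurable_scaleR) (auto simp: borel_prod[symmetric])
  have trans: "integrable lborel (\<lambda>x. f (x + w)) \<longleftrightarrow> integrable lborel f"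
      "(LBINT x. f (x + w)) = (LBINT x. f x)"
    if "f \<in> borel_measurable borel" for f :: "'a \<Rightarrow> 'c::{banach, second_countable_topology}" and w
    using lborel_integrable_affine[OF _ that, of 1 w] lborel_integral_affine[OF _ that, of 1 w]
    by (simp_all add: add.commute)
  have H: "integrable lborel ?H"
  proof (rule lborel_fubini_integrable[OF mH])
    have "(\<lambda>s. LBINT x. norm (?H (s, x))) = (\<lambda>s. indicator {0..1} s *\<^sub>R (LBINT x. norm (D x v)))"
      using trans(2)[of "\<lambda>x. norm (D x v)"] by (auto simp: indicator_def)
    then show "integrable lborel (\<lambda>s. LBINT x. norm (?H (s, x)))" by (simp add: integrable_scaleR_left)
    show "AE s in lborel. integrable lborel (\<lambda>x. ?H (s, x))"
      using trans(1)[of "\<lambda>x. D x v"] Dv by auto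
  qed
  have FTC: "(LBINT s. ?H (s, x)) = \<psi> (x + v) - \<psi> x" for x
  proof -
    have "(LBINT s. indicator {0..1} s *\<^sub>R D (x + s *\<^sub>R v) v) = \<psi> (x + 1 *\<^sub>R v) - \<psi> (x + 0 *\<^sub>R v)"
    proof (rule integral_FTC_atLeastAtMost)
      fix s :: real
      have "((\<lambda>s. x + s *\<^sub>R v) has_derivative (\<lambda>h. h *\<^sub>R v)) (at s within {0..1})"
        by (auto intro!: derivative_eq_intros)
      from has_derivative_compose[OF this der[of "x + s *\<^sub>R v"]]
      have "((\<lambda>s. \<psi> (x + s *\<^sub>R v)) has_derivative (\<lambda>h. D (x + s *\<^sub>R v) (h *\<^sub>R v))) (at s within {0..1})" .
      then show "((\<lambda>s. \<psi> (x + s *\<^sub>R v)) has_vector_derivative D (x + s *\<^sub>R v) v) (at s within {0..1})"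
        unfolding has_vector_derivative_def linear_scale[OF has_derivative_linear[OF der]] .
    qed (auto intro!: continuous_on_compose2[OF cont] continuous_intros)
    then show ?thesis by simp
  qed
  have "(LBINT x. D x v) = (LBINT s. indicator {0..1::real} s *\<^sub>R (LBINT x. D x v))" by simp
  also have "\<dots> = (LBINT s. LBINT x. ?H (s, x))"
    using trans(2)[of "\<lambda>x. D x v"] by simp
  also have "\<dots> = (LBINT x. LBINT s. ?H (s, x))"
    using lborel_fubini_swap[of "\<lambda>s x. ?H (s, x)"] H by simp
  also have "\<dots> = (LBINT x. \<psi> (x + v) - \<psi> x)" unfolding FTC ..
  also have "\<dots> = 0" using \<psi> trans[of \<psi> v] by auto
  finally show ?thesis .
qed

lemma fourier_phase: "fourier f \<xi> = (LBINT x. f x * phase (x \<bullet> \<xi>))"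
  unfolding fourier_def phase_def ..

lemma fourier_bound: "norm (fourier f \<xi>) \<le> (LBINT x. norm (f x))"
proof -
  have "norm (fourier f \<xi>) \<le> (LBINT x. norm (f x * phase (x \<bullet> \<xi>)))"
    unfolding fourier_phase by (rule integral_norm_bound)
  then show ?thesis by (simp add: norm_mult)
qed

lemma integrable_mult_phase:
  assumes "integrable lborel f" "g \<in> borel_measurable borel"
  shows "integrable lborel (\<lambda>x. f x * phase (g x))"
  by (rule Bochner_Integration.integrable_bound[OF assms(1)])
     (use assms in \<open>auto simp: norm_mult\<close>)

lemma fourier_derivative:
  fixes \<phi> :: "real^3 \<Rightarrow> complex"
  assumes \<phi>: "schwartz \<phi>" and e: "e \<in> Basis"
  shows "fourier (\<lambda>x. frechet_derivative \<phi> (at x) e) \<xi> = 2 * of_real pi * \<i> * of_real (e \<bullet> \<xi>) * fourier \<phi> \<xi>"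
proof -
  let ?d = "\<lambda>x. frechet_derivative \<phi> (at x) e"
  let ?c = "2 * of_real pi * \<i> :: complex"
  let ?D = "\<lambda>x v. \<phi> x * (phase (x \<bullet> \<xi>) * (- ?c * of_real (v \<bullet> \<xi>))) + frechet_derivative \<phi> (at x) v * phase (x \<bullet> \<xi>)"
  note s = schwartz_frechet[OF \<phi> e]
  have i1: "integrable lborel (\<lambda>x. \<phi> x * phase (x \<bullet> \<xi>))" "integrable lborel (\<lambda>x. ?d x * phase (x \<bullet> \<xi>))"
    by (intro integrable_mult_phase schwartz_integrable s \<phi>; simp)+
  have eq: "?D x e = - ?c * of_real (e \<bullet> \<xi>) * (\<phi> x * phase (x \<bullet> \<xi>)) + ?d x * phase (x \<bullet> \<xi>)" for x
    by simp
  have "(LBINT x. ?D x e) = 0"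
  proof (rule integral_directional_derivative_eq_0[where D="?D" and v=e and \<psi>="\<lambda>x. \<phi> x * phase (x \<bullet> \<xi>)"])
    fix x
    have "((\<lambda>x. phase (x \<bullet> \<xi>)) has_derivative (\<lambda>v. phase (x \<bullet> \<xi>) * (- ?c * of_real (v \<bullet> \<xi>)))) (at x)"
    proof -
      have "((\<lambda>x. - ?c * of_real (x \<bullet> \<xi>)) has_derivative (\<lambda>v. - ?c * of_real (v \<bullet> \<xi>))) (at x)"
        by (auto intro!: derivative_eq_intros)
      from has_derivative_compose[OF this DERIV_exp[unfolded has_field_derivative_def]]
      show ?thesis unfolding phase_def by (simp add: mult_ac)
    qed
    then show "((\<lambda>x. \<phi> x * phase (x \<bullet> \<xi>)) has_derivative ?D x) (at x)"
      by (intro has_derivative_mult schwartz_has_derivative \<phi>)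
  next
    show "continuous_on UNIV (\<lambda>x. ?D x e)"
      by (intro continuous_intros schwartz_continuous \<phi> s)
    show "integrable lborel (\<lambda>x. ?D x e)" unfolding eq using i1 by simp
  qed (rule i1)
  then have "- ?c * of_real (e \<bullet> \<xi>) * (LBINT x. \<phi> x * phase (x \<bullet> \<xi>)) + (LBINT x. ?d x * phase (x \<bullet> \<xi>)) = 0"
    unfolding eq using i1 by simp
  then show ?thesis unfolding fourier_phase by (simp add: algebra_simps)
qed

text \<open>Two derivatives in each horizontal direction give this decay, which is uniform in the vertical variable. It
makes the transform integrable over every plane that is a graph over the horizontal one, even after
multiplication by a locally integrable power of the horizontal distance.\<close>

lemma fourier_decay_plane:
  fixes \<phi> :: "real^3 \<Rightarrow> complex"
  assumes \<phi>: "schwartz \<phi>"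
  shows "\<exists>B>0. \<forall>z w. norm (fourier \<phi> (coords (z, w))) \<le>
     B * (1 / (1 + (fst z)\<^sup>2) * (1 / (1 + (snd z)\<^sup>2)))"
proof -
  let ?d = "\<lambda>e f x. frechet_derivative f (at x) e"
  have ax: "axis 1 1 \<in> (Basis::(real^3) set)" "axis 2 1 \<in> (Basis::(real^3) set)" by (auto simp: axis_in_Basis_iff)
  define \<phi>1 where "\<phi>1 = ?d (axis 1 1) (?d (axis 1 1) \<phi>)"
  define \<phi>2 where "\<phi>2 = ?d (axis 2 1) (?d (axis 2 1) \<phi>)"
  define \<phi>12 where "\<phi>12 = ?d (axis 1 1) (?d (axis 1 1) \<phi>2)"
  have s: "schwartz \<phi>1" "schwartz \<phi>2" "schwartz \<phi>12"
    unfolding \<phi>1_def \<phi>2_def \<phi>12_def by (intro schwartz_frechet \<phi> ax)+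
  have twice: "norm (fourier (?d e (?d e f)) \<xi>) = 4 * pi\<^sup>2 * (e \<bullet> \<xi>)\<^sup>2 * norm (fourier f \<xi>)"
    if "schwartz f" "e \<in> Basis" for f e and \<xi> :: "real^3"
    by (simp add: fourier_derivative schwartz_frechet that norm_mult power2_eq_square)
  define N where "N = (\<lambda>f::real^3\<Rightarrow>complex. LBINT x. norm (f x))"
  have N0: "N f \<ge> 0" for f unfolding N_def by simp
  have N: "norm (fourier f \<xi>) \<le> N f" for f \<xi> unfolding N_def by (rule fourier_bound)
  define B where "B = N \<phi> + N \<phi>1 + N \<phi>2 + N \<phi>12 + 1"
  show ?thesis
  proof (intro exI[of _ B] conjI allI)
    show "B > 0" unfolding B_def using N0 by (simp add: add_nonneg_pos)
    fix z :: "plane" and w :: real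
    obtain a b where z: "z = (a, b)" by (cases z)
    let ?\<xi> = "coords (z, w)"
    let ?F = "norm (fourier \<phi> ?\<xi>)"
    have p: "1 \<le> 4 * pi\<^sup>2" using pi_ge_two power_mono[of 2 pi 2] by simp
    have le: "x \<le> y" if "x \<ge> 0" "4 * pi\<^sup>2 * x \<le> y" for x y :: real
      using mult_right_mono[OF p that(1)] that(2) by simp
    have in1: "axis 1 1 \<bullet> ?\<xi> = a" and in2: "axis 2 1 \<bullet> ?\<xi> = b" by (simp_all add: z inner_axis')
    have t1: "norm (fourier \<phi>1 ?\<xi>) = 4 * pi\<^sup>2 * a\<^sup>2 * ?F"
      unfolding \<phi>1_def twice[OF \<phi> ax(1)] in1 ..
    have t2: "norm (fourier \<phi>2 ?\<xi>) = 4 * pi\<^sup>2 * b\<^sup>2 * ?F"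
      unfolding \<phi>2_def twice[OF \<phi> ax(2)] in2 ..
    have t3: "norm (fourier \<phi>12 ?\<xi>) = 4 * pi\<^sup>2 * a\<^sup>2 * norm (fourier \<phi>2 ?\<xi>)"
      unfolding \<phi>12_def twice[OF s(2) ax(1)] in1 ..
    have 1: "a\<^sup>2 * ?F \<le> N \<phi>1"
      by (rule le[OF _ order_trans[OF eq_refl N[of \<phi>1 ?\<xi>]]]) (simp_all add: t1)
    have 2: "b\<^sup>2 * ?F \<le> norm (fourier \<phi>2 ?\<xi>)"
      by (rule le) (simp_all add: t2)
    have 3: "a\<^sup>2 * norm (fourier \<phi>2 ?\<xi>) \<le> N \<phi>12"
      by (rule le[OF _ order_trans[OF eq_refl N[of \<phi>12 ?\<xi>]]]) (simp_all add: t3)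
    have 4: "a\<^sup>2 * (b\<^sup>2 * ?F) \<le> N \<phi>12" using order_trans[OF mult_left_mono[OF 2, of "a\<^sup>2"] 3] by simp
    have "?F * ((1 + a\<^sup>2) * (1 + b\<^sup>2)) = ?F + a\<^sup>2 * ?F + b\<^sup>2 * ?F + a\<^sup>2 * (b\<^sup>2 * ?F)"
      by (simp add: algebra_simps)
    also have "\<dots> \<le> B" unfolding B_def using N[of \<phi> ?\<xi>] 1 order_trans[OF 2 N] 4 by linarith
    finally have "?F * ((1 + a\<^sup>2) * (1 + b\<^sup>2)) \<le> B" .
    moreover have "0 < (1 + a\<^sup>2) * (1 + b\<^sup>2)" by (intro mult_pos_pos) (auto simp: add_pos_nonneg)
    ultimately have "?F \<le> B / ((1 + a\<^sup>2) * (1 + b\<^sup>2))" by (simp only: pos_le_divide_eq)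
    then show "?F \<le> B * (1 / (1 + (fst z)\<^sup>2) * (1 / (1 + (snd z)\<^sup>2)))" by (simp add: z)
  qed
qed

section \<open>Integrals of a Fourier transform over planes\<close>

text \<open>The Fourier transform in the coordinates of \<open>coords\<close>.\<close>

definition fourier_split :: "(plane\<times>real \<Rightarrow> complex) \<Rightarrow> plane \<Rightarrow> real \<Rightarrow> complex" where
  "fourier_split f z w = (LBINT u. f u * phase (z \<bullet> fst u + w * snd u))"

lemma fourier_coords:
  assumes [measurable]: "\<phi> \<in> borel_measurable borel"
  shows "fourier \<phi> (coords (z, w)) = fourier_split (\<lambda>u. \<phi> (coords u)) z w"
proof -
  have "fourier \<phi> (coords (z, w)) = (LBINT u. \<phi> (coords u) * phase (coords u \<bullet> coords (z, w)))"
    unfolding fourier_phase by (rule lborel_integral_coords) measurable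
  then show ?thesis unfolding fourier_split_def
    by (simp add: inner_vec_def sum_3 inner_prod_def mult_ac)
qed

lemma measurable_fourier_split:
  assumes [measurable]: "f \<in> borel_measurable borel"
  shows "(\<lambda>(z, w). fourier_split f z w) \<in> borel_measurable borel"
proof -
  have [measurable]: "(\<lambda>p::(plane\<times>real)\<times>(plane\<times>real). fst (fst p) \<bullet> fst (snd p) + snd (fst p) * snd (snd p)) \<in> borel_measurable (borel \<Otimes>\<^sub>M borel)"
    unfolding borel_prod by (intro borel_measurable_continuous_onI continuous_intros)
  have "(\<lambda>x. LBINT u. f u * phase (fst x \<bullet> fst u + snd x * snd u)) \<in> borel_measurable borel"
    by (rule lborel.borel_measurable_lebesgue_integral) (simp add: split_beta')
  then show ?thesis unfolding fourier_split_def by (simp add: split_beta')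
qed

lemma measurable_fourier_split_slice:
  assumes "f \<in> borel_measurable borel"
  shows "(\<lambda>z. fourier_split f z (a \<bullet> z)) \<in> borel_measurable borel"
proof -
  have "(\<lambda>z. (z, a \<bullet> z)) \<in> borel_measurable borel"
    by (intro borel_measurable_continuous_onI continuous_intros)
  from measurable_compose[OF this measurable_fourier_split[OF assms]] show ?thesis by simp
qed

text \<open>On the plane \<open>w = a \<bullet> z\<close> the phase is \<open>z \<bullet> (y + \<tau> a)\<close> with \<open>u = (y, \<tau>)\<close>. Carrying out the integral over \<open>z\<close>
first transforms the Gaussian.\<close>

lemma plane_integral_gauss:
  assumes f: "integrable lborel f" and t: "t > 0"
  shows "(LBINT z. of_real (exp (- pi * t * (norm z)\<^sup>2)) * fourier_split f z (a \<bullet> z)) =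
    (LBINT u. of_real (exp (- pi * (norm (fst u + snd u *\<^sub>R a))\<^sup>2 / t) / t) * f u)"
proof -
  have [measurable]: "f \<in> borel_measurable borel" using f by auto
  let ?e = "\<lambda>z::plane. of_real (exp (- pi * t * (norm z)\<^sup>2)) :: complex"
  have [measurable]: "(\<lambda>p::plane\<times>(plane\<times>real). fst p \<bullet> (fst (snd p) + snd (snd p) *\<^sub>R a)) \<in> borel_measurable borel"
    by (intro borel_measurable_continuous_onI continuous_intros)
  have "integrable lborel (\<lambda>z::plane. of_real (exp (- pi * t * (norm z)\<^sup>2)) :: complex)"
    using integrable_gauss2[OF t] by (simp only: complex_of_real_integrable_eq)
  from integrable_mult_phase[OF lborel_integrable_product[OF this f], of "\<lambda>p. fst p \<bullet> (fst (snd p) + snd (snd p) *\<^sub>R a)"]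
  have i: "integrable lborel (\<lambda>(z, u). ?e z * f u * phase (z \<bullet> (fst u + snd u *\<^sub>R a)))"
    by (simp add: split_beta')
  have "(LBINT z. ?e z * fourier_split f z (a \<bullet> z)) = (LBINT z. LBINT u. ?e z * f u * phase (z \<bullet> (fst u + snd u *\<^sub>R a)))"
    unfolding fourier_split_def 
    by (subst integral_mult_right_zero[symmetric]) (simp add: mult_ac inner_add_right inner_commute)
  also have "\<dots> = (LBINT u. LBINT z. ?e z * f u * phase (z \<bullet> (fst u + snd u *\<^sub>R a)))"
    by (rule lborel_fubini_swap[OF i])
  also have "\<dots> = (LBINT u. of_real (exp (- pi * (norm (fst u + snd u *\<^sub>R a))\<^sup>2 / t) / t) * f u)"
  proof (rule Bochner_Integration.integral_cong[OF refl])
    fix u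
    have "(LBINT z. ?e z * f u * phase (z \<bullet> (fst u + snd u *\<^sub>R a))) = 
       (LBINT z. f u * (?e z * phase (z \<bullet> (fst u + snd u *\<^sub>R a))))" by (simp add: mult_ac)
    also have "\<dots> = f u * (LBINT z. ?e z * phase (z \<bullet> (fst u + snd u *\<^sub>R a)))" by (rule integral_mult_right_zero)
    finally show "(LBINT z. ?e z * f u * phase (z \<bullet> (fst u + snd u *\<^sub>R a))) =
      of_real (exp (- pi * (norm (fst u + snd u *\<^sub>R a))\<^sup>2 / t) / t) * f u"
      unfolding integral_gauss2_phase[OF t] by (simp add: mult.commute)
  qed
  finally show ?thesis .
qed

section \<open>Kernels along sheared planes\<close>

lemma borel_measurable_fst [measurable]:
  "(fst :: 'a::second_countable_topology \<times> 'b::second_countable_topology \<Rightarrow> 'a) \<in> borel_measurable borel"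
  by (intro borel_measurable_continuous_onI continuous_intros)

lemma borel_measurable_snd [measurable]:
  "(snd :: 'a::second_countable_topology \<times> 'b::second_countable_topology \<Rightarrow> 'b) \<in> borel_measurable borel"
  by (intro borel_measurable_continuous_onI continuous_intros)

abbreviation plane_weight :: "plane \<Rightarrow> real" where
  "plane_weight z \<equiv> 1 / (1 + (fst z)\<^sup>2) * (1 / (1 + (snd z)\<^sup>2))"

lemma plane_weight_le_1: "plane_weight z \<le> 1"
proof -
  have "1 / (1 + x\<^sup>2) \<le> 1" for x :: real by (simp add: divide_le_eq add_pos_nonneg)
  then show ?thesis by (intro mult_le_one) auto
qed

lemma powr_norm_square: "((norm z)\<^sup>2) powr c = norm z powr (2 * c)"
  by (cases "norm z = 0") (auto simp: powr_powr simp flip: powr_numeral)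

lemma lborel_integrable_swap:
  fixes f :: "'a::euclidean_space \<times> 'b::euclidean_space \<Rightarrow> 'c::{banach, second_countable_topology}"
  shows "integrable lborel (\<lambda>(y, x). f (x, y)) \<longleftrightarrow> integrable lborel f"
  using lborel_pair.integrable_product_swap_iff[of f] by (simp add: lborel_prod)

lemma integrable_powr_weight:
  assumes r: "0 \<le> r" "r < 1"
  shows "integrable lborel (\<lambda>z. norm z powr (- 2 * r) * plane_weight z)"
proof (cases "r = 0")
  case True
  show ?thesis
    by (rule Bochner_Integration.integrable_bound[OF integrable_plane_weight])
       (measurable, auto simp: True intro!: AE_I2)
next
  case False
  with r have r0: "0 < r" by simp
  let ?k = "\<lambda>z::plane. norm z powr (- 2 * r) * exp (- pi * 1 * (norm z)\<^sup>2)"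
  have i: "integrable lborel (\<lambda>z. exp pi * ?k z + plane_weight z)"
    by (intro Bochner_Integration.integrable_add integrable_mult_right integrable_powr_gauss2 integrable_plane_weight r0 r) simp
  show ?thesis
  proof (rule integrable_dominated[OF i])
    fix z
    have "norm z powr (- 2 * r) * plane_weight z \<le> (exp pi * ?k z + 1) * plane_weight z"
      using powr_le_gauss[of "2 * r" z] r by (intro mult_right_mono) auto
    also have "\<dots> \<le> exp pi * ?k z * 1 + plane_weight z"
      unfolding distrib_right by (intro add_mono mult_left_mono plane_weight_le_1) auto
    finally show "norm (norm z powr (- 2 * r) * plane_weight z) \<le> exp pi * ?k z + plane_weight z"
      by (subst real_norm_def, subst abs_of_nonneg) auto
  qed measurable
qed

text \<open>For fixed \<open>\<tau>\<close> the singularity is only translated, so the bound for its part is independent of \<open>a\<close>; decay of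
\<open>f\<close> in \<open>\<tau>\<close> does the rest.\<close>

lemma integrable_sheared_kernel:
  fixes f :: "plane\<times>real \<Rightarrow> complex" and r :: real
  assumes r: "0 < r" "r < 1" and f: "integrable lborel f" and K: "\<And>u. norm (f u) \<le> K * (1 / (1 + (snd u)\<^sup>2))"
  shows "\<exists>M. \<forall>a. integrable lborel (\<lambda>u. of_real (norm (fst u + snd u *\<^sub>R a) powr (- 2 * r)) * f u) \<and>
    (LBINT u. norm (of_real (norm (fst u + snd u *\<^sub>R a) powr (- 2 * r)) * f u)) \<le> M"
proof -
  have [measurable]: "f \<in> borel_measurable borel" using f by auto
  have K0: "K \<ge> 0" using order_trans[OF norm_ge_zero K[of "(0, 0)"]] by simp
  let ?k = "\<lambda>z::plane. norm z powr (- 2 * r) * exp (- pi * 1 * (norm z)\<^sup>2)"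
  have k: "integrable lborel ?k" by (rule integrable_powr_gauss2) (use r in auto)
  define \<kappa> where "\<kappa> = (LBINT y. ?k y)"
  have sh: "integrable lborel (\<lambda>y. ?k (y + w))" "(LBINT y. ?k (y + w)) = \<kappa>" for w
    using lborel_integrable_affine[of 1 ?k w] lborel_integral_affine[of 1 ?k w] k
    by (simp_all add: \<kappa>_def add.commute)
  let ?w = "\<lambda>\<tau>::real. K * (1 / (1 + \<tau>\<^sup>2))"
  have w: "integrable lborel (\<lambda>\<tau>. ?w \<tau> * \<kappa>)"
    by (intro integrable_mult_left integrable_mult_right integrable_inverse_square)
  have [measurable]: "(\<lambda>u::plane\<times>real. fst u + snd u *\<^sub>R a) \<in> borel_measurable borel" for a
    by (intro borel_measurable_continuous_onI continuous_intros)
  let ?P = "\<lambda>a u. of_real (?k (fst u + snd u *\<^sub>R a)) * f u"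
  have P: "integrable lborel (?P a)" "(LBINT u. norm (?P a u)) \<le> (LBINT \<tau>. ?w \<tau> * \<kappa>)" for a
  proof -
    have dom: "AE \<tau> in lborel. integrable lborel (\<lambda>y. ?w \<tau> * ?k (y + \<tau> *\<^sub>R a)) \<and> (LBINT y. ?w \<tau> * ?k (y + \<tau> *\<^sub>R a)) \<le> ?w \<tau> * \<kappa> \<and>
      (\<forall>y. norm (?P a (y, \<tau>)) \<le> ?w \<tau> * ?k (y + \<tau> *\<^sub>R a))"
    proof (intro AE_I2 conjI allI)
      fix \<tau> :: real and y :: plane
      show "integrable lborel (\<lambda>y. ?w \<tau> * ?k (y + \<tau> *\<^sub>R a))" by (intro integrable_mult_right sh)
      show "(LBINT y. ?w \<tau> * ?k (y + \<tau> *\<^sub>R a)) \<le> ?w \<tau> * \<kappa>"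
        unfolding integral_mult_right_zero sh(2) by (rule order_refl)
      show "norm (?P a (y, \<tau>)) \<le> ?w \<tau> * ?k (y + \<tau> *\<^sub>R a)"
        using mult_left_mono[OF K[of "(y, \<tau>)"], of "?k (y + \<tau> *\<^sub>R a)"] by (simp add: norm_mult mult.commute)
    qed
    have m: "?P a \<in> borel_measurable borel" by measurable
    show "integrable lborel (?P a)" by (rule lborel_integrable_iterated_snd(1)[OF m w dom])
    show "(LBINT u. norm (?P a u)) \<le> (LBINT \<tau>. ?w \<tau> * \<kappa>)"
      by (rule lborel_integrable_iterated_snd(2)[OF m w dom])
  qed
  let ?Q = "\<lambda>a u. of_real (norm (fst u + snd u *\<^sub>R a) powr (- 2 * r)) * f u"
  let ?b = "\<lambda>a u. exp pi * norm (?P a u) + norm (f u)"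
  have b: "integrable lborel (?b a)" for a
    by (intro Bochner_Integration.integrable_add integrable_mult_right integrable_norm P f)
  have le: "norm (?Q a u) \<le> ?b a u" for a u
  proof -
    have "norm (?Q a u) \<le> (exp pi * ?k (fst u + snd u *\<^sub>R a) + 1) * norm (f u)"
      unfolding norm_mult norm_of_real abs_of_nonneg[OF powr_ge_zero]
      using powr_le_gauss[of "2 * r" "fst u + snd u *\<^sub>R a"] r by (intro mult_right_mono) auto
    also have "\<dots> = ?b a u" by (simp add: norm_mult distrib_right)
    finally show ?thesis .
  qed
  show ?thesis
  proof (intro exI allI conjI)
    fix a
    show i: "integrable lborel (?Q a)" by (rule integrable_dominated[OF b _ le]) measurable
    have "(LBINT u. norm (?Q a u)) \<le> (LBINT u. ?b a u)" by (intro integral_mono integrable_norm[OF i] b le)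
    also have "\<dots> = exp pi * (LBINT u. norm (?P a u)) + (LBINT u. norm (f u))"
      unfolding integral_mult_right_zero[symmetric]
      by (intro Bochner_Integration.integral_add integrable_mult_right integrable_norm P f)
    also have "\<dots> \<le> exp pi * (LBINT \<tau>. ?w \<tau> * \<kappa>) + (LBINT u. norm (f u))" using P by simp
    finally show "(LBINT u. norm (?Q a u)) \<le> exp pi * (LBINT \<tau>. ?w \<tau> * \<kappa>) + (LBINT u. norm (f u))" .
  qed
qed

lemma AE_sheared_neq: "AE u in lborel. fst u + snd u *\<^sub>R (a::plane) \<noteq> 0"
proof -
  let ?v = "((1, 0), fst a) :: plane\<times>real"
  have "negligible {u. ?v \<bullet> u = 0}" by (rule negligible_hyperplane) (simp add: zero_prod_def)
  then have "{u. ?v \<bullet> u = 0} \<in> null_sets lebesgue" by (simp add: negligible_iff_null_sets)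
  moreover have "{u. ?v \<bullet> u = 0} \<in> sets borel" by measurable
  ultimately have "{u. ?v \<bullet> u = 0} \<in> null_sets lborel" by (simp add: null_sets_completion_iff)
  then have "AE u in lborel. u \<notin> {u. ?v \<bullet> u = 0}" by (rule AE_not_in)
  then show ?thesis
  proof eventually_elim
    case (elim u)
    have "fst (fst u + snd u *\<^sub>R a) = ?v \<bullet> u" by (simp add: inner_prod_def)
    then show ?case using elim by (metis fst_zero mem_Collect_eq)
  qed
qed

text \<open>The plane integral of a transform against \<open>|z| powr (- 2 r)\<close> is a Riesz potential of the function: split the
power into Gaussians, apply \<open>plane_integral_gauss\<close> to each of them, and reassemble. The two exponents add up to
minus the dimension of the plane, as they must for a Fourier pair of powers.\<close>

lemma plane_integral_powr:
  fixes f :: "plane\<times>real \<Rightarrow> complex"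
  assumes r: "0 < r" "r < 1" and f: "integrable lborel f" and K: "\<And>u. norm (f u) \<le> K * (1 / (1 + (snd u)\<^sup>2))"
    and B: "\<And>z w. norm (fourier_split f z w) \<le> B * plane_weight z"
  shows "of_real (Gamma r * pi powr (- r)) * (LBINT z. of_real (norm z powr (- 2 * r)) * fourier_split f z (a \<bullet> z)) =
    of_real (inv_gamma (1 - r)) * (LBINT u. of_real (norm (fst u + snd u *\<^sub>R a) powr (- 2 * (1 - r))) * f u)"
proof -
  have fm[measurable]: "f \<in> borel_measurable borel" using f by auto
  note hm[measurable] = measurable_fourier_split_slice[OF fm, of a]
  have [measurable]: "(\<lambda>u::plane\<times>real. fst u + snd u *\<^sub>R a) \<in> borel_measurable borel"
    by (intro borel_measurable_continuous_onI continuous_intros)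
  define W where "W = (\<lambda>z::plane. Gamma r * (pi * (norm z)\<^sup>2) powr (- r))"
  define k where "k = (\<lambda>(z::plane) t. indicator {0<..} t * t powr (r - 1) * exp (- (pi * (norm z)\<^sup>2) * t) :: real)"
  define W' where "W' = (\<lambda>u. inv_gamma (1 - r) * ((norm (fst u + snd u *\<^sub>R a))\<^sup>2) powr (- (1 - r)))"
  define k' where "k' = (\<lambda>u t. indicator {0<..} t * t powr (- (1 - r) - 1) * exp (- pi * (norm (fst u + snd u *\<^sub>R a))\<^sup>2 / t) :: real)"
  have Weq: "W z = Gamma r * pi powr (- r) * norm z powr (- 2 * r)" for z
    unfolding W_def by (simp add: powr_mult powr_norm_square)
  have W'eq: "W' u = inv_gamma (1 - r) * norm (fst u + snd u *\<^sub>R a) powr (- 2 * (1 - r))" for u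
    unfolding W'_def powr_norm_square by simp
  have int1: "integrable lborel (\<lambda>z. of_real (W z) * fourier_split f z (a \<bullet> z))"
  proof (rule Bochner_Integration.integrable_bound[OF integrable_mult_right[OF integrable_powr_weight[of r], of "Gamma r * pi powr (- r) * B"]])
    show "AE z in lborel. norm (of_real (W z) * fourier_split f z (a \<bullet> z)) \<le> norm (Gamma r * pi powr (- r) * B * (norm z powr (- 2 * r) * plane_weight z))"
    proof (rule AE_I2)
      fix z
      have "norm (of_real (W z) * fourier_split f z (a \<bullet> z)) = W z * norm (fourier_split f z (a \<bullet> z))"
        unfolding Weq using Gamma_real_pos[OF r(1)] by (simp add: norm_mult)
      also have "\<dots> \<le> W z * (B * plane_weight z)"
        unfolding Weq using Gamma_real_pos[OF r(1)] by (intro mult_left_mono B) auto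
      also have "\<dots> = Gamma r * pi powr (- r) * B * (norm z powr (- 2 * r) * plane_weight z)"
        unfolding Weq by (simp add: mult_ac)
      finally show "norm (of_real (W z) * fourier_split f z (a \<bullet> z)) \<le> norm (Gamma r * pi powr (- r) * B * (norm z powr (- 2 * r) * plane_weight z))"
        unfolding real_norm_def by linarith
    qed
  qed (use r in \<open>auto simp: W_def\<close>)
  have r': "0 < 1 - r" "1 - r < 1" using r by auto
  have M: "integrable lborel (\<lambda>u. of_real (norm (fst u + snd u *\<^sub>R a) powr (- 2 * (1 - r))) * f u)"
    using integrable_sheared_kernel[OF r' f K] by blast
  have int2: "integrable lborel (\<lambda>u. of_real (W' u) * f u)"
    unfolding W'eq of_real_mult mult.assoc by (intro integrable_mult_right M)
  have "(LBINT z. of_real (W z) * fourier_split f z (a \<bullet> z)) = (LBINT t. LBINT z. of_real (k z t) * fourier_split f z (a \<bullet> z))"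
  proof (rule integral_swap_weight)
    show "AE z in lborel. (\<integral>\<^sup>+t. ennreal (k z t) \<partial>lborel) = ennreal (W z)"
      using AE_plane_neq
    proof eventually_elim
      case (elim z)
      then have "z \<noteq> 0" by auto
      then show ?case unfolding k_def W_def by (intro nn_integral_gamma r) simp
    qed
    show "(\<lambda>(z, t). k z t) \<in> borel_measurable borel"
      unfolding k_def split_beta' by measurable
  qed (use int1 r Gamma_real_pos[OF r(1)] in \<open>auto simp: k_def W_def\<close>)
  also have "\<dots> = (LBINT t. LBINT u. of_real (k' u t) * f u)"
  proof (rule Bochner_Integration.integral_cong[OF refl])
    fix t :: real
    show "(LBINT z. of_real (k z t) * fourier_split f z (a \<bullet> z)) = (LBINT u. of_real (k' u t) * f u)"
    proof (cases "t > 0")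
      case True
      have "(LBINT z. of_real (k z t) * fourier_split f z (a \<bullet> z)) = 
         (LBINT z. of_real (t powr (r - 1)) * (of_real (exp (- pi * t * (norm z)\<^sup>2)) * fourier_split f z (a \<bullet> z)))"
        unfolding k_def using True by (simp add: mult_ac)
      also have "\<dots> = of_real (t powr (r - 1)) * (LBINT z. of_real (exp (- pi * t * (norm z)\<^sup>2)) * fourier_split f z (a \<bullet> z))"
        by (rule integral_mult_right_zero)
      also have "\<dots> = of_real (t powr (r - 1)) * (LBINT u. of_real (exp (- pi * (norm (fst u + snd u *\<^sub>R a))\<^sup>2 / t) / t) * f u)"
        unfolding plane_integral_gauss[OF f True] ..
      also have "\<dots> = (LBINT u. of_real (t powr (r - 1)) * (of_real (exp (- pi * (norm (fst u + snd u *\<^sub>R a))\<^sup>2 / t) / t) * f u))"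
        by (rule integral_mult_right_zero[symmetric])
      also have "\<dots> = (LBINT u. of_real (k' u t) * f u)"
      proof -
        have "t powr (- (1 - r) - 1) = t powr (r - 1) / t" using True by (simp add: powr_diff powr_add field_simps power2_eq_square)
        then show ?thesis unfolding k'_def using True by (simp add: mult_ac)
      qed
      finally show ?thesis .
    qed (simp add: k_def k'_def)
  qed
  also have "\<dots> = (LBINT u. of_real (W' u) * f u)"
  proof (rule integral_swap_weight[symmetric])
    show "AE u in lborel. (\<integral>\<^sup>+t. ennreal (k' u t) \<partial>lborel) = ennreal (W' u)"
      using AE_sheared_neq[of a]
    proof eventually_elim
      case (elim u)
      then show ?case unfolding k'_def W'_def by (intro nn_integral_inv_gamma) (use r in auto)
    qed
    have [measurable]: "(\<lambda>p::(plane\<times>real)\<times>real. fst (fst p) + snd (fst p) *\<^sub>R a) \<in> borel_measurable borel"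
      by (intro borel_measurable_continuous_onI continuous_intros)
    show "(\<lambda>(u, t). k' u t) \<in> borel_measurable borel"
      unfolding k'_def split_beta' by measurable
  qed (use int2 r inv_gamma(2)[of "1 - r"] in \<open>auto simp: k'_def W'_def\<close>)
  finally show ?thesis unfolding Weq W'eq of_real_mult mult.assoc integral_mult_right_zero .
qed

lemma tendsto_sqrt_inverse_Suc: "(\<lambda>n. sqrt (1 / real (Suc n))) \<longlonglongrightarrow> 0"
proof -
  have "(\<lambda>n. 1 / real (Suc n)) \<longlonglongrightarrow> 0" using LIMSEQ_inverse_real_of_nat by (simp add: inverse_eq_divide)
  from tendsto_real_sqrt[OF this] show ?thesis by simp
qed

text \<open>The limiting case \<open>r = 0\<close>: the integral of a transform over a plane is the integral of the function over the
orthogonal line. Both sides of \<open>plane_integral_gauss\<close> converge as the width \<open>t\<close> tends to \<open>0\<close>; on the right the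
Gaussian is first rescaled to a fixed one, so that the limit moves into the argument of \<open>f\<close>.\<close>

lemma plane_integral_eq_line_integral:
  fixes f :: "plane\<times>real \<Rightarrow> complex"
  assumes f: "integrable lborel f" and K: "\<And>u. norm (f u) \<le> K * (1 / (1 + (snd u)\<^sup>2))"
    and c: "continuous_on UNIV f"
    and B: "\<And>z w. norm (fourier_split f z w) \<le> B * plane_weight z"
  shows "(LBINT z. fourier_split f z (a \<bullet> z)) = (LBINT \<tau>. f (- \<tau> *\<^sub>R a, \<tau>))"
proof -
  have fm[measurable]: "f \<in> borel_measurable borel" using f by auto
  note hm[measurable] = measurable_fourier_split_slice[OF fm, of a]
  define t where "t = (\<lambda>n. 1 / real (Suc n))"
  have t: "t n > 0" for n unfolding t_def by simp
  have t0: "t \<longlonglongrightarrow> 0" unfolding t_def using LIMSEQ_inverse_real_of_nat by (simp add: inverse_eq_divide)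
  let ?L = "\<lambda>n. LBINT z. of_real (exp (- pi * t n * (norm z)\<^sup>2)) * fourier_split f z (a \<bullet> z)"
  have "?L \<longlonglongrightarrow> (LBINT z. fourier_split f z (a \<bullet> z))"
  proof (rule integral_dominated_convergence)
    show "integrable lborel (\<lambda>z. B * plane_weight z)" by (intro integrable_mult_right integrable_plane_weight)
    show "AE z in lborel. (\<lambda>n. of_real (exp (- pi * t n * (norm z)\<^sup>2)) * fourier_split f z (a \<bullet> z)) \<longlonglongrightarrow> fourier_split f z (a \<bullet> z)"
      by (rule AE_I2) (auto intro!: tendsto_eq_intros t0)
    show "AE z in lborel. norm (of_real (exp (- pi * t n * (norm z)\<^sup>2)) * fourier_split f z (a \<bullet> z)) \<le> B * plane_weight z" for n
    proof (rule AE_I2)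
      fix z
      have "norm (of_real (exp (- pi * t n * (norm z)\<^sup>2)) * fourier_split f z (a \<bullet> z)) \<le> 1 * norm (fourier_split f z (a \<bullet> z))"
        unfolding norm_mult by (rule mult_right_mono) (use t[of n] in auto)
      also have "\<dots> \<le> B * plane_weight z" using B by simp
      finally show "norm (of_real (exp (- pi * t n * (norm z)\<^sup>2)) * fourier_split f z (a \<bullet> z)) \<le> B * plane_weight z" .
    qed
  qed measurable
  moreover have "?L \<longlonglongrightarrow> (LBINT \<tau>. f (- \<tau> *\<^sub>R a, \<tau>))"
  proof -
    let ?E = "\<lambda>x::plane. exp (- pi * 1 * (norm x)\<^sup>2)"
    define g where "g = (\<lambda>n (p::real\<times>plane). of_real (?E (snd p)) * f (- fst p *\<^sub>R a + sqrt (t n) *\<^sub>R snd p, fst p))"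
    define g0 where "g0 = (\<lambda>p::real\<times>plane. of_real (?E (snd p)) * f (- fst p *\<^sub>R a, fst p))"
    let ?w = "\<lambda>(\<tau>::real, x). K * (1 / (1 + \<tau>\<^sup>2)) * ?E x"
    have w: "integrable lborel ?w"
      by (intro lborel_integrable_product integrable_mult_right integrable_inverse_square integrable_gauss2) simp
    have mg: "g n \<in> borel_measurable borel" for n unfolding g_def
      by (intro borel_measurable_continuous_onI continuous_intros continuous_on_compose2[OF c]) auto
    have mg0: "g0 \<in> borel_measurable borel" unfolding g0_def
      by (intro borel_measurable_continuous_onI continuous_intros continuous_on_compose2[OF c]) auto
    have gb: "norm (g n p) \<le> ?w p" for n p
    proof -
      obtain \<tau> x where p: "p = (\<tau>, x)" by (cases p)
      have "?E x * norm (f (- \<tau> *\<^sub>R a + sqrt (t n) *\<^sub>R x, \<tau>)) \<le> ?E x * (K * (1 / (1 + \<tau>\<^sup>2)))"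
        using K[of "(- \<tau> *\<^sub>R a + sqrt (t n) *\<^sub>R x, \<tau>)"] by (intro mult_left_mono) auto
      then show ?thesis unfolding p g_def by (simp add: norm_mult mult_ac)
    qed
    have g: "integrable lborel (g n)" for n
      by (rule Bochner_Integration.integrable_bound[OF w])
         (use mg in simp, rule AE_I2, rule order_trans[OF gb], simp only: real_norm_def abs_ge_self)
    have lim: "(\<lambda>n. LBINT p. g n p) \<longlonglongrightarrow> (LBINT p. g0 p)"
    proof (rule integral_dominated_convergence[OF _ _ w])
      show "AE p in lborel. (\<lambda>n. g n p) \<longlonglongrightarrow> g0 p"
      proof (rule AE_I2)
        fix p :: "real \<times> plane"
        let ?q = "(- fst p *\<^sub>R a + 0 *\<^sub>R snd p, fst p)"
        have "(\<lambda>n. (- fst p *\<^sub>R a + sqrt (t n) *\<^sub>R snd p, fst p)) \<longlonglongrightarrow> ?q"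
          unfolding t_def by (intro tendsto_intros tendsto_sqrt_inverse_Suc)
        moreover have "isCont f ?q" using c continuous_on_eq_continuous_at[OF open_UNIV] by blast
        ultimately have "(\<lambda>n. f (- fst p *\<^sub>R a + sqrt (t n) *\<^sub>R snd p, fst p)) \<longlonglongrightarrow> f ?q"
          by (rule isCont_tendsto_compose[rotated])
        from tendsto_mult_left[OF this, of "of_real (?E (snd p))"]
        show "(\<lambda>n. g n p) \<longlonglongrightarrow> g0 p" by (simp add: g_def g0_def)
      qed
      show "AE p in lborel. norm (g n p) \<le> ?w p" for n by (rule AE_I2, rule gb)
    qed (use mg mg0 in auto)
    have g0val: "(LBINT p. g0 p) = (LBINT \<tau>. f (- \<tau> *\<^sub>R a, \<tau>))"
    proof -
      have i: "integrable lborel (\<lambda>\<tau>. f (- \<tau> *\<^sub>R a, \<tau>))"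
      proof (rule Bochner_Integration.integrable_bound[OF integrable_mult_right[OF integrable_inverse_square, of K]])
        show "(\<lambda>\<tau>. f (- \<tau> *\<^sub>R a, \<tau>)) \<in> borel_measurable lborel"
          unfolding measurable_lborel2
          by (intro borel_measurable_continuous_onI continuous_on_compose2[OF c] continuous_intros) auto
        show "AE \<tau> in lborel. norm (f (- \<tau> *\<^sub>R a, \<tau>)) \<le> norm (K * (1 / (1 + \<tau>\<^sup>2)))"
          using K[of "(- \<tau> *\<^sub>R a, \<tau>)" for \<tau>] by (intro AE_I2) (metis abs_ge_self order_trans real_norm_def snd_conv)
      qed
      have e: "integrable lborel (\<lambda>x. of_real (?E x) :: complex)" 
        unfolding complex_of_real_integrable_eq by (rule integrable_gauss2) simp
      have "(LBINT p. g0 p) = (LBINT p. f (- fst p *\<^sub>R a, fst p) * of_real (?E (snd p)))"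
        by (simp add: g0_def mult.commute)
      also have "\<dots> = (LBINT \<tau>. f (- \<tau> *\<^sub>R a, \<tau>)) * (LBINT x. of_real (?E x))"
        by (rule lborel_integral_product[OF i e])
      also have "(LBINT x. of_real (?E x)) = (of_real 1 :: complex)"
        unfolding integral_complex_of_real using integral_gauss2[of 1] by simp
      finally show ?thesis by simp
    qed
    have "?L n = (LBINT p. g n p)" for n
    proof -
      let ?F = "\<lambda>u. of_real (exp (- pi * (norm (fst u + snd u *\<^sub>R a))\<^sup>2 / t n) / t n) * f u"
      have mF: "?F \<in> borel_measurable borel"
        by (intro borel_measurable_continuous_onI continuous_intros continuous_on_compose2[OF c]) (use t[of n] in auto)
      have F: "integrable lborel ?F"
      proof (rule Bochner_Integration.integrable_bound[OF integrable_mult_right[OF integrable_norm[OF f], of "1 / t n"]])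
        show "AE u in lborel. norm (?F u) \<le> norm (1 / t n * norm (f u))"
          using t[of n] by (intro AE_I2) (auto simp: norm_mult norm_divide intro!: divide_right_mono mult_left_le_one_le)
      qed (use mF in simp)
      have "?L n = (LBINT u. ?F u)" by (rule plane_integral_gauss[OF f t])
      also have "\<dots> = (LBINT \<tau>. LBINT y. ?F (y, \<tau>))"
        by (rule lborel_fubini_snd[OF F, symmetric])
      also have "\<dots> = (LBINT \<tau>. LBINT x. g n (\<tau>, x))"
      proof (rule Bochner_Integration.integral_cong[OF refl])
        fix \<tau>
        have "(\<lambda>y. ?F (y, \<tau>)) \<in> borel_measurable borel"
          by (intro borel_measurable_continuous_onI continuous_intros continuous_on_compose2[OF c]) (use t[of n] in auto)
        from lborel_integral_affine[OF _ this, of "sqrt (t n)" "- \<tau> *\<^sub>R a"]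
        have "(LBINT y. ?F (y, \<tau>)) = t n *\<^sub>R (LBINT x. ?F (- \<tau> *\<^sub>R a + sqrt (t n) *\<^sub>R x, \<tau>))"
          using t[of n] by simp
        also have "\<dots> = (LBINT x. t n *\<^sub>R ?F (- \<tau> *\<^sub>R a + sqrt (t n) *\<^sub>R x, \<tau>))"
          by (rule integral_scaleR_right[symmetric])
        also have "\<dots> = (LBINT x. g n (\<tau>, x))"
          using t[of n] by (intro Bochner_Integration.integral_cong refl)
            (simp add: g_def scaleR_conv_of_real power_mult_distrib)
        finally show "(LBINT y. ?F (y, \<tau>)) = (LBINT x. g n (\<tau>, x))" .
      qed
      also have "\<dots> = (LBINT p. g n p)" by (rule lborel_fubini_fst[OF g])
      finally show ?thesis .
    qed
    then show ?thesis using lim g0val by simp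
  qed
  ultimately show ?thesis by (rule LIMSEQ_unique)
qed

section \<open>Radial profiles and their line integrals\<close>

lemma integrable_profile:
  fixes h :: "real \<Rightarrow> real"
  assumes "continuous_on UNIV h" "\<And>t. T\<^sup>2 \<le> t \<Longrightarrow> h t = 0" "0 < T"
  shows "integrable lborel (\<lambda>a::'a::euclidean_space. h ((norm a)\<^sup>2))"
proof -
  have "integrable lborel (\<lambda>a::'a. h ((norm a)\<^sup>2) * 1)"
  proof (rule integrable_mult_continuous_compact_support[where L="cball 0 T"])
    show "integrable lborel (\<lambda>b::'a. indicator (cball 0 T) b *\<^sub>R (1::real))"
      unfolding real_scaleR_def mult_1_right
      by (rule integrable_real_indicator) (simp_all add: emeasure_lborel_cball_finite flip: infinity_ennreal_def)
    show "continuous_on UNIV (\<lambda>a::'a. h ((norm a)\<^sup>2))"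
      by (intro continuous_on_compose2[OF assms(1)] continuous_intros) auto
    fix b :: 'a assume "b \<notin> cball 0 T"
    then have "T\<^sup>2 \<le> (norm b)\<^sup>2" using assms(3) by (intro power_mono) auto
    then show "h ((norm b)\<^sup>2) = 0" by (rule assms(2))
  qed simp
  then show ?thesis by simp
qed

text \<open>The integral of the radial function \<open>a \<mapsto> h(|a|\<^sup>2)\<close> along any line at distance \<open>|p|\<close> from the origin.\<close>

definition radon :: "(real \<Rightarrow> real) \<Rightarrow> real \<Rightarrow> real" where
  "radon h p = (LBINT q. h (p\<^sup>2 + q\<^sup>2))"

lemma integrable_radon:
  fixes h :: "real \<Rightarrow> real"
  assumes "continuous_on UNIV h" "\<And>t. T\<^sup>2 \<le> t \<Longrightarrow> h t = 0" "0 < T"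
  shows "integrable lborel (radon h)"
proof -
  have "integrable lborel (\<lambda>z::plane. h ((norm z)\<^sup>2))" by (rule integrable_profile[OF assms])
  from lborel_fubini_integrable_fst[OF this] show ?thesis unfolding radon_def by (simp add: norm_plane)
qed

text \<open>A rotation that takes \<open>z\<close> to the first axis turns \<open>a \<bullet> z\<close> into the first coordinate of \<open>a\<close> times \<open>|z|\<close>; the second
coordinate is then integrated out.\<close>

lemma radon_slice:
  fixes h :: "real \<Rightarrow> real" and \<Psi> :: "real \<Rightarrow> complex" and z :: "plane"
  assumes h: "continuous_on UNIV h" "\<And>t. T\<^sup>2 \<le> t \<Longrightarrow> h t = 0" "0 < T"
    and \<Psi>[measurable]: "\<Psi> \<in> borel_measurable borel" and bd: "\<And>w. norm (\<Psi> w) \<le> C" and z: "z \<noteq> 0"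
  shows "(LBINT p. of_real (radon h p) * \<Psi> (p * norm z)) = (LBINT a. of_real (h ((norm a)\<^sup>2)) * \<Psi> (a \<bullet> z))"
proof -
  obtain x y where xy: "z = (x, y)" by (cases z)
  let ?n = "norm z"
  have n: "?n > 0" using z by simp
  let ?G = "\<lambda>a::plane. of_real (h ((norm a)\<^sup>2)) * \<Psi> (fst a * ?n)"
  have [measurable]: "h \<in> borel_measurable borel" using h(1) by (rule borel_measurable_continuous_onI)
  have i: "integrable lborel (\<lambda>a::plane. h ((norm a)\<^sup>2))" by (rule integrable_profile[OF h])
  have mG[measurable]: "?G \<in> borel_measurable borel" by measurable
  have G: "integrable lborel ?G"
  proof (rule Bochner_Integration.integrable_bound[OF integrable_mult_left[OF integrable_norm[OF i], of C]])
    show "AE a in lborel. norm (?G a) \<le> norm (norm (h ((norm a)\<^sup>2)) * C)"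
    proof (rule AE_I2)
      fix a :: "plane"
      have "norm (?G a) \<le> norm (h ((norm a)\<^sup>2)) * C" unfolding norm_mult norm_of_real real_norm_def by (intro mult_left_mono bd) auto
      then show "norm (?G a) \<le> norm (norm (h ((norm a)\<^sup>2)) * C)" unfolding real_norm_def by linarith
    qed
  qed simp
  define c where "c = x / ?n"
  define d where "d = y / ?n"
  have cd: "c\<^sup>2 + d\<^sup>2 = 1"
  proof -
    have "c\<^sup>2 + d\<^sup>2 = (norm z)\<^sup>2 / (norm z)\<^sup>2"
      unfolding c_def d_def power_divide norm_plane[of z] by (simp only: xy fst_conv snd_conv add_divide_distrib)
    then show ?thesis using n by simp
  qed
  let ?R = "\<lambda>(x, y). (c * x + d * y, c * y - d * x)"
  have [measurable]: "?R \<in> borel_measurable borel"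
    by (intro borel_measurable_continuous_onI) (auto simp: split_beta' intro!: continuous_intros)
  have R: "?G (?R a) = of_real (h ((norm a)\<^sup>2)) * \<Psi> (a \<bullet> z)" for a
  proof -
    obtain p q where a: "a = (p, q)" by (cases a)
    have "(norm (?R a))\<^sup>2 = (c\<^sup>2 + d\<^sup>2) * (p\<^sup>2 + q\<^sup>2)" unfolding norm_plane a by (simp add: algebra_simps power2_eq_square)
    then have 1: "(norm (?R a))\<^sup>2 = (norm a)\<^sup>2" unfolding norm_plane cd a by simp
    have 2: "fst (?R a) * ?n = a \<bullet> z" unfolding a xy c_def d_def using n xy by (simp add: field_simps inner_prod_def)
    show ?thesis unfolding 1 2 ..
  qed
  have "(LBINT p. of_real (radon h p) * \<Psi> (p * ?n)) = (LBINT p. LBINT q. ?G (p, q))"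
  proof (rule Bochner_Integration.integral_cong[OF refl])
    fix p
    have "(LBINT q. ?G (p, q)) = (LBINT q. of_real (h (p\<^sup>2 + q\<^sup>2)) * \<Psi> (p * ?n))"
      by (simp add: norm_plane)
    also have "\<dots> = (LBINT q. of_real (h (p\<^sup>2 + q\<^sup>2))) * \<Psi> (p * ?n)"
      by (rule integral_mult_left_zero)
    also have "\<dots> = of_real (radon h p) * \<Psi> (p * ?n)" unfolding radon_def integral_complex_of_real ..
    finally show "of_real (radon h p) * \<Psi> (p * ?n) = (LBINT q. ?G (p, q))" ..
  qed
  also have "\<dots> = (LBINT a. ?G a)" by (rule lborel_fubini_fst[OF G])
  also have "\<dots> = (\<integral>a. ?G a \<partial>distr lborel borel ?R)" unfolding distr_rotation[OF cd] ..
  also have "\<dots> = (LBINT a. ?G (?R a))" by (rule integral_distr) measurable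
  finally show ?thesis unfolding R .
qed

text \<open>The substitution \<open>w = p |z|\<close> in the vertical variable, followed by \<open>radon_slice\<close>, exhibits the cone function as a
superposition of weighted planes \<open>w = a \<bullet> z\<close>.\<close>

lemma cone_pairing:
  fixes h :: "real \<Rightarrow> real"
  assumes h: "continuous_on UNIV h" "\<And>t. T\<^sup>2 \<le> t \<Longrightarrow> h t = 0" "0 < T" and r: "0 \<le> r" "r < 1"
    and f: "integrable lborel f" and B: "\<And>z w. norm (fourier_split f z w) \<le> B * plane_weight z"
  shows "(LBINT u. of_real (norm (fst u) powr (- (1 + 2 * r)) * radon h (snd u / norm (fst u))) * fourier_split f (fst u) (snd u))
     = (LBINT a. of_real (h ((norm a)\<^sup>2)) * (LBINT z. of_real (norm z powr (- 2 * r)) * fourier_split f z (a \<bullet> z)))"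
proof -
  have fm[measurable]: "f \<in> borel_measurable borel" using f by auto
  have hm[measurable]: "h \<in> borel_measurable borel" using h(1) by (rule borel_measurable_continuous_onI)
  note hatm = measurable_fourier_split[OF fm]
  have B0: "B \<ge> 0" using order_trans[OF norm_ge_zero B[of 0 0]] by simp
  have hatb: "norm (fourier_split f z w) \<le> B" for z w
    using order_trans[OF B mult_left_mono[OF plane_weight_le_1 B0]] by simp
  have hatz[measurable]: "fourier_split f z \<in> borel_measurable borel" for z
    using measurable_compose[OF _ hatm, of "\<lambda>w. (z, w)" borel] by (auto intro!: borel_measurable_continuous_onI continuous_intros)
  note ir = integrable_radon[OF h]
  have rm[measurable]: "radon h \<in> borel_measurable borel" using ir by auto
  let ?F = "\<lambda>u. of_real (norm (fst u) powr (- (1 + 2 * r)) * radon h (snd u / norm (fst u))) * fourier_split f (fst u) (snd u)"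
  have mF: "?F \<in> borel_measurable borel" using hatm unfolding split_beta' by measurable
  have dil: "integrable lborel (\<lambda>w. radon h (w / n))" "(LBINT w. norm (radon h (w / n))) = n * (LBINT p. norm (radon h p))" if "n > 0" for n
  proof -
    show "integrable lborel (\<lambda>w. radon h (w / n))"
      using lborel_integrable_real_affine[OF ir, of "1 / n" 0] that by simp
    show "(LBINT w. norm (radon h (w / n))) = n * (LBINT p. norm (radon h p))"
      using lborel_integral_real_affine[of n "\<lambda>w. norm (radon h (w / n))" 0] that by simp
  qed
  let ?b = "\<lambda>z w. norm z powr (- (1 + 2 * r)) * (B * plane_weight z) * norm (radon h (w / norm z))"
  let ?R = "LBINT p. norm (radon h p)"
  have nz: "norm z powr (- (1 + 2 * r)) * norm z = norm z powr (- 2 * r)" if "z \<noteq> 0" for z :: plane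
    using that by (simp add: powr_diff powr_minus powr_add field_simps)
  have F: "integrable lborel ?F"
  proof (rule lborel_integrable_iterated_fst[OF mF integrable_mult_right[OF integrable_powr_weight[OF r], of "B * ?R"]])
    show "AE z in lborel. integrable lborel (?b z) \<and> (LBINT w. ?b z w) \<le> B * ?R * (norm z powr (- 2 * r) * plane_weight z) \<and>
      (\<forall>w. norm (?F (z, w)) \<le> ?b z w)"
      using AE_plane_neq
    proof eventually_elim
      case (elim z)
      then have z: "z \<noteq> 0" by auto
      then have n: "norm z > 0" by simp
      have "(LBINT w. ?b z w) = norm z powr (- (1 + 2 * r)) * (B * plane_weight z) * (norm z * ?R)"
        unfolding dil(2)[OF n, symmetric] by (rule integral_mult_right_zero)
      also have "\<dots> = B * ?R * (norm z powr (- 2 * r) * plane_weight z)"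
        unfolding nz[OF z, symmetric] by (simp only: mult_ac)
      finally have e1: "(LBINT w. ?b z w) = B * ?R * (norm z powr (- 2 * r) * plane_weight z)" .
      have e2: "integrable lborel (?b z)" by (intro integrable_mult_right integrable_norm dil n)
      have e3: "norm (?F (z, w)) \<le> ?b z w" for w
      proof -
        have "norm (?F (z, w)) = norm z powr (- (1 + 2 * r)) * norm (radon h (w / norm z)) * norm (fourier_split f z w)"
          by (simp add: norm_mult abs_mult)
        also have "\<dots> \<le> norm z powr (- (1 + 2 * r)) * norm (radon h (w / norm z)) * (B * plane_weight z)"
          by (intro mult_left_mono B) auto
        finally show ?thesis by (simp add: mult_ac)
      qed
      show ?case by (intro conjI allI e2 e3 eq_refl[OF e1])
    qed
  qed
  let ?H = "\<lambda>z a. of_real (h ((norm a)\<^sup>2)) * (of_real (norm z powr (- 2 * r)) * fourier_split f z (a \<bullet> z))"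
  have H: "integrable lborel (\<lambda>(z, a). ?H z a)"
  proof (rule integrable_dominated[OF lborel_integrable_product[OF
        integrable_mult_right[OF integrable_powr_weight[OF r], of B] integrable_norm[OF integrable_profile[OF h]]]])
    have [measurable]: "(\<lambda>p::plane\<times>plane. fourier_split f (fst p) (snd p \<bullet> fst p)) \<in> borel_measurable borel"
    proof -
      have "(\<lambda>p::plane\<times>plane. (fst p, snd p \<bullet> fst p)) \<in> borel_measurable borel"
        by (intro borel_measurable_continuous_onI continuous_intros)
      from measurable_compose[OF this hatm] show ?thesis by simp
    qed
    show "(\<lambda>(z, a). ?H z a) \<in> borel_measurable lborel" unfolding split_beta' by measurable
    fix p :: "plane\<times>plane"
    obtain z a where p: "p = (z, a)" by (cases p)
    have "norm (?H z a) = norm (h ((norm a)\<^sup>2)) * norm z powr (- 2 * r) * norm (fourier_split f z (a \<bullet> z))" by (simp add: norm_mult)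
    also have "\<dots> \<le> norm (h ((norm a)\<^sup>2)) * norm z powr (- 2 * r) * (B * plane_weight z)" by (intro mult_left_mono B) auto
    finally show "norm (case p of (z, a) \<Rightarrow> ?H z a) \<le> (case p of (z, a) \<Rightarrow> B * (norm z powr (- 2 * r) * plane_weight z) * norm (h ((norm a)\<^sup>2)))"
      unfolding p prod.case by (simp only: mult_ac)
  qed
  have "(LBINT u. ?F u) = (LBINT z. LBINT w. ?F (z, w))" by (rule lborel_fubini_fst[OF F, symmetric])
  also have "\<dots> = (LBINT z. LBINT a. ?H z a)"
  proof (rule Bochner_Integration.integral_cong[OF refl])
    fix z
    show "(LBINT w. ?F (z, w)) = (LBINT a. ?H z a)"
    proof (cases "z = 0")
      case True then show ?thesis by simp
    next
      case False
      then have n: "norm z > 0" by simp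
      have "(LBINT w. ?F (z, w)) = \<bar>norm z\<bar> *\<^sub>R (LBINT p. ?F (z, 0 + norm z * p))"
        using n by (intro lborel_integral_real_affine) simp
      also have "\<dots> = (LBINT p. \<bar>norm z\<bar> *\<^sub>R ?F (z, 0 + norm z * p))" by (rule integral_scaleR_right[symmetric])
      also have "\<dots> = (LBINT p. of_real (norm z powr (- 2 * r)) * (of_real (radon h p) * fourier_split f z (p * norm z)))"
      proof -
        have "norm z powr (- 2 * r) = norm z * norm z powr (- (1 + 2 * r))"
          using n by (simp add: powr_diff powr_minus powr_add field_simps)
        then show ?thesis using n by (simp add: scaleR_conv_of_real mult_ac)
      qed
      also have "\<dots> = of_real (norm z powr (- 2 * r)) * (LBINT p. of_real (radon h p) * fourier_split f z (p * norm z))"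
        by (rule integral_mult_right_zero)
      also have "\<dots> = of_real (norm z powr (- 2 * r)) * (LBINT a. of_real (h ((norm a)\<^sup>2)) * fourier_split f z (a \<bullet> z))"
        using radon_slice[OF h, of "fourier_split f z" B z] hatz hatb False by simp
      also have "\<dots> = (LBINT a. of_real (norm z powr (- 2 * r)) * (of_real (h ((norm a)\<^sup>2)) * fourier_split f z (a \<bullet> z)))"
        by (rule integral_mult_right_zero[symmetric])
      finally show ?thesis by (simp add: mult_ac)
    qed
  qed
  also have "\<dots> = (LBINT a. LBINT z. ?H z a)" by (rule lborel_fubini_swap[OF H])
  also have "\<dots> = (LBINT a. of_real (h ((norm a)\<^sup>2)) * (LBINT z. of_real (norm z powr (- 2 * r)) * fourier_split f z (a \<bullet> z)))"
    unfolding integral_mult_right_zero ..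
  finally show ?thesis .
qed

section \<open>Cone functions\<close>

definition horiz :: "real^3 \<Rightarrow> plane" where "horiz x = (x$1, x$2)"

lemma horiz_coords [simp]: "horiz (coords u) = fst u" by (simp add: horiz_def)

lemma norm_horiz: "(norm (horiz x))\<^sup>2 = (x$1)\<^sup>2 + (x$2)\<^sup>2" by (simp add: norm_plane horiz_def)

lemma horiz_scaleR: "horiz (c *\<^sub>R x) = c *\<^sub>R horiz x" by (simp add: horiz_def)

lemma horiz_eq_0: "horiz x = 0 \<Longrightarrow> x$3 = 0 \<Longrightarrow> x = 0"
  by (simp add: horiz_def zero_prod_def vec_eq_iff forall_3)

lemma continuous_on_horiz [continuous_intros]: "continuous_on S f \<Longrightarrow> continuous_on S (\<lambda>x. horiz (f x))"
  unfolding horiz_def by (intro continuous_intros)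

lemma measurable_horiz [measurable]: "horiz \<in> borel_measurable borel"
  by (intro borel_measurable_continuous_onI continuous_intros)

lemma measurable_nth3 [measurable]: "(\<lambda>x::real^3. x $ i) \<in> borel_measurable borel"
  by (intro borel_measurable_continuous_onI continuous_intros)

text \<open>A function that is already homogeneous on the whole space agrees with the extension of its restriction to the
sphere.\<close>

lemma homog_homogeneous:
  assumes "\<And>c x. 0 < c \<Longrightarrow> g (c *\<^sub>R x) = c powr p * g x" "g 0 = 0"
  shows "homog p g x = of_real (g x)"
proof (cases "x = 0")
  case True then show ?thesis using assms(2) by (simp add: homog_def)
next
  case False
  then have "g (sgn x) = inverse (norm x) powr p * g x" unfolding sgn_div_norm by (intro assms(1)) simp
  moreover have "norm x powr p * inverse (norm x) powr p = 1" using False by (simp flip: powr_mult)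
  ultimately show ?thesis unfolding homog_def by (metis mult.assoc mult_1)
qed

lemma measurable_fourier:
  fixes f :: "real^3 \<Rightarrow> complex"
  assumes [measurable]: "f \<in> borel_measurable borel"
  shows "fourier f \<in> borel_measurable borel"
proof -
  have [measurable]: "(\<lambda>p::(real^3)\<times>(real^3). snd p \<bullet> fst p) \<in> borel_measurable (borel \<Otimes>\<^sub>M borel)"
    unfolding borel_prod by (intro borel_measurable_continuous_onI continuous_intros)
  have "(\<lambda>\<xi>. LBINT x. f x * phase (x \<bullet> \<xi>)) \<in> borel_measurable borel"
    by (rule lborel.borel_measurable_lebesgue_integral) (simp add: split_beta')
  then show ?thesis unfolding fourier_phase[abs_def] .
qed

text \<open>The function itself, homogeneous of degree \<open>-s\<close> on the whole space; it doubles as the angle function. On the axis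
it is \<open>0\<close> because \<open>0 powr (- s) = 0\<close>.\<close>

definition cone_fun :: "real \<Rightarrow> (real \<Rightarrow> real) \<Rightarrow> real^3 \<Rightarrow> real" where
  "cone_fun s h x = norm (horiz x) powr (- s) * radon h (x$3 / norm (horiz x))"

text \<open>The quotient of the constants in \<open>plane_integral_powr\<close> for \<open>2 r = s - 1\<close>.\<close>

definition riesz_const :: "real \<Rightarrow> real" where
  "riesz_const s = inv_gamma (1 - (s - 1) / 2) / (Gamma ((s - 1) / 2) * pi powr (- ((s - 1) / 2)))"

definition cone_hat :: "real \<Rightarrow> (real \<Rightarrow> real) \<Rightarrow> real^3 \<Rightarrow> real" where
  "cone_hat s h \<xi> = riesz_const s * (LBINT a. h ((norm a)\<^sup>2) * norm (horiz \<xi> + \<xi>$3 *\<^sub>R a) powr (s - 3))"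

text \<open>On the plane \<open>\<xi>\<^sub>3 = 0\<close> division by zero gives \<open>0\<close>, which is also the smooth continuation when \<open>h\<close> has compact
support.\<close>

definition cone_hat1 :: "(real \<Rightarrow> real) \<Rightarrow> real^3 \<Rightarrow> real" where
  "cone_hat1 h \<xi> = h ((norm (horiz \<xi>))\<^sup>2 / (\<xi>$3)\<^sup>2) / (\<xi>$3)\<^sup>2"

lemma riesz_const_pos: "1 < s \<Longrightarrow> s < 3 \<Longrightarrow> 0 < riesz_const s"
  unfolding riesz_const_def by (intro divide_pos_pos mult_pos_pos inv_gamma Gamma_real_pos) auto

lemma cone_fun_scaleR: "0 < c \<Longrightarrow> cone_fun s h (c *\<^sub>R x) = c powr (- s) * cone_fun s h x"
  unfolding cone_fun_def by (simp add: horiz_scaleR powr_mult)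

lemma cone_fun_0: "horiz x = 0 \<Longrightarrow> cone_fun s h x = 0"
  unfolding cone_fun_def by simp

lemma cone_hat_scaleR: 
  assumes "0 < c" shows "cone_hat s h (c *\<^sub>R x) = c powr (- 3 + s) * cone_hat s h x"
proof -
  have "norm (horiz (c *\<^sub>R x) + (c *\<^sub>R x)$3 *\<^sub>R a) powr (s - 3) = c powr (- 3 + s) * norm (horiz x + x$3 *\<^sub>R a) powr (s - 3)" for a
  proof -
    have "horiz (c *\<^sub>R x) + (c *\<^sub>R x)$3 *\<^sub>R a = c *\<^sub>R (horiz x + x$3 *\<^sub>R a)" by (simp add: horiz_scaleR scaleR_add_right)
    then show ?thesis using assms by (simp add: powr_mult)
  qed
  then show ?thesis unfolding cone_hat_def by (simp add: mult_ac)
qed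

lemma cone_hat1_scaleR:
  assumes "0 < c" shows "cone_hat1 h (c *\<^sub>R x) = c powr (- 3 + 1) * cone_hat1 h x"
proof -
  have "c powr (- 3 + 1) = 1 / c\<^sup>2" using assms by (simp add: powr_minus divide_inverse)
  then show ?thesis using assms unfolding cone_hat1_def by (simp add: horiz_scaleR power_mult_distrib)
qed

text \<open>A density on the plane that is radial, smooth and supported in the disc of radius \<open>T\<close>. Taking \<open>h\<close> as a function
of the squared radius makes it smooth at the origin as well.\<close>

locale radial_profile =
  fixes h :: "real \<Rightarrow> real" and T :: real
  assumes h_smooth: "ndiff UNIV n h" and h_support: "T\<^sup>2 \<le> t \<Longrightarrow> h t = 0" and T_pos: "0 < T"
begin

lemma h_continuous: "continuous_on UNIV h"
  using ndiff_continuous_on[OF h_smooth[of 0]] .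

lemma h_measurable [measurable]: "h \<in> borel_measurable borel"
  using h_continuous by (rule borel_measurable_continuous_onI)

lemma h_integrable: "integrable lborel (\<lambda>a::plane. h ((norm a)\<^sup>2))"
  by (rule integrable_profile[OF h_continuous h_support T_pos])

lemma radon_measurable [measurable]: "radon h \<in> borel_measurable borel"
  using integrable_radon[OF h_continuous h_support T_pos] by auto

lemma h_bounded: "\<exists>M>0. \<forall>t\<ge>0. \<bar>h t\<bar> \<le> M"
proof -
  have "bounded (h ` {0..T\<^sup>2})"
    using h_continuous by (meson compact_Icc compact_continuous_image compact_imp_bounded continuous_on_subset subset_UNIV)
  then obtain M where M: "\<forall>t\<in>{0..T\<^sup>2}. \<bar>h t\<bar> \<le> M" by (auto simp: bounded_iff)
  have "\<bar>h t\<bar> \<le> \<bar>M\<bar> + 1" if "t \<ge> 0" for t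
    using M h_support[of t] that by (cases "t \<le> T\<^sup>2") force+
  then show ?thesis by (intro exI[of _ "\<bar>M\<bar> + 1"]) auto
qed

lemma radon_eq_0: "T\<^sup>2 \<le> p\<^sup>2 \<Longrightarrow> radon h p = 0"
proof -
  assume p: "T\<^sup>2 \<le> p\<^sup>2"
  have "h (p\<^sup>2 + q\<^sup>2) = 0" for q by (rule h_support) (use p in \<open>simp add: add_increasing2\<close>)
  then show ?thesis unfolding radon_def by simp
qed

text \<open>For \<open>\<tau> \<noteq> 0\<close> the kernel has one singularity, at \<open>- y / \<tau>\<close>, of integrable order.\<close>

lemma integrable_kernel:
  fixes y :: "plane" and \<tau> :: real
  assumes r: "0 < r" "r < 1" and \<tau>: "\<tau> \<noteq> 0"
  shows "integrable lborel (\<lambda>a. h ((norm a)\<^sup>2) * norm (y + \<tau> *\<^sub>R a) powr (- 2 * r))"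
proof -
  obtain M where M: "M > 0" "\<And>t. t \<ge> 0 \<Longrightarrow> \<bar>h t\<bar> \<le> M" using h_bounded by blast
  let ?k = "\<lambda>z::plane. norm z powr (- 2 * r) * exp (- pi * 1 * (norm z)\<^sup>2)"
  have "integrable lborel ?k" by (rule integrable_powr_gauss2) (use r in auto)
  then have k: "integrable lborel (\<lambda>a. ?k (y + \<tau> *\<^sub>R a))"
    by (subst lborel_integrable_affine[OF \<tau>]) auto
  let ?b = "\<lambda>a. M * exp pi * ?k (y + \<tau> *\<^sub>R a) + norm (h ((norm a)\<^sup>2))"
  have b: "integrable lborel ?b" by (intro Bochner_Integration.integrable_add integrable_mult_right integrable_norm k h_integrable)
  have le: "norm (h ((norm a)\<^sup>2) * norm (y + \<tau> *\<^sub>R a) powr (- 2 * r)) \<le> ?b a" for a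
  proof -
    have "norm (h ((norm a)\<^sup>2) * norm (y + \<tau> *\<^sub>R a) powr (- 2 * r)) = \<bar>h ((norm a)\<^sup>2)\<bar> * norm (y + \<tau> *\<^sub>R a) powr (- 2 * r)"
      by (simp add: abs_mult)
    also have "\<dots> \<le> \<bar>h ((norm a)\<^sup>2)\<bar> * (exp pi * ?k (y + \<tau> *\<^sub>R a) + 1)"
      using powr_le_gauss[of "2 * r" "y + \<tau> *\<^sub>R a"] r by (intro mult_left_mono) auto
    also have "\<dots> = \<bar>h ((norm a)\<^sup>2)\<bar> * (exp pi * ?k (y + \<tau> *\<^sub>R a)) + \<bar>h ((norm a)\<^sup>2)\<bar>"
      by (simp add: distrib_left)
    also have "\<dots> \<le> M * (exp pi * ?k (y + \<tau> *\<^sub>R a)) + \<bar>h ((norm a)\<^sup>2)\<bar>"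
      by (intro add_right_mono mult_right_mono M) auto
    finally show ?thesis by (simp add: mult_ac)
  qed
  show ?thesis
  proof (rule Bochner_Integration.integrable_bound[OF b])
    show "AE a in lborel. norm (h ((norm a)\<^sup>2) * norm (y + \<tau> *\<^sub>R a) powr (- 2 * r)) \<le> norm (?b a)"
      by (rule AE_I2, rule order_trans[OF le]) (simp only: real_norm_def abs_ge_self)
  qed measurable
qed

section \<open>The Fourier pair\<close>

text \<open>The pairing of a cone function with a transform, as a superposition of plane integrals. The degree \<open>-1\<close> is the
case \<open>r = 0\<close>.\<close>

lemma fourier_cone_slices:
  assumes \<phi>: "schwartz \<phi>" and r: "0 \<le> r" "r < 1"
  shows "regular_distr (homog (- (1 + 2 * r)) (cone_fun (1 + 2 * r) h)) (fourier \<phi>) = 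
     (LBINT a. of_real (h ((norm a)\<^sup>2)) * (LBINT z. of_real (norm z powr (- 2 * r)) * fourier_split (\<lambda>u. \<phi> (coords u)) z (a \<bullet> z)))"
proof -
  obtain B where "B > 0" and B: "\<forall>z w. norm (fourier \<phi> (coords (z, w))) \<le> B * plane_weight z"
    using fourier_decay_plane[OF \<phi>] by blast
  note fc = fourier_coords[OF schwartz_measurable[OF \<phi>]]
  note fm[measurable] = measurable_fourier[OF schwartz_measurable[OF \<phi>]]
  have hom: "homog (- (1 + 2 * r)) (cone_fun (1 + 2 * r) h) x = of_real (cone_fun (1 + 2 * r) h x)" for x
    by (rule homog_homogeneous) (simp_all add: cone_fun_scaleR cone_fun_0 horiz_def zero_prod_def)
  have "regular_distr (homog (- (1 + 2 * r)) (cone_fun (1 + 2 * r) h)) (fourier \<phi>) =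
     (LBINT x. of_real (cone_fun (1 + 2 * r) h x) * fourier \<phi> x)"
    unfolding regular_distr_def hom ..
  also have "\<dots> = (LBINT u. of_real (cone_fun (1 + 2 * r) h (coords u)) * fourier \<phi> (coords u))"
    by (rule lborel_integral_coords) (unfold cone_fun_def, measurable)
  also have "\<dots> = (LBINT u. of_real (norm (fst u) powr (- (1 + 2 * r)) * radon h (snd u / norm (fst u))) * fourier_split (\<lambda>u. \<phi> (coords u)) (fst u) (snd u))"
    using fc[of "fst u" "snd u" for u] by (simp add: cone_fun_def)
  also have "\<dots> = (LBINT a. of_real (h ((norm a)\<^sup>2)) * (LBINT z. of_real (norm z powr (- 2 * r)) * fourier_split (\<lambda>u. \<phi> (coords u)) z (a \<bullet> z)))"
    by (rule cone_pairing[OF h_continuous h_support T_pos r schwartz_integrable_coords[OF \<phi>], of B])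
       (assumption, unfold fc[symmetric], rule B[rule_format])
  finally show ?thesis .
qed

lemma schwartz_decay_snd:
  fixes \<phi> :: "real^3 \<Rightarrow> complex"
  assumes "schwartz \<phi>"
  shows "\<exists>K. \<forall>u. norm (\<phi> (coords u)) \<le> K * (1 / (1 + (snd u)\<^sup>2))"
proof -
  obtain C where C: "C > 0" "\<And>u. norm (\<phi> (coords u)) \<le>
     C * (1 / (1 + (fst (fst u))\<^sup>2) * (1 / (1 + (snd (fst u))\<^sup>2)) * (1 / (1 + (snd u)\<^sup>2)))"
    using schwartz_decay[OF assms] by blast
  have "norm (\<phi> (coords u)) \<le> C * (1 / (1 + (snd u)\<^sup>2))" for u
  proof -
    have "norm (\<phi> (coords u)) \<le> C * (plane_weight (fst u) * (1 / (1 + (snd u)\<^sup>2)))" by (rule C(2))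
    also have "\<dots> \<le> C * (1 * (1 / (1 + (snd u)\<^sup>2)))"
      using C(1) by (intro mult_left_mono mult_right_mono plane_weight_le_1) auto
    finally show ?thesis by simp
  qed
  then show ?thesis by blast
qed

text \<open>For each plane the integral is given by \<open>plane_integral_powr\<close>; exchanging the integrals over \<open>a\<close> and over
frequencies leaves the transform of the cone function.\<close>

lemma fourier_cone:
  assumes s: "1 < s" "s < 3" and \<phi>: "schwartz \<phi>"
  shows "regular_distr (homog (- s) (cone_fun s h)) (fourier \<phi>) = regular_distr (homog (- 3 + s) (cone_hat s h)) \<phi>"
proof -
  define r where "r = (s - 1) / 2"
  have r: "0 < r" "r < 1" and sr: "s = 1 + 2 * r" using s by (auto simp: r_def field_simps)
  have r': "0 < 1 - r" "1 - r < 1" using r by auto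
  let ?f = "\<lambda>u. \<phi> (coords u)"
  note f = schwartz_integrable_coords[OF \<phi>]
  note fm[measurable] = schwartz_coords_measurable[OF \<phi>]
  note \<phi>m[measurable] = schwartz_measurable[OF \<phi>]
  obtain K where K: "\<forall>u. norm (?f u) \<le> K * (1 / (1 + (snd u)\<^sup>2))" using schwartz_decay_snd[OF \<phi>] by blast
  obtain B where "B > 0" and B': "\<forall>z w. norm (fourier \<phi> (coords (z, w))) \<le> B * plane_weight z"
    using fourier_decay_plane[OF \<phi>] by blast
  have B: "norm (fourier_split ?f z w) \<le> B * plane_weight z" for z w
    using B'[rule_format, of z w] unfolding fourier_coords[OF schwartz_measurable[OF \<phi>]] .
  obtain M where M': "\<forall>a. integrable lborel (\<lambda>u. of_real (norm (fst u + snd u *\<^sub>R a) powr (- 2 * (1 - r))) * ?f u) \<and>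
    (LBINT u. norm (of_real (norm (fst u + snd u *\<^sub>R a) powr (- 2 * (1 - r))) * ?f u)) \<le> M"
    using integrable_sheared_kernel[OF r' f K[rule_format]] by (rule exE)
  note M = M'[rule_format, THEN conjunct1] M'[rule_format, THEN conjunct2]
  define G where "G = Gamma r * pi powr (- r)"
  have G: "G > 0" unfolding G_def using Gamma_real_pos[OF r(1)] by simp
  define k where "k = (\<lambda>(a::plane) (u::plane\<times>real). norm (fst u + snd u *\<^sub>R a) powr (- 2 * (1 - r)))"
  have km: "(\<lambda>p::plane\<times>(plane\<times>real). fst (snd p) + snd (snd p) *\<^sub>R fst p) \<in> borel_measurable borel"
    by (intro borel_measurable_continuous_onI continuous_intros)
  have C: "riesz_const s = inv_gamma (1 - r) / G" unfolding riesz_const_def G_def r_def ..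
  have slice: "(LBINT z. of_real (norm z powr (- 2 * r)) * fourier_split ?f z (a \<bullet> z)) = of_real (riesz_const s) * (LBINT u. of_real (k a u) * ?f u)" for a
  proof -
    have div: "I = of_real (c / G) * J" if "of_real G * I = of_real c * J" for I J :: complex and c
      using that G by (simp add: field_simps)
    show ?thesis unfolding C k_def
      by (rule div, unfold G_def, rule plane_integral_powr[OF r f K[rule_format] B])
  qed
  let ?F = "\<lambda>a u. of_real (h ((norm a)\<^sup>2)) * (of_real (k a u) * ?f u)"
  have mF: "(\<lambda>(a, u). ?F a u) \<in> borel_measurable borel"
  proof -
    have [measurable]: "(\<lambda>p. k (fst p) (snd p)) \<in> borel_measurable borel"
      using measurable_compose[OF km, of "\<lambda>z. norm z powr (- 2 * (1 - r))" borel] unfolding k_def by simp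
    have [measurable]: "(\<lambda>p::plane\<times>(plane\<times>real). ?f (snd p)) \<in> borel_measurable borel"
      by (rule measurable_compose[OF borel_measurable_snd fm])
    show ?thesis unfolding split_beta' by measurable
  qed
  have i: "integrable lborel (\<lambda>(a, u). ?F a u)"
  proof (rule lborel_integrable_iterated_fst[OF mF integrable_mult_left[OF integrable_norm[OF h_integrable], of M]])
    let ?g = "\<lambda>a u. norm (h ((norm a)\<^sup>2)) * norm (of_real (k a u) * ?f u)"
    have "integrable lborel (?g a)" for a unfolding k_def by (intro integrable_mult_right integrable_norm M)
    moreover have "(LBINT u. ?g a u) \<le> norm (h ((norm a)\<^sup>2)) * M" for a
      unfolding k_def integral_mult_right_zero by (intro mult_left_mono M) simp
    ultimately show "AE a in lborel. integrable lborel (?g a) \<and> (LBINT u. ?g a u) \<le> norm (h ((norm a)\<^sup>2)) * M \<and>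
        (\<forall>u. norm (case (a, u) of (a, u) \<Rightarrow> ?F a u) \<le> ?g a u)"
      by (simp add: norm_mult)
  qed
  have "regular_distr (homog (- s) (cone_fun s h)) (fourier \<phi>) = 
     (LBINT a. of_real (h ((norm a)\<^sup>2)) * (LBINT z. of_real (norm z powr (- 2 * r)) * fourier_split ?f z (a \<bullet> z)))"
    unfolding sr by (rule fourier_cone_slices[OF \<phi>]) (use r in auto)
  also have "\<dots> = (LBINT a. of_real (riesz_const s) * (LBINT u. ?F a u))"
    unfolding slice by (intro Bochner_Integration.integral_cong refl) (subst integral_mult_right_zero, rule mult.left_commute)
  also have "\<dots> = of_real (riesz_const s) * (LBINT a. LBINT u. ?F a u)" by (rule integral_mult_right_zero)
  also have "(LBINT a. LBINT u. ?F a u) = (LBINT u. LBINT a. ?F a u)" by (rule lborel_fubini_swap[OF i])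
  also have "of_real (riesz_const s) * \<dots> = (LBINT u. of_real (riesz_const s) * (LBINT a. ?F a u))"
    by (rule integral_mult_right_zero[symmetric])
  also have "\<dots> = (LBINT u. of_real (cone_hat s h (coords u)) * ?f u)"
  proof (rule Bochner_Integration.integral_cong[OF refl])
    fix u
    have "(LBINT a. ?F a u) = (LBINT a. of_real (h ((norm a)\<^sup>2) * k a u) * ?f u)" by (simp add: mult_ac)
    also have "\<dots> = (LBINT a. of_real (h ((norm a)\<^sup>2) * k a u)) * ?f u" by (rule integral_mult_left_zero)
    also have "\<dots> = of_real (LBINT a. h ((norm a)\<^sup>2) * k a u) * ?f u" unfolding integral_complex_of_real ..
    finally have "(LBINT a. ?F a u) = of_real (LBINT a. h ((norm a)\<^sup>2) * k a u) * ?f u" .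
    moreover have "s - 3 = - 2 * (1 - r)" unfolding sr by simp
    ultimately show "of_real (riesz_const s) * (LBINT a. ?F a u) = of_real (cone_hat s h (coords u)) * ?f u"
      unfolding cone_hat_def k_def by simp
  qed
  also have "\<dots> = (LBINT x. of_real (cone_hat s h x) * \<phi> x)"
  proof (rule lborel_integral_coords[symmetric])
    have "cone_hat s h \<in> borel_measurable borel"
    proof -
      have [measurable]: "(\<lambda>p::(real^3)\<times>plane. horiz (fst p) + fst p $ 3 *\<^sub>R snd p) \<in> borel_measurable (borel \<Otimes>\<^sub>M borel)"
        unfolding borel_prod by (intro borel_measurable_continuous_onI continuous_intros)
      show ?thesis unfolding cone_hat_def[abs_def]
        by (intro borel_measurable_times borel_measurable_const lborel.borel_measurable_lebesgue_integral) (simp add: split_beta')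
    qed
    then show "(\<lambda>x. of_real (cone_hat s h x) * \<phi> x) \<in> borel_measurable borel" by measurable
  qed
  also have "\<dots> = regular_distr (homog (- 3 + s) (cone_hat s h)) \<phi>"
  proof -
    have "homog (- 3 + s) (cone_hat s h) x = of_real (cone_hat s h x)" for x
      by (rule homog_homogeneous) (simp_all add: cone_hat_scaleR, simp add: cone_hat_def horiz_def zero_prod_def)
    then show ?thesis unfolding regular_distr_def by simp
  qed
  finally show ?thesis .
qed

text \<open>For each plane the integral is a line integral, by \<open>plane_integral_eq_line_integral\<close>. The lines
\<open>(- \<tau> a, \<tau>)\<close> sweep out space, and the substitution \<open>y = - \<tau> a\<close> with its Jacobian \<open>\<tau>\<^sup>2\<close> turns the
superposition into a function.\<close>

lemma fourier_cone_1:
  assumes \<phi>: "schwartz \<phi>"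
  shows "regular_distr (homog (- 1) (cone_fun 1 h)) (fourier \<phi>) = regular_distr (homog (- 3 + 1) (cone_hat1 h)) \<phi>"
proof -
  let ?f = "\<lambda>u. \<phi> (coords u)"
  note f = schwartz_integrable_coords[OF \<phi>]
  note fm[measurable] = schwartz_coords_measurable[OF \<phi>]
  note \<phi>m[measurable] = schwartz_measurable[OF \<phi>]
  obtain K where K: "\<forall>u. norm (?f u) \<le> K * (1 / (1 + (snd u)\<^sup>2))" using schwartz_decay_snd[OF \<phi>] by blast
  obtain B where "B > 0" and B': "\<forall>z w. norm (fourier \<phi> (coords (z, w))) \<le> B * plane_weight z"
    using fourier_decay_plane[OF \<phi>] by blast
  have B: "norm (fourier_split ?f z w) \<le> B * plane_weight z" for z w
    using B'[rule_format, of z w] unfolding fourier_coords[OF \<phi>m] .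
  have cf: "continuous_on UNIV ?f"
    by (intro continuous_on_compose2[OF schwartz_continuous[OF \<phi>, of UNIV]] linear_continuous_on
        linear_conv_bounded_linear[THEN iffD1] linear_coords) auto
  have slice: "(LBINT z. of_real (norm z powr (- 2 * 0)) * fourier_split ?f z (a \<bullet> z)) = (LBINT \<tau>. ?f (- \<tau> *\<^sub>R a, \<tau>))" for a
  proof -
    have "(LBINT z. of_real (norm z powr (- 2 * 0)) * fourier_split ?f z (a \<bullet> z)) = (LBINT z. fourier_split ?f z (a \<bullet> z))"
    proof (rule integral_cong_AE)
      show "AE z in lborel. of_real (norm z powr (- 2 * 0)) * fourier_split ?f z (a \<bullet> z) = fourier_split ?f z (a \<bullet> z)"
        using AE_plane_neq by eventually_elim auto
    qed (use measurable_fourier_split_slice[OF fm, of a] in auto)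
    also have "\<dots> = (LBINT \<tau>. ?f (- \<tau> *\<^sub>R a, \<tau>))"
      by (rule plane_integral_eq_line_integral[OF f K[rule_format] cf B])
    finally show ?thesis .
  qed
  define F where "F = (\<lambda>a \<tau>. of_real (h ((norm a)\<^sup>2)) * ?f (- \<tau> *\<^sub>R a, \<tau>))"
  have Fb: "norm (F a \<tau>) \<le> norm (h ((norm a)\<^sup>2)) * (K * (1 / (1 + \<tau>\<^sup>2)))" for a \<tau>
    unfolding F_def using K[rule_format, of "(- \<tau> *\<^sub>R a, \<tau>)"] by (simp only: norm_mult norm_of_real snd_conv real_norm_def mult_left_mono abs_ge_zero)
  have i: "integrable lborel (\<lambda>(a, \<tau>). F a \<tau>)"
  proof (rule integrable_dominated[OF lborel_integrable_product[OF integrable_norm[OF h_integrable]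
          integrable_mult_right[OF integrable_inverse_square, of K]]])
    have "(\<lambda>p. F (fst p) (snd p)) \<in> borel_measurable borel" unfolding F_def
      by (intro borel_measurable_continuous_onI continuous_intros continuous_on_compose2[OF cf]
          continuous_on_compose2[OF h_continuous]) auto
    then show "(\<lambda>(a, \<tau>). F a \<tau>) \<in> borel_measurable lborel" by (simp add: split_beta')
  qed (use Fb in \<open>simp add: split_beta'\<close>)
  let ?G = "\<lambda>u. of_real (cone_hat1 h (coords u)) * ?f u"
  have ch: "cone_hat1 h (coords u) = h ((norm (fst u))\<^sup>2 / (snd u)\<^sup>2) / (snd u)\<^sup>2" for u
    unfolding cone_hat1_def by simp
  have mG: "?G \<in> borel_measurable borel" unfolding ch by measurable
  have aff: "(LBINT a. \<Phi> (- \<tau> *\<^sub>R a)) = (1 / \<tau>\<^sup>2) *\<^sub>R (LBINT y. \<Phi> y)"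
    if "\<tau> \<noteq> 0" and "\<Phi> \<in> borel_measurable borel" for \<tau> :: real and \<Phi> :: "plane \<Rightarrow> 'c::{banach,second_countable_topology}"
    using lborel_integral_affine[of "- \<tau>" \<Phi> 0] that by (simp add: power2_eq_square)
  have inner: "(LBINT a. F a \<tau>) = (LBINT y. ?G (y, \<tau>))" if "\<tau> \<noteq> 0" for \<tau>
  proof -
    let ?\<Phi> = "\<lambda>y. of_real (h ((norm y)\<^sup>2 / \<tau>\<^sup>2)) * ?f (y, \<tau>)"
    have "(\<lambda>y. ?f (y, \<tau>)) \<in> borel_measurable borel"
      by (intro borel_measurable_continuous_onI continuous_on_compose2[OF cf] continuous_intros) auto
    then have m: "?\<Phi> \<in> borel_measurable borel" by measurable
    have "F a \<tau> = ?\<Phi> (- \<tau> *\<^sub>R a)" for a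
      unfolding F_def using that by (simp add: power_mult_distrib)
    then have "(LBINT a. F a \<tau>) = (1 / \<tau>\<^sup>2) *\<^sub>R (LBINT y. ?\<Phi> y)" using aff[OF that m] by simp
    also have "\<dots> = (LBINT y. (1 / \<tau>\<^sup>2) *\<^sub>R ?\<Phi> y)" by (rule integral_scaleR_right[symmetric])
    also have "\<dots> = (LBINT y. ?G (y, \<tau>))" unfolding ch by (simp add: scaleR_conv_of_real)
    finally show ?thesis .
  qed
  have AE0: "AE \<tau>::real in lborel. \<tau> \<noteq> 0" using AE_inner_neq[of "1::real" 0] by simp
  have G: "integrable lborel ?G"
  proof (rule lborel_integrable_iterated_snd[OF mG])
    let ?N = "LBINT a. norm (h ((norm (a::plane))\<^sup>2))"
    let ?b = "\<lambda>\<tau> y. (K * (1 / (1 + \<tau>\<^sup>2)) / \<tau>\<^sup>2) * norm (h ((norm (y::plane))\<^sup>2 / \<tau>\<^sup>2))"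
    show "integrable lborel (\<lambda>\<tau>. ?N * (K * (1 / (1 + \<tau>\<^sup>2))))"
      by (intro integrable_mult_right integrable_inverse_square)
    show "AE \<tau> in lborel. integrable lborel (?b \<tau>) \<and> (LBINT y. ?b \<tau> y) \<le> ?N * (K * (1 / (1 + \<tau>\<^sup>2))) \<and>
       (\<forall>y. norm (?G (y, \<tau>)) \<le> ?b \<tau> y)"
      using AE0
    proof eventually_elim
      case (elim \<tau>)
      let ?\<Phi> = "\<lambda>y::plane. norm (h ((norm y)\<^sup>2 / \<tau>\<^sup>2))"
      have m: "?\<Phi> \<in> borel_measurable borel" by measurable
      have sc: "?\<Phi> (- \<tau> *\<^sub>R a) = norm (h ((norm a)\<^sup>2))" for a using elim by (simp add: power_mult_distrib)
      have "integrable lborel ?\<Phi>"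
        using lborel_integrable_affine[of "- \<tau>" ?\<Phi> 0] m elim sc integrable_norm[OF h_integrable] by simp
      then have "integrable lborel (?b \<tau>)" by (rule integrable_mult_right)
      moreover have "(LBINT y. ?\<Phi> y) = \<tau>\<^sup>2 * ?N" using aff[OF elim m] sc elim by (simp add: field_simps)
      then have "(LBINT y. ?b \<tau> y) = ?N * (K * (1 / (1 + \<tau>\<^sup>2)))"
        unfolding integral_mult_right_zero using elim by simp
      moreover have "norm (?G (y, \<tau>)) \<le> ?b \<tau> y" for y
      proof -
        have "norm (?G (y, \<tau>)) = ?\<Phi> y / \<tau>\<^sup>2 * norm (?f (y, \<tau>))" unfolding ch by (simp add: norm_mult norm_divide norm_power)
        also have "\<dots> \<le> ?\<Phi> y / \<tau>\<^sup>2 * (K * (1 / (1 + \<tau>\<^sup>2)))"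
          using K[rule_format, of "(y, \<tau>)"] by (intro mult_left_mono) auto
        finally show ?thesis by (simp add: mult_ac)
      qed
      ultimately show ?case by simp
    qed
  qed
  have "regular_distr (homog (- (1 + 2 * 0)) (cone_fun (1 + 2 * 0) h)) (fourier \<phi>) = 
     (LBINT a. of_real (h ((norm a)\<^sup>2)) * (LBINT z. of_real (norm z powr (- 2 * 0)) * fourier_split ?f z (a \<bullet> z)))"
    by (rule fourier_cone_slices[OF \<phi>]) auto
  also have "\<dots> = (LBINT a. LBINT \<tau>. F a \<tau>)"
    unfolding slice F_def integral_mult_right_zero ..
  also have "\<dots> = (LBINT \<tau>. LBINT a. F a \<tau>)" by (rule lborel_fubini_swap[OF i])
  also have "\<dots> = (LBINT \<tau>. LBINT y. ?G (y, \<tau>))"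
  proof (rule integral_cong_AE)
    show "AE \<tau> in lborel. (LBINT a. F a \<tau>) = (LBINT y. ?G (y, \<tau>))"
      using AE0 by eventually_elim (rule inner)
    show "(\<lambda>\<tau>. LBINT a. F a \<tau>) \<in> borel_measurable lborel"
      using lborel_fubini_integrable_fst[of "\<lambda>(\<tau>, a). F a \<tau>"] i lborel_integrable_swap[of "\<lambda>(a, \<tau>). F a \<tau>"]
      by (auto intro: borel_measurable_integrable)
    show "(\<lambda>\<tau>. LBINT y. ?G (y, \<tau>)) \<in> borel_measurable lborel"
      using lborel_fubini_integrable_fst[of "\<lambda>(\<tau>, y). ?G (y, \<tau>)"] G lborel_integrable_swap[of ?G]
      by (auto intro: borel_measurable_integrable)
  qed
  also have "\<dots> = (LBINT u. ?G u)" by (rule lborel_fubini_snd[OF G])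
  also have "\<dots> = (LBINT x. of_real (cone_hat1 h x) * \<phi> x)"
    by (rule lborel_integral_coords[symmetric]) (unfold cone_hat1_def, measurable)
  also have "\<dots> = regular_distr (homog (- 3 + 1) (cone_hat1 h)) \<phi>"
  proof -
    have "homog (- 3 + 1) (cone_hat1 h) x = of_real (cone_hat1 h x)" for x
      by (rule homog_homogeneous) (simp_all only: cone_hat1_scaleR, simp add: cone_hat1_def)
    then show ?thesis unfolding regular_distr_def by simp
  qed
  finally show ?thesis by simp
qed

end

section \<open>Smoothness and admissibility of the cone functions\<close>

lemma ndiff_square:
  fixes f :: "'a::euclidean_space \<Rightarrow> real"
  shows "open U \<Longrightarrow> ndiff U n f \<Longrightarrow> ndiff U n (\<lambda>x. (f x)\<^sup>2)"
  unfolding power2_eq_square by (rule ndiff_mult)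

lemma ndiff_compose_powr:
  fixes f :: "'a::euclidean_space \<Rightarrow> real"
  assumes "open U" "ndiff U n f" "\<And>x. x \<in> U \<Longrightarrow> 0 < f x"
  shows "ndiff U n (\<lambda>x. f x powr p)"
  using ndiff_compose[OF assms(1), of f "{0<..}" n "\<lambda>t. t powr p"] ndiff_powr assms by auto

lemmas ndiff_intros = ndiff_const ndiff_add ndiff_mult ndiff_square ndiff_compose_powr ndiff_linear

lemma powr_minus_one: "0 \<le> (x::real) \<Longrightarrow> x powr (-1) = 1 / x"
  by (cases "x = 0") (auto simp: powr_minus divide_inverse)

lemma smooth_on_S2I:
  assumes "\<And>n. ndiff (- {0}) n F"
  shows "smooth_on_S2 F"
  unfolding smooth_on_S2_def
  by (intro exI[of _ "- {0}"] exI[of _ F] conjI smooth_on_ndiff assms) auto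

context radial_profile
begin

lemma ndiff_h: "open U \<Longrightarrow> ndiff U n f \<Longrightarrow> ndiff U n (\<lambda>x. h (f x))"
  using ndiff_compose[of U f UNIV n h] h_smooth by auto

text \<open>Near the axis the function vanishes identically. Elsewhere \<open>|x'|\<^sup>2\<close> is positive and the line integral is
differentiated under the integral sign.\<close>

lemma ndiff_cone_fun: "ndiff (- {0}) n (cone_fun s h)"
proof (rule ndiff_local)
  fix x :: "real^3" assume x: "x \<in> - {0}"
  show "\<exists>V g. open V \<and> x \<in> V \<and> ndiff V n g \<and> (\<forall>y\<in>V. g y = cone_fun s h y)"
  proof (cases "horiz x = 0")
    case True
    let ?V = "{y::real^3. T\<^sup>2 * ((y$1)\<^sup>2 + (y$2)\<^sup>2) < (y$3)\<^sup>2}"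
    have V: "open ?V" by (intro open_Collect_less continuous_intros)
    have "x $ 3 \<noteq> 0" using x True horiz_eq_0 by blast
    moreover have "x $ 1 = 0" "x $ 2 = 0" using True by (auto simp: horiz_def zero_prod_def)
    ultimately have "x \<in> ?V" by simp
    moreover have "cone_fun s h y = 0" if "y \<in> ?V" for y
    proof (cases "horiz y = 0")
      case False
      then have "T\<^sup>2 \<le> (y $ 3 / norm (horiz y))\<^sup>2"
        using that by (simp add: power_divide norm_horiz[symmetric] field_simps)
      then show ?thesis unfolding cone_fun_def by (simp add: radon_eq_0)
    qed (rule cone_fun_0)
    ultimately show ?thesis using V by (intro exI[of _ ?V] exI[of _ "\<lambda>_. 0"]) (auto intro: ndiff_const)
  next
    case False
    let ?V = "{y::real^3. 0 < (y$1)\<^sup>2 + (y$2)\<^sup>2}"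
    let ?\<Phi> = "\<lambda>p::(real^3)\<times>real. h ((fst p$3)\<^sup>2 * ((fst p$1)\<^sup>2 + (fst p$2)\<^sup>2) powr (-1) + (snd p)\<^sup>2) * ((fst p$1)\<^sup>2 + (fst p$2)\<^sup>2) powr (- s / 2)"
    have V: "open ?V" by (intro open_Collect_less continuous_intros)
    have op: "open (?V \<times> (UNIV::real set))" using V by (intro open_Times) auto
    have xV: "x \<in> ?V" using False unfolding norm_horiz[symmetric] by simp
    have bl: "bounded_linear (\<lambda>p::(real^3)\<times>real. fst p $ i)" for i
      using bounded_linear_compose[OF bounded_linear_vec_nth bounded_linear_fst] .
    have "ndiff (?V \<times> UNIV) (Suc n) ?\<Phi>"
      by (intro ndiff_intros ndiff_h op bl bounded_linear_snd) auto
    then have "ndiff ?V n (\<lambda>y. LBINT q. ?\<Phi> (y, q) * 1)"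
    proof (rule ndiff_parametric_integral[OF V, where L="cball 0 T", rotated 2])
      show "integrable lborel (\<lambda>b::real. indicator (cball 0 T) b *\<^sub>R (1::real))"
        unfolding real_scaleR_def mult_1_right
        by (rule integrable_real_indicator) (simp_all add: emeasure_lborel_cball_finite flip: infinity_ennreal_def)
      fix y :: "real^3" and q :: real assume "q \<notin> cball 0 T"
      then have "T\<^sup>2 \<le> \<bar>q\<bar>\<^sup>2" using T_pos by (intro power_mono) auto
      then have "T\<^sup>2 \<le> (y$3)\<^sup>2 * ((y$1)\<^sup>2 + (y$2)\<^sup>2) powr (-1) + q\<^sup>2" by (simp add: add_increasing)
      then show "?\<Phi> (y, q) = 0" by (simp add: h_support)
    qed simp
    moreover have "(LBINT q. ?\<Phi> (y, q) * 1) = cone_fun s h y" for y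
    proof -
      have "(LBINT q. ?\<Phi> (y, q) * 1) = (LBINT q. h ((y$3 / norm (horiz y))\<^sup>2 + q\<^sup>2) * norm (horiz y) powr (- s))"
        by (simp add: norm_horiz[symmetric] powr_minus_one power_divide powr_norm_square)
      also have "\<dots> = radon h (y$3 / norm (horiz y)) * norm (horiz y) powr (- s)"
        unfolding radon_def by (rule integral_mult_left_zero)
      finally show ?thesis unfolding cone_fun_def by (simp only: mult.commute)
    qed
    ultimately show ?thesis using V xV by (intro exI[of _ ?V] exI[of _ "\<lambda>y. LBINT q. ?\<Phi> (y, q) * 1"]) auto
  qed
qed auto

lemma ndiff_cone_hat1: "ndiff (- {0}) n (cone_hat1 h)"
proof (rule ndiff_local)
  fix x :: "real^3" assume x: "x \<in> - {0}"
  show "\<exists>V g. open V \<and> x \<in> V \<and> ndiff V n g \<and> (\<forall>y\<in>V. g y = cone_hat1 h y)"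
  proof (cases "x $ 3 = 0")
    case True
    let ?V = "{y::real^3. T\<^sup>2 * (y$3)\<^sup>2 < (y$1)\<^sup>2 + (y$2)\<^sup>2}"
    have V: "open ?V" by (intro open_Collect_less continuous_intros)
    have "horiz x \<noteq> 0" using x True horiz_eq_0 by blast
    then have "x \<in> ?V" using True unfolding mem_Collect_eq norm_horiz[symmetric] by simp
    moreover have "cone_hat1 h y = 0" if "y \<in> ?V" for y
    proof (cases "y $ 3 = 0")
      case False
      then have "T\<^sup>2 \<le> (norm (horiz y))\<^sup>2 / (y $ 3)\<^sup>2"
        using that by (simp add: norm_horiz field_simps)
      then show ?thesis unfolding cone_hat1_def by (simp add: h_support)
    qed (simp add: cone_hat1_def)
    ultimately show ?thesis using V by (intro exI[of _ ?V] exI[of _ "\<lambda>_. 0"]) (auto intro: ndiff_const)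
  next
    case False
    let ?V = "{y::real^3. 0 < (y$3)\<^sup>2}"
    let ?g = "\<lambda>y::real^3. h (((y$1)\<^sup>2 + (y$2)\<^sup>2) * ((y$3)\<^sup>2) powr (-1)) * ((y$3)\<^sup>2) powr (-1)"
    have V: "open ?V" by (intro open_Collect_less continuous_intros)
    have "ndiff ?V n ?g"
      by (intro ndiff_intros ndiff_h V bounded_linear_vec_nth) auto
    moreover have "?g y = cone_hat1 h y" for y
      unfolding cone_hat1_def norm_horiz by (simp add: powr_minus_one)
    ultimately show ?thesis using V False by (intro exI[of _ ?V] exI[of _ ?g]) auto
  qed
qed auto

text \<open>Near the plane \<open>\<xi>\<^sub>3 = 0\<close> the kernel has no singularity on the support of \<open>h\<close>. Off that plane the substitution
\<open>b = \<xi>' + \<xi>\<^sub>3 a\<close> moves \<open>\<xi>\<close> into the smooth factor and leaves the fixed singular weight \<open>|b| powr (s - 3)\<close>.\<close>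

lemma ndiff_cone_hat:
  assumes s: "1 < s" "s < 3"
  shows "ndiff (- {0}) n (cone_hat s h)"
proof (rule ndiff_local)
  let ?q = "\<lambda>p::(real^3)\<times>plane. (fst p$1 + fst p$3 * fst (snd p))\<^sup>2 + (fst p$2 + fst p$3 * snd (snd p))\<^sup>2"
  have bl: "bounded_linear (\<lambda>p::(real^3)\<times>plane. fst p $ i)"
    "bounded_linear (\<lambda>p::(real^3)\<times>plane. fst (snd p))"
    "bounded_linear (\<lambda>p::(real^3)\<times>plane. snd (snd p))" for i
    using bounded_linear_compose[OF bounded_linear_vec_nth bounded_linear_fst]
      bounded_linear_compose[OF bounded_linear_fst bounded_linear_snd]
      bounded_linear_compose[OF bounded_linear_snd bounded_linear_snd] by auto
  fix x :: "real^3" assume x: "x \<in> - {0}"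
  show "\<exists>V g. open V \<and> x \<in> V \<and> ndiff V n g \<and> (\<forall>y\<in>V. g y = cone_hat s h y)"
  proof (cases "x $ 3 = 0")
    case True
    let ?V = "{y::real^3. T\<^sup>2 * (y$3)\<^sup>2 < (y$1)\<^sup>2 + (y$2)\<^sup>2}"
    let ?\<Phi> = "\<lambda>p::(real^3)\<times>plane. h ((fst (snd p))\<^sup>2 + (snd (snd p))\<^sup>2) * ?q p powr ((s - 3) / 2)"
    have V: "open ?V" by (intro open_Collect_less continuous_intros)
    have op: "open (?V \<times> (UNIV::plane set))" using V by (intro open_Times) auto
    have "horiz x \<noteq> 0" using x True horiz_eq_0 by blast
    then have xV: "x \<in> ?V" using True unfolding mem_Collect_eq norm_horiz[symmetric] by simp
    have q: "?q (y, a) = (norm (horiz y + y$3 *\<^sub>R a))\<^sup>2" for y a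
      unfolding norm_plane by (simp add: horiz_def)
    have zero: "?\<Phi> (y, a) = 0" if "a \<notin> cball 0 T" for y a
    proof -
      have "T\<^sup>2 \<le> (norm a)\<^sup>2" using T_pos that by (intro power_mono) auto
      then show ?thesis by (simp add: norm_plane h_support)
    qed
    have "ndiff (?V \<times> UNIV) (Suc n) ?\<Phi>"
    proof (rule ndiff_local[OF op])
      fix p assume p: "p \<in> ?V \<times> (UNIV::plane set)"
      obtain y a where ya: "p = (y, a)" by (cases p)
      show "\<exists>W g. open W \<and> p \<in> W \<and> ndiff W (Suc n) g \<and> (\<forall>y\<in>W. g y = ?\<Phi> y)"
      proof (cases "a \<in> cball 0 T")
        case False
        let ?W = "(UNIV :: (real^3) set) \<times> (- cball 0 T :: plane set)"
        have "open ?W" by (intro open_Times) auto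
        moreover have "\<forall>y\<in>?W. 0 = ?\<Phi> y" using zero by (auto simp del: mem_cball)
        ultimately show ?thesis using False ya
          by (intro exI[of _ ?W] exI[of _ "\<lambda>_. 0"]) (auto intro!: ndiff_const)
      next
        case True
        let ?W = "{p. 0 < ?q p}"
        have W: "open ?W" by (intro open_Collect_less continuous_intros)
        have "norm (y$3 *\<^sub>R a) < norm (horiz y)"
        proof -
          have "(norm (y$3 *\<^sub>R a))\<^sup>2 \<le> (y$3)\<^sup>2 * T\<^sup>2"
            using True by (auto simp: power_mult_distrib intro!: mult_left_mono power_mono)
          also have "\<dots> < (norm (horiz y))\<^sup>2" using p ya by (simp add: norm_horiz mult.commute)
          finally show ?thesis by (rule power2_less_imp_less) simp
        qed
        then have "horiz y + y$3 *\<^sub>R a \<noteq> 0" by (metis add_eq_0_iff less_irrefl norm_minus_cancel)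
        then have "p \<in> ?W" unfolding ya mem_Collect_eq q by simp
        moreover have "ndiff ?W (Suc n) ?\<Phi>" by (intro ndiff_intros ndiff_h W bl) auto
        ultimately show ?thesis using W by blast
      qed
    qed
    then have "ndiff ?V n (\<lambda>y. LBINT a. ?\<Phi> (y, a) * 1)"
    proof (rule ndiff_parametric_integral[OF V, where L="cball 0 T", rotated 2])
      show "integrable lborel (\<lambda>b::plane. indicator (cball 0 T) b *\<^sub>R (1::real))"
        unfolding real_scaleR_def mult_1_right
        by (rule integrable_real_indicator) (simp_all add: emeasure_lborel_cball_finite flip: infinity_ennreal_def)
    qed (use zero in auto)
    then have "ndiff ?V n (\<lambda>y. riesz_const s * (LBINT a. ?\<Phi> (y, a) * 1))"
      by (intro ndiff_mult ndiff_const V)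
    moreover have "riesz_const s * (LBINT a. ?\<Phi> (y, a) * 1) = cone_hat s h y" for y
    proof -
      have 2: "2 * ((s - 3) / 2) = s - 3" by simp
      show ?thesis unfolding cone_hat_def q powr_norm_square 2 by (simp add: norm_plane[symmetric])
    qed
    ultimately show ?thesis using V xV
      by (intro exI[of _ ?V] exI[of _ "\<lambda>y. riesz_const s * (LBINT a. ?\<Phi> (y, a) * 1)"]) auto
  next
    case False
    \<comment> \<open>a bound on the frequency keeps the support in b inside one compact disc\<close>
    define R where "R = norm x + 1"
    let ?V = "{y::real^3. 0 < (y$3)\<^sup>2} \<inter> ball 0 R"
    define w where "w = (\<lambda>b::plane. norm b powr (s - 3))"
    let ?\<Phi> = "\<lambda>p::(real^3)\<times>plane. h (((fst (snd p) + (-1) * fst p$1)\<^sup>2 + (snd (snd p) + (-1) * fst p$2)\<^sup>2) * ((fst p$3)\<^sup>2) powr (-1)) * ((fst p$3)\<^sup>2) powr (-1)"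
    have V: "open ?V" by (intro open_Int open_Collect_less continuous_intros) auto
    have op: "open (?V \<times> (UNIV::plane set))" using V by (intro open_Times) auto
    have xV: "x \<in> ?V" using False unfolding R_def by simp
    have \<Phi>: "?\<Phi> (y, b) = h ((norm (b - horiz y))\<^sup>2 / (y$3)\<^sup>2) / (y$3)\<^sup>2" for y b
      unfolding norm_plane by (simp add: horiz_def powr_minus_one)
    have "ndiff (?V \<times> UNIV) (Suc n) ?\<Phi>"
      by (intro ndiff_intros ndiff_h op bl) auto
    then have "ndiff ?V n (\<lambda>y. LBINT b. ?\<Phi> (y, b) * w b)"
    proof (rule ndiff_parametric_integral[OF V, where L="cball 0 ((1 + T) * R)", rotated 2])
      let ?L = "cball 0 ((1 + T) * R) :: plane set"
      let ?k = "\<lambda>z::plane. norm z powr (- (3 - s)) * exp (- pi * 1 * (norm z)\<^sup>2)"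
      have "- 2 * ((3 - s) / 2) = - (3 - s)" "0 < (3 - s) / 2" "(3 - s) / 2 < 1" "(0::real) < 1"
        using s by (auto simp: field_simps)
      then have k: "integrable lborel ?k" using integrable_powr_gauss2[of "(3 - s) / 2" 1] s by (simp only:)
      have L: "integrable lborel (indicator ?L :: _ \<Rightarrow> real)"
        by (rule integrable_real_indicator) (simp_all add: emeasure_lborel_cball_finite flip: infinity_ennreal_def)
      show "integrable lborel (\<lambda>b. indicator ?L b *\<^sub>R w b)"
      proof (rule Bochner_Integration.integrable_bound[OF Bochner_Integration.integrable_add[OF integrable_mult_right[OF k, of "exp pi"] L]])
        show "AE b in lborel. norm (indicator ?L b *\<^sub>R w b) \<le> norm (exp pi * ?k b + indicator ?L b)"
        proof (rule AE_I2)
          fix b :: "plane"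
          show "norm (indicator ?L b *\<^sub>R w b) \<le> norm (exp pi * ?k b + indicator ?L b)"
            using powr_le_gauss[of "3 - s" b] s unfolding w_def by (simp add: indicator_def)
        qed
        show "(\<lambda>b. indicator ?L b *\<^sub>R w b) \<in> borel_measurable lborel"
        proof -
          have "w \<in> borel_measurable borel" unfolding w_def by measurable
          then show ?thesis by (intro borel_measurable_scaleR borel_measurable_indicator) (auto simp: borel_closed)
        qed
      qed
      fix y :: "real^3" and b :: "plane" assume y: "y \<in> ?V" and b: "b \<notin> ?L"
      have "norm (horiz y) \<le> norm y" "\<bar>y$3\<bar> \<le> norm y"
      proof -
        have "(norm y)\<^sup>2 = (norm (horiz y))\<^sup>2 + (y$3)\<^sup>2" unfolding norm_horiz by (simp add: norm_vec_def L2_set_def sum_3)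
        then have "(norm (horiz y))\<^sup>2 \<le> (norm y)\<^sup>2" by simp
        then show "norm (horiz y) \<le> norm y" by (rule power2_le_imp_le) simp
      qed (rule component_le_norm_cart)
      moreover have "norm y < R" using y by simp
      moreover have "(1 + T) * R < norm b" using b by simp
      moreover have "norm b - norm (horiz y) \<le> norm (b - horiz y)" by (rule norm_triangle_ineq2)
      moreover have "T * \<bar>y$3\<bar> \<le> T * R" using calculation(2,3) T_pos by (intro mult_left_mono) auto
      ultimately have "T * \<bar>y$3\<bar> \<le> norm (b - horiz y)" by (simp add: algebra_simps)
      then have "(T * \<bar>y$3\<bar>)\<^sup>2 \<le> (norm (b - horiz y))\<^sup>2" using T_pos by (intro power_mono) auto
      then have "T\<^sup>2 \<le> (norm (b - horiz y))\<^sup>2 / (y$3)\<^sup>2" using y by (simp add: power_mult_distrib field_simps)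
      then show "?\<Phi> (y, b) = 0" unfolding \<Phi> by (simp add: h_support)
    qed simp
    then have "ndiff ?V n (\<lambda>y. riesz_const s * (LBINT b. ?\<Phi> (y, b) * w b))"
      by (intro ndiff_mult ndiff_const V)
    moreover have "riesz_const s * (LBINT b. ?\<Phi> (y, b) * w b) = cone_hat s h y" if "y \<in> ?V" for y
    proof -
      have y3: "y$3 \<noteq> 0" using that by simp
      let ?F = "\<lambda>a::plane. h ((norm a)\<^sup>2) * norm (horiz y + y$3 *\<^sub>R a) powr (s - 3)"
      have [measurable]: "(\<lambda>a::plane. horiz y + y$3 *\<^sub>R a) \<in> borel_measurable borel"
        by (intro borel_measurable_continuous_onI continuous_intros)
      have "(LBINT a. ?F a) = \<bar>1 / y$3\<bar>^DIM(plane) *\<^sub>R (LBINT b. ?F ((- 1 / y$3) *\<^sub>R horiz y + (1 / y$3) *\<^sub>R b))"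
        by (rule lborel_integral_affine) (use y3 in \<open>simp, measurable\<close>)
      also have "\<dots> = (1 / (y$3)\<^sup>2) *\<^sub>R (LBINT b. h ((norm (b - horiz y))\<^sup>2 / (y$3)\<^sup>2) * w b)"
      proof -
        have "(- 1 / y$3) *\<^sub>R horiz y + (1 / y$3) *\<^sub>R b = (1 / y$3) *\<^sub>R (b - horiz y)" for b
          by (simp add: scaleR_diff_right)
        then have "?F ((- 1 / y$3) *\<^sub>R horiz y + (1 / y$3) *\<^sub>R b) = h ((norm (b - horiz y))\<^sup>2 / (y$3)\<^sup>2) * w b" for b
          using y3 unfolding w_def by (simp add: power_divide)
        moreover have "\<bar>1 / y$3\<bar>^DIM(plane) = 1 / (y$3)\<^sup>2" by (simp add: power2_eq_square)
        ultimately show ?thesis by (simp only:)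
      qed
      also have "\<dots> = (LBINT b. ?\<Phi> (y, b) * w b)"
        unfolding \<Phi> by (simp add: field_simps flip: integral_mult_right_zero)
      finally show ?thesis unfolding cone_hat_def by simp
    qed
    ultimately show ?thesis using V xV
      by (intro exI[of _ ?V] exI[of _ "\<lambda>y. riesz_const s * (LBINT b. ?\<Phi> (y, b) * w b)"]) auto
  qed
qed auto

lemma angle_fourier_cone:
  assumes "1 < s" "s < 3"
  shows "angle_fourier s (cone_fun s h) (cone_hat s h)"
  unfolding angle_fourier_def fourier_distr_def
  using fourier_cone[OF assms] smooth_on_S2I[OF ndiff_cone_hat[OF assms]] by blast

lemma angle_fourier_cone_1: "angle_fourier 1 (cone_fun 1 h) (cone_hat1 h)"
  unfolding angle_fourier_def fourier_distr_def
  using fourier_cone_1 smooth_on_S2I[OF ndiff_cone_hat1] by blast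

lemma admissible_cone_fun:
  assumes "\<And>p. 0 \<le> radon h p"
  shows "admissible (cone_fun s h)"
  unfolding admissible_def
proof (intro conjI ballI)
  show "smooth_on_S2 (cone_fun s h)" by (rule smooth_on_S2I[OF ndiff_cone_fun])
  show "0 \<le> cone_fun s h x" for x unfolding cone_fun_def using assms by simp
  have "axis 3 1 \<in> S2" by simp
  moreover have "cone_fun s h (axis 3 1) = 0" by (rule cone_fun_0) (simp add: horiz_def axis_def zero_prod_def)
  ultimately show "\<exists>x\<in>S2. cone_fun s h x = 0" by blast
  show "cone_fun s h (- x) = cone_fun s h x" for x
  proof -
    have "horiz (- x) = - horiz x" by (simp add: horiz_def)
    then show ?thesis unfolding cone_fun_def radon_def by simp
  qed
  show "axisymmetric (cone_fun s h)" unfolding axisymmetric_def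
  proof (intro allI ballI)
    fix \<alpha> and x :: "real^3"
    have "(norm (horiz (rot3 \<alpha> x)))\<^sup>2 = ((cos \<alpha>)\<^sup>2 + (sin \<alpha>)\<^sup>2) * ((x$1)\<^sup>2 + (x$2)\<^sup>2)"
      unfolding norm_horiz rot3_def vector_3 by algebra
    then have "(norm (horiz (rot3 \<alpha> x)))\<^sup>2 = (norm (horiz x))\<^sup>2" unfolding norm_horiz by simp
    then have "norm (horiz (rot3 \<alpha> x)) = norm (horiz x)" by simp
    moreover have "rot3 \<alpha> x $ 3 = x $ 3" by (simp add: rot3_def)
    ultimately show "cone_fun s h (rot3 \<alpha> x) = cone_fun s h x" unfolding cone_fun_def by simp
  qed
qed

text \<open>At polar angle \<open>\<theta>\<close> the argument of the line integral is \<open>cos \<theta> / sin \<theta>\<close>, and this is at least \<open>tan \<theta>\<^sub>0\<close>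
because \<open>cos (\<theta> + \<theta>\<^sub>0) \<ge> 0\<close>.\<close>

lemma vanishes_upto_cone_fun:
  assumes \<theta>: "0 < \<theta>\<^sub>0" "\<theta>\<^sub>0 < pi / 2" and T: "T = tan \<theta>\<^sub>0"
  shows "vanishes_upto (pi / 2 - \<theta>\<^sub>0) (cone_fun s h)"
  unfolding vanishes_upto_def
proof (intro ballI)
  fix \<theta> \<mu> :: real assume t: "\<theta> \<in> {0..pi / 2 - \<theta>\<^sub>0}"
  have s0: "0 \<le> sin \<theta>" using t \<theta> by (intro sin_ge_zero) auto
  have "(norm (horiz (sph \<theta> \<mu>)))\<^sup>2 = (sin \<theta>)\<^sup>2 * ((cos \<mu>)\<^sup>2 + (sin \<mu>)\<^sup>2)"
    by (simp only: norm_horiz sph_def vector_3 power_mult_distrib distrib_left)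
  then have n: "norm (horiz (sph \<theta> \<mu>)) = sin \<theta>" using s0 by simp
  show "cone_fun s h (sph \<theta> \<mu>) = 0"
  proof (cases "sin \<theta> = 0")
    case True then show ?thesis using n by (intro cone_fun_0) simp
  next
    case False
    with s0 have s1: "0 < sin \<theta>" by simp
    have c0: "0 < cos \<theta>\<^sub>0" using \<theta> by (intro cos_gt_zero_pi) auto
    have "0 \<le> cos (\<theta> + \<theta>\<^sub>0)" using t \<theta> by (intro cos_ge_zero) auto
    then have "sin \<theta> * sin \<theta>\<^sub>0 \<le> cos \<theta> * cos \<theta>\<^sub>0" by (simp add: cos_add)
    then have "T \<le> cos \<theta> / sin \<theta>" unfolding T tan_def using s1 c0 by (simp add: field_simps)
    then have "T\<^sup>2 \<le> (cos \<theta> / sin \<theta>)\<^sup>2" using T_pos by (intro power_mono) auto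
    moreover have "sph \<theta> \<mu> $ 3 = cos \<theta>" by (simp add: sph_def)
    ultimately show ?thesis unfolding cone_fun_def n by (simp add: radon_eq_0)
  qed
qed

end

section \<open>A smooth bump\<close>

lemma poly_exp_tendsto_0: "((\<lambda>y::real. poly p y * exp (- y)) \<longlongrightarrow> 0) at_top"
proof -
  have "((\<lambda>y::real. \<Sum>i\<le>degree p. coeff p i * (y ^ i / exp y)) \<longlongrightarrow> (\<Sum>i\<le>degree p. coeff p i * 0)) at_top"
    by (intro tendsto_intros tendsto_power_div_exp_0)
  then show ?thesis by (simp add: poly_altdef sum_distrib_right exp_minus divide_inverse mult.assoc)
qed

text \<open>The derivative has the same form, with the polynomial \<open>X\<^sup>2 * (p - p')\<close> in place of \<open>p\<close>; at \<open>0\<close> the difference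
quotient is again of this form and tends to \<open>0\<close>.\<close>

lemma ndiff_flat: "ndiff UNIV n (\<lambda>t::real. if 0 < t then poly p (1 / t) * exp (- (1 / t)) else 0)"
proof (induction n arbitrary: p)
  have D: "((\<lambda>t::real. if 0 < t then poly p (1 / t) * exp (- (1 / t)) else 0) has_real_derivative
     (if 0 < t then poly ([:0, 0, 1:] * (p - pderiv p)) (1 / t) * exp (- (1 / t)) else 0)) (at t)" (is "(?f has_real_derivative _) _") for p t
  proof (cases "t = 0")
    case True
    have "((\<lambda>h. (?f (0 + h) - ?f 0) / h) \<longlongrightarrow> 0) (at 0)"
    proof (rule filterlim_split_at)
      have "eventually (\<lambda>h. (?f (0 + h) - ?f 0) / h = 0) (at_left 0)"
        unfolding eventually_at_left_field by (intro exI[of _ "-1"]) auto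
      then show "((\<lambda>h. (?f (0 + h) - ?f 0) / h) \<longlongrightarrow> 0) (at_left 0)" by (rule tendsto_eventually)
      have "((\<lambda>h::real. poly (pCons 0 p) (inverse h) * exp (- inverse h)) \<longlongrightarrow> 0) (at_right 0)"
        by (rule filterlim_compose[OF poly_exp_tendsto_0 filterlim_inverse_at_top_right])
      moreover have "eventually (\<lambda>h. poly (pCons 0 p) (inverse h) * exp (- inverse h) = (?f (0 + h) - ?f 0) / h) (at_right 0)"
        unfolding eventually_at_right_field by (intro exI[of _ 1]) (auto simp: divide_inverse)
      ultimately show "((\<lambda>h. (?f (0 + h) - ?f 0) / h) \<longlongrightarrow> 0) (at_right 0)"
        by (rule Lim_transform_eventually)
    qed
    then show ?thesis using True by (simp add: DERIV_def)
  next
    case False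
    show ?thesis
    proof (cases "0 < t")
      case True
      have "((\<lambda>t. poly p (1 / t) * exp (- (1 / t))) has_real_derivative
         poly ([:0, 0, 1:] * (p - pderiv p)) (1 / t) * exp (- (1 / t))) (at t)"
        using True by (auto intro!: derivative_eq_intros DERIV_chain2[OF poly_DERIV] simp: field_simps power2_eq_square)
      then have "(?f has_real_derivative poly ([:0, 0, 1:] * (p - pderiv p)) (1 / t) * exp (- (1 / t))) (at t)"
        by (rule has_field_derivative_transform_within_open[of _ _ _ "{0<..}"]) (use True in auto)
      then show ?thesis using True by simp
    next
      case False
      have "(?f has_real_derivative 0) (at t)"
        by (rule has_field_derivative_transform_within_open[of "\<lambda>_. 0" _ _ "{..<0}"]) (use False \<open>t \<noteq> 0\<close> in auto)
      then show ?thesis using False by simp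
    qed
  qed
  {
    case 0
    show ?case using D unfolding ndiff.simps has_field_derivative_def differentiable_def by blast
  next
    case (Suc n)
    show ?case by (rule ndiff_real_SucI[OF _ D Suc.IH]) auto
  }
qed

definition bump :: "real \<Rightarrow> real" where "bump t = (if 0 < t then exp (- (1 / t)) else 0)"

lemma ndiff_bump: "ndiff UNIV n bump"
proof -
  have "bump = (\<lambda>t. if 0 < t then poly 1 (1 / t) * exp (- (1 / t)) else 0)" by (auto simp: bump_def fun_eq_iff)
  then show ?thesis using ndiff_flat[of n 1] by (simp only:)
qed

lemma bump_nonneg: "0 \<le> bump t" and bump_pos: "0 < t \<Longrightarrow> 0 < bump t" and bump_eq_0: "t \<le> 0 \<Longrightarrow> bump t = 0"
  by (auto simp: bump_def)

lemma bump_mono: "s \<le> t \<Longrightarrow> bump s \<le> bump t"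
  by (auto simp: bump_def frac_le)

section \<open>Gaussians are Schwartz functions\<close>

lemma real_polynomial_function_has_derivative:
  fixes p :: "'a::euclidean_space \<Rightarrow> real"
  shows "real_polynomial_function p \<Longrightarrow> \<exists>p'. (\<forall>x. (p has_derivative p' x) (at x)) \<and> (\<forall>v. real_polynomial_function (\<lambda>x. p' x v))"
proof (induction rule: real_polynomial_function.induct)
  case (linear f)
  then show ?case by (intro exI[of _ "\<lambda>_. f"]) (auto intro: bounded_linear_imp_has_derivative real_polynomial_function.intros(2))
next
  case (const c)
  then show ?case by (intro exI[of _ "\<lambda>_ _. 0"]) (auto intro: real_polynomial_function.intros(2))
next
  case (add f g)
  then obtain f' g' where "\<forall>x. (f has_derivative f' x) (at x)" "\<forall>v. real_polynomial_function (\<lambda>x. f' x v)"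
    "\<forall>x. (g has_derivative g' x) (at x)" "\<forall>v. real_polynomial_function (\<lambda>x. g' x v)" by blast
  then show ?case by (intro exI[of _ "\<lambda>x v. f' x v + g' x v"]) (auto intro: has_derivative_add)
next
  case (mult f g)
  then obtain f' g' where d: "\<forall>x. (f has_derivative f' x) (at x)" "\<forall>v. real_polynomial_function (\<lambda>x. f' x v)"
    "\<forall>x. (g has_derivative g' x) (at x)" "\<forall>v. real_polynomial_function (\<lambda>x. g' x v)" by blast
  then show ?case using mult.hyps
    by (intro exI[of _ "\<lambda>x v. f x * g' x v + f' x v * g x"]) (auto intro!: has_derivative_mult real_polynomial_function.intros(3) real_polynomial_function.intros(4))
qed

lemma real_polynomial_function_growth:
  fixes p :: "'a::euclidean_space \<Rightarrow> real"
  shows "real_polynomial_function p \<Longrightarrow> \<exists>C m. 0 \<le> C \<and> (\<forall>x. \<bar>p x\<bar> \<le> C * (1 + norm x) ^ m)"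
proof (induction rule: real_polynomial_function.induct)
  case (linear f)
  then obtain K where K: "0 \<le> K" "\<And>x. norm (f x) \<le> norm x * K" using bounded_linear.nonneg_bounded by blast
  have "\<bar>f x\<bar> \<le> K * (1 + norm x) ^ 1" for x using K(2)[of x] K(1) by (simp add: distrib_left mult.commute add_increasing)
  then show ?case using K(1) by blast
next
  case (const c)
  have "\<bar>c\<bar> \<le> \<bar>c\<bar> * (1 + norm x) ^ 0" for x :: 'a by simp
  then show ?case using abs_ge_zero by blast
next
  case (add f g)
  then obtain C m D n where h: "0 \<le> C" "\<forall>x. \<bar>f x\<bar> \<le> C * (1 + norm x) ^ m" "0 \<le> D" "\<forall>x. \<bar>g x\<bar> \<le> D * (1 + norm x) ^ n" by blast
  have "\<bar>f x + g x\<bar> \<le> (C + D) * (1 + norm x) ^ (m + n)" for x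
  proof -
    have "\<bar>f x + g x\<bar> \<le> C * (1 + norm x) ^ m + D * (1 + norm x) ^ n" using h by (meson abs_triangle_ineq add_mono order_trans)
    also have "\<dots> \<le> C * (1 + norm x) ^ (m + n) + D * (1 + norm x) ^ (m + n)"
      using h by (intro add_mono mult_left_mono power_increasing) auto
    finally show ?thesis by (simp add: distrib_right)
  qed
  then show ?case using h add_nonneg_nonneg by blast
next
  case (mult f g)
  then obtain C m D n where h: "0 \<le> C" "\<forall>x. \<bar>f x\<bar> \<le> C * (1 + norm x) ^ m" "0 \<le> D" "\<forall>x. \<bar>g x\<bar> \<le> D * (1 + norm x) ^ n" by blast
  have "\<bar>f x * g x\<bar> \<le> (C * D) * (1 + norm x) ^ (m + n)" for x
  proof -
    have "\<bar>f x * g x\<bar> \<le> (C * (1 + norm x) ^ m) * (D * (1 + norm x) ^ n)" unfolding abs_mult using h by (intro mult_mono) auto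
    then show ?thesis by (simp add: power_add mult_ac)
  qed
  then show ?case using h mult_nonneg_nonneg by blast
qed

lemma power_le_fact_exp: "0 \<le> (y::real) \<Longrightarrow> y ^ n \<le> fact n * exp y"
proof -
  assume "0 \<le> y"
  then have "y ^ n / fact n \<le> exp y"
    using sum_le_suminf[OF summable_exp_generic[of y], of "{n}"] by (auto simp: exp_def scaleR_conv_of_real divide_inverse mult.commute)
  then show ?thesis by (simp add: field_simps)
qed

text \<open>Derivatives of a polynomial times a Gaussian are of the same kind, and any polynomial is outgrown by
\<open>exp (c * |x|\<^sup>2)\<close>.\<close>

lemma schwartz_polynomial_gauss:
  fixes Q p :: "real^3 \<Rightarrow> real"
  assumes Q: "real_polynomial_function Q" and c: "0 < c" "\<And>x. c * (norm x)\<^sup>2 \<le> Q x" and p: "real_polynomial_function p"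
  shows "schwartz (\<lambda>x. of_real (p x * exp (- Q x)) :: complex)"
proof -
  obtain Q' where Q': "\<forall>x. (Q has_derivative Q' x) (at x)" "\<forall>v. real_polynomial_function (\<lambda>x. Q' x v)"
    using real_polynomial_function_has_derivative[OF Q] by blast
  let ?g = "\<lambda>p x. of_real (p x * exp (- Q x)) :: complex"
  have step: "\<exists>q. real_polynomial_function q \<and> (\<lambda>x. frechet_derivative (?g p) (at x) v) = ?g q"
    and diff: "?g p differentiable (at x)" if "real_polynomial_function p" for p v x
  proof -
    obtain p' where p': "\<forall>x. (p has_derivative p' x) (at x)" "\<forall>v. real_polynomial_function (\<lambda>x. p' x v)"
      using real_polynomial_function_has_derivative \<open>real_polynomial_function p\<close> by blast
    have d: "(?g p has_derivative (\<lambda>v. of_real ((p' x v + (-1) * (p x * Q' x v)) * exp (- Q x)))) (at x)" for x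
    proof -
      have "((\<lambda>x. exp (- Q x)) has_derivative (\<lambda>v. exp (- Q x) * (- Q' x v))) (at x)"
        using has_derivative_compose[OF has_derivative_minus[OF Q'(1)[rule_format]] DERIV_exp[unfolded has_field_derivative_def]] .
      from has_derivative_of_real[OF has_derivative_mult[OF p'(1)[rule_format] this]]
      have "(?g p has_derivative (\<lambda>v. of_real (p x * (exp (- Q x) * (- Q' x v)) + p' x v * exp (- Q x)))) (at x)" .
      then show ?thesis by (simp add: algebra_simps)
    qed
    show "?g p differentiable (at x)" using d differentiable_def by blast
    have "(\<lambda>x. frechet_derivative (?g p) (at x) v) = ?g (\<lambda>x. p' x v + (-1) * (p x * Q' x v))"
      by (rule ext) (subst frechet_derivative_at[OF d, symmetric], rule refl)
    moreover have "real_polynomial_function (\<lambda>x. p' x v + (-1) * (p x * Q' x v))"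
      using p'(2) Q'(2) \<open>real_polynomial_function p\<close>
      by (intro real_polynomial_function.intros(3) real_polynomial_function.intros(4) real_polynomial_function.intros(2)) auto
    ultimately show "\<exists>q. real_polynomial_function q \<and> (\<lambda>x. frechet_derivative (?g p) (at x) v) = ?g q" by blast
  qed
  have iter: "\<exists>q. real_polynomial_function q \<and> iter_deriv vs (?g p) = ?g q" for vs
  proof (induction vs)
    case Nil then show ?case using p by (intro exI[of _ p]) auto
  next
    case (Cons v vs)
    then obtain q where "real_polynomial_function q" "iter_deriv vs (?g p) = ?g q" by blast
    then show ?case using step[of q v] by simp
  qed
  have bd: "bounded (range (\<lambda>x. norm x ^ k *\<^sub>R ?g q x))" if q: "real_polynomial_function q" for q k
  proof -
    obtain C m where C: "0 \<le> C" "\<forall>x. \<bar>q x\<bar> \<le> C * (1 + norm x) ^ m" using real_polynomial_function_growth[OF q] by blast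
    have "norm (norm x ^ k *\<^sub>R ?g q x) \<le> C * (fact (k + m) * exp (1 + 1 / (4 * c)))" for x
    proof -
      let ?n = "norm x"
      have 0: "0 \<le> c * (?n - 1 / (2 * c))\<^sup>2" using c by simp
      have "c * (?n - 1 / (2 * c))\<^sup>2 = c * ?n\<^sup>2 - ?n + 1 / (4 * c)" using c(1) by (simp add: power2_eq_square field_simps)
      then have e: "1 + ?n - Q x \<le> 1 + 1 / (4 * c)" using 0 c(2)[of x] by linarith
      have "norm (norm x ^ k *\<^sub>R ?g q x) = ?n ^ k * (\<bar>q x\<bar> * exp (- Q x))" by (simp add: norm_mult abs_mult)
      also have "\<dots> \<le> (1 + ?n) ^ k * ((C * (1 + ?n) ^ m) * exp (- Q x))"
        using C by (intro mult_mono power_mono mult_right_mono) auto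
      also have "\<dots> = C * (1 + ?n) ^ (k + m) * exp (- Q x)" by (simp add: power_add mult_ac)
      also have "\<dots> \<le> C * (fact (k + m) * exp (1 + ?n)) * exp (- Q x)"
        using C by (intro mult_right_mono mult_left_mono power_le_fact_exp) auto
      also have "\<dots> = C * (fact (k + m) * exp (1 + ?n - Q x))" by (simp add: exp_diff exp_minus divide_inverse)
      also have "\<dots> \<le> C * (fact (k + m) * exp (1 + 1 / (4 * c)))" using C e by (intro mult_left_mono) auto
      finally show ?thesis .
    qed
    then show ?thesis unfolding bounded_iff by blast
  qed
  show ?thesis unfolding schwartz_def smooth_on_def
  proof (intro conjI allI impI ballI)
    fix vs x show "iter_deriv vs (?g p) differentiable at x"
    proof -
      obtain q where "real_polynomial_function q" "iter_deriv vs (?g p) = ?g q" using iter by blast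
      then show ?thesis using diff[of q] by simp
    qed
  next
    fix k vs show "bounded (range (\<lambda>x. norm x ^ k *\<^sub>R iter_deriv vs (?g p) x))"
    proof -
      obtain q where "real_polynomial_function q" "iter_deriv vs (?g p) = ?g q" using iter by blast
      then show ?thesis using bd[of q k] by simp
    qed
  qed
qed

text \<open>For small \<open>t\<close> this is spread out horizontally, and its transform is concentrated near the vertical axis.\<close>

definition flat_gauss :: "real \<Rightarrow> real^3 \<Rightarrow> complex" where
  "flat_gauss t x = of_real (exp (- pi * t * (norm (horiz x))\<^sup>2) * exp (- pi * 1 * (x$3)\<^sup>2))"

lemma norm_split_horiz: "(norm x)\<^sup>2 = (norm (horiz x))\<^sup>2 + (x$3)\<^sup>2" for x :: "real^3"
  unfolding norm_horiz by (simp add: norm_vec_def L2_set_def sum_3)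

lemma schwartz_flat_gauss:
  assumes t: "0 < t" "t \<le> 1"
  shows "schwartz (flat_gauss t)"
proof -
  let ?Q = "\<lambda>x::real^3. (pi * t) * (x$1 * x$1 + x$2 * x$2) + pi * (x$3 * x$3)"
  have "schwartz (\<lambda>x. of_real (1 * exp (- ?Q x)) :: complex)"
  proof (rule schwartz_polynomial_gauss[where Q="?Q" and p="\<lambda>_. 1" and c="pi * t"])
    show "real_polynomial_function ?Q"
      by (intro real_polynomial_function.intros bounded_linear_vec_nth)
    fix x :: "real^3"
    have "pi * t * (norm x)\<^sup>2 = (pi * t) * (x$1 * x$1 + x$2 * x$2) + pi * t * (x$3 * x$3)"
      unfolding norm_split_horiz norm_horiz by (simp add: power2_eq_square distrib_left)
    also have "\<dots> \<le> ?Q x" using t by (intro add_left_mono mult_right_mono) auto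
    finally show "pi * t * (norm x)\<^sup>2 \<le> ?Q x" .
  qed (use t in auto)
  moreover have "(\<lambda>x. of_real (1 * exp (- ?Q x)) :: complex) = flat_gauss t"
  proof
    fix x
    have "exp (- ?Q x) = exp (- pi * t * (norm (horiz x))\<^sup>2) * exp (- pi * 1 * (x$3)\<^sup>2)"
      unfolding norm_horiz exp_add[symmetric] by (simp add: power2_eq_square algebra_simps)
    then show "of_real (1 * exp (- ?Q x)) = flat_gauss t x" unfolding flat_gauss_def by simp
  qed
  ultimately show ?thesis by simp
qed

lemma fourier_flat_gauss:
  assumes t: "0 < t" "t \<le> 1"
  shows "fourier (flat_gauss t) (coords (z, w)) = of_real (exp (- pi * (norm z)\<^sup>2 / t) / t * exp (- pi * w\<^sup>2))"
proof -
  let ?e = "\<lambda>z'::plane. of_real (exp (- pi * t * (norm z')\<^sup>2)) * phase (z' \<bullet> z) :: complex"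
  let ?d = "\<lambda>\<tau>. of_real (exp (- pi * 1 * \<tau>\<^sup>2)) * phase (\<tau> * w) :: complex"
  have "integrable lborel (\<lambda>z'::plane. of_real (exp (- pi * t * (norm z')\<^sup>2)) :: complex)"
    unfolding complex_of_real_integrable_eq using t by (intro integrable_gauss2)
  then have e: "integrable lborel ?e" by (intro integrable_mult_phase) auto
  have d: "integrable lborel ?d" by (rule integrable_gauss_phase) simp
  have "fourier (flat_gauss t) (coords (z, w)) = fourier_split (\<lambda>u. flat_gauss t (coords u)) z w"
    by (rule fourier_coords[OF schwartz_measurable[OF schwartz_flat_gauss[OF t]]])
  also have "\<dots> = (LBINT u. ?e (fst u) * ?d (snd u))"
    unfolding fourier_split_def flat_gauss_def by (simp add: phase_add inner_commute mult_ac)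
  also have "\<dots> = (LBINT z'. ?e z') * (LBINT \<tau>. ?d \<tau>)" by (rule lborel_integral_product[OF e d])
  also have "\<dots> = of_real (exp (- pi * (norm z)\<^sup>2 / t) / t) * of_real (exp (- pi * w\<^sup>2 / 1) / sqrt 1)"
    unfolding integral_gauss2_phase[OF t(1)] integral_gauss_phase[OF zero_less_one] ..
  finally show ?thesis by simp
qed

section \<open>No strictly positive transform in degree -1\<close>

text \<open>With \<open>|u| powr (-2)\<close> written as \<open>pi\<close> times the integral of \<open>exp (- pi \<sigma> |u|\<^sup>2)\<close> over \<open>\<sigma> > 0\<close>, the integral over
space becomes Gaussian and leaves \<open>pi / ((\<sigma> + t) * sqrt (\<sigma> + 1))\<close>. The part \<open>\<sigma> \<le> 1\<close> already
diverges logarithmically as \<open>t\<close> tends to \<open>0\<close>.\<close>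

lemma flat_gauss_log_lower_bound:
  assumes t: "0 < t"
  shows "ennreal (pi / sqrt 2 * ln ((1 + t) / t)) \<le>
    (\<integral>\<^sup>+u. ennreal (norm u powr (- 2) * (exp (- pi * t * (norm (fst u))\<^sup>2) * exp (- pi * 1 * (snd u)\<^sup>2))) \<partial>(lborel :: (plane\<times>real) measure))"
proof -
  let ?g = "\<lambda>u::plane\<times>real. exp (- pi * t * (norm (fst u))\<^sup>2) * exp (- pi * 1 * (snd u)\<^sup>2)"
  let ?H = "\<lambda>p::real\<times>(plane\<times>real). ennreal (pi * indicator {0<..} (fst p) * (exp (- pi * (fst p + t) * (norm (fst (snd p)))\<^sup>2) * exp (- pi * (fst p + 1) * (snd (snd p))\<^sup>2)))"
  have mH: "?H \<in> borel_measurable borel"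
  proof -
    have [measurable]: "(\<lambda>p::real\<times>(plane\<times>real). exp (- pi * (fst p + t) * (norm (fst (snd p)))\<^sup>2) * exp (- pi * (fst p + 1) * (snd (snd p))\<^sup>2)) \<in> borel_measurable borel"
      by (intro borel_measurable_continuous_onI continuous_intros)
    show ?thesis by measurable
  qed
  have sub: "ennreal (norm u powr (- 2) * ?g u) = (\<integral>\<^sup>+\<sigma>. ?H (\<sigma>, u) \<partial>lborel)" if "u \<noteq> 0" for u :: "plane\<times>real"
  proof -
    have A: "pi * (norm u)\<^sup>2 > 0" using that by simp
    have nu: "(norm u)\<^sup>2 = (norm (fst u))\<^sup>2 + (snd u)\<^sup>2" by (simp add: norm_prod_def)
    have "(\<integral>\<^sup>+\<sigma>. ?H (\<sigma>, u) \<partial>lborel) = (\<integral>\<^sup>+\<sigma>. ennreal (pi * ?g u) * ennreal (indicator {0<..} \<sigma> * \<sigma> powr (1 - 1) * exp (- (pi * (norm u)\<^sup>2) * \<sigma>)) \<partial>lborel)"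
    proof (rule nn_integral_cong)
      fix \<sigma> :: real
      have "exp (- pi * (\<sigma> + t) * (norm (fst u))\<^sup>2) * exp (- pi * (\<sigma> + 1) * (snd u)\<^sup>2) = ?g u * exp (- (pi * (norm u)\<^sup>2) * \<sigma>)"
        unfolding nu exp_add[symmetric] by (simp add: algebra_simps)
      then show "?H (\<sigma>, u) = ennreal (pi * ?g u) * ennreal (indicator {0<..} \<sigma> * \<sigma> powr (1 - 1) * exp (- (pi * (norm u)\<^sup>2) * \<sigma>))"
        by (auto simp: indicator_def ennreal_mult'[symmetric] mult_ac)
    qed
    also have "\<dots> = ennreal (pi * ?g u) * (\<integral>\<^sup>+\<sigma>. ennreal (indicator {0<..} \<sigma> * \<sigma> powr (1 - 1) * exp (- (pi * (norm u)\<^sup>2) * \<sigma>)) \<partial>lborel)"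
      by (rule nn_integral_cmult) measurable
    also have "\<dots> = ennreal (pi * ?g u) * ennreal (Gamma 1 * (pi * (norm u)\<^sup>2) powr (- 1))"
      by (subst nn_integral_gamma[OF zero_less_one A]) (rule refl)
    also have "\<dots> = ennreal (pi * ?g u * (pi * (norm u)\<^sup>2) powr (- 1))" by (simp add: ennreal_mult'[symmetric])
    also have "pi * ?g u * (pi * (norm u)\<^sup>2) powr (- 1) = norm u powr (- 2) * ?g u"
    proof -
      have "(pi * (norm u)\<^sup>2) powr (- 1) = 1 / (pi * (norm u)\<^sup>2)" by (rule powr_minus_one) simp
      moreover have "norm u powr (- 2) = 1 / (norm u)\<^sup>2" using that by (simp add: powr_minus divide_inverse)
      ultimately show ?thesis by simp
    qed
    finally show ?thesis ..
  qed
  have inner: "(\<integral>\<^sup>+u. ?H (\<sigma>, u) \<partial>lborel) = ennreal (pi * indicator {0<..} \<sigma> * (1 / (\<sigma> + t) * (1 / sqrt (\<sigma> + 1))))" for \<sigma>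
  proof (cases "0 < \<sigma>")
    case True
    then have pos: "\<sigma> + t > 0" "\<sigma> + 1 > 0" using t by auto
    let ?a = "\<lambda>z::plane. exp (- pi * (\<sigma> + t) * (norm z)\<^sup>2)" and ?b = "\<lambda>w::real. exp (- pi * (\<sigma> + 1) * w\<^sup>2)"
    have "(\<integral>\<^sup>+u. ?H (\<sigma>, u) \<partial>lborel) = (\<integral>\<^sup>+u. ennreal pi * (ennreal (?a (fst u)) * ennreal (?b (snd u))) \<partial>lborel)"
      using True by (simp add: ennreal_mult')
    also have "\<dots> = ennreal pi * (\<integral>\<^sup>+u. ennreal (?a (fst u)) * ennreal (?b (snd u)) \<partial>lborel)"
      by (rule nn_integral_cmult) measurable
    also have "(\<integral>\<^sup>+u. ennreal (?a (fst u)) * ennreal (?b (snd u)) \<partial>lborel) = (\<integral>\<^sup>+z. ennreal (?a z) \<partial>lborel) * (\<integral>\<^sup>+w. ennreal (?b w) \<partial>lborel)"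
      by (rule lborel_nn_integral_product) measurable
    also have "(\<integral>\<^sup>+z. ennreal (?a z) \<partial>lborel) = ennreal (1 / (\<sigma> + t))"
      by (subst nn_integral_eq_integral[OF integrable_gauss2[OF pos(1)]]) (simp, subst integral_gauss2[OF pos(1)], rule refl)
    also have "(\<integral>\<^sup>+w. ennreal (?b w) \<partial>lborel) = ennreal (1 / sqrt (\<sigma> + 1))"
      by (subst nn_integral_eq_integral[OF integrable_gauss[OF pos(2)]]) (simp, subst integral_gauss[OF pos(2)], rule refl)
    finally show ?thesis using True pos by (simp add: ennreal_mult'[symmetric])
  qed simp
  have "ennreal (pi / sqrt 2 * ln ((1 + t) / t)) = (\<integral>\<^sup>+\<sigma>. ennreal (pi / sqrt 2 * (1 / (\<sigma> + t))) * indicator {0..1} \<sigma> \<partial>lborel)"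
  proof -
    have "(\<integral>\<^sup>+\<sigma>. ennreal (pi / sqrt 2 * (1 / (\<sigma> + t))) * indicator {0..1} \<sigma> \<partial>lborel) = ennreal (pi / sqrt 2 * ln (1 + t) - pi / sqrt 2 * ln (0 + t))"
    proof (rule nn_integral_FTC_Icc[where F="\<lambda>x. pi / sqrt 2 * ln (x + t)"])
      fix x :: real assume "x \<in> {0..1}"
      then have x: "0 \<le> x" "x \<le> 1" by auto
      show "((\<lambda>x. pi / sqrt 2 * ln (x + t)) has_real_derivative pi / sqrt 2 * (1 / (x + t))) (at x)"
        using t x by (intro DERIV_cmult) (auto intro!: derivative_eq_intros)
      show "0 \<le> pi / sqrt 2 * (1 / (x + t))" using x t by simp
    qed auto
    moreover have "pi / sqrt 2 * ln (1 + t) - pi / sqrt 2 * ln (0 + t) = pi / sqrt 2 * ln ((1 + t) / t)"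
      using t by (simp add: ln_div right_diff_distrib)
    ultimately show ?thesis by simp
  qed
  also have "\<dots> \<le> (\<integral>\<^sup>+\<sigma>. ennreal (pi * indicator {0<..} \<sigma> * (1 / (\<sigma> + t) * (1 / sqrt (\<sigma> + 1)))) \<partial>lborel)"
  proof (rule nn_integral_mono_AE)
    have "AE \<sigma>::real in lborel. \<sigma> \<noteq> 0" using AE_inner_neq[of "1::real" 0] by simp
    then show "AE \<sigma> in lborel. ennreal (pi / sqrt 2 * (1 / (\<sigma> + t))) * indicator {0..1} \<sigma> \<le> ennreal (pi * indicator {0<..} \<sigma> * (1 / (\<sigma> + t) * (1 / sqrt (\<sigma> + 1))))"
    proof eventually_elim
      case (elim \<sigma>)
      show ?case
      proof (cases "0 < \<sigma> \<and> \<sigma> \<le> 1")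
        case True
        then have "1 / sqrt 2 \<le> 1 / sqrt (\<sigma> + 1)" by (intro divide_left_mono) auto
        then have "pi * (1 / (\<sigma> + t) * (1 / sqrt 2)) \<le> pi * (1 / (\<sigma> + t) * (1 / sqrt (\<sigma> + 1)))"
          using True t by (intro mult_left_mono) auto
        then show ?thesis using True by (simp add: mult_ac ennreal_leI)
      next
        case False
        then show ?thesis using elim by (auto simp: indicator_def)
      qed
    qed
  qed
  also have "\<dots> = (\<integral>\<^sup>+\<sigma>. \<integral>\<^sup>+u. ?H (\<sigma>, u) \<partial>lborel \<partial>lborel)" unfolding inner ..
  also have "\<dots> = (\<integral>\<^sup>+p. ?H p \<partial>lborel)" by (rule lborel_nn_integral_fst[OF mH])
  also have "\<dots> = (\<integral>\<^sup>+u. \<integral>\<^sup>+\<sigma>. ?H (\<sigma>, u) \<partial>lborel \<partial>lborel)" by (rule lborel_nn_integral_snd[OF mH, symmetric])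
  also have "\<dots> = (\<integral>\<^sup>+u. ennreal (norm u powr (- 2) * ?g u) \<partial>lborel)"
  proof (rule nn_integral_cong_AE)
    show "AE u in lborel. (\<integral>\<^sup>+\<sigma>. ?H (\<sigma>, u) \<partial>lborel) = ennreal (norm u powr (- 2) * ?g u)"
      using AE_space_neq
    proof eventually_elim
      case (elim u)
      then have "u \<noteq> 0" by auto
      then show ?case by (rule sub[symmetric])
    qed
  qed
  finally show ?thesis .
qed

lemma smooth_on_S2_continuous:
  assumes "smooth_on_S2 \<omega>"
  shows "\<exists>F. continuous_on S2 F \<and> (\<forall>x\<in>S2. F x = \<omega> x)"
proof -
  obtain U F where F: "open U" "S2 \<subseteq> U" "smooth_on U F" "\<forall>x\<in>S2. F x = \<omega> x"
    using assms unfolding smooth_on_S2_def by blast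
  have "set [] \<subseteq> (Basis::(real^3) set)" by simp
  then have "\<forall>x\<in>U. iter_deriv [] F differentiable (at x)" using F(3) unfolding smooth_on_def by blast
  then have "continuous_on S2 F"
    using F(2) by (intro continuous_at_imp_continuous_on) (auto intro: differentiable_imp_continuous_within)
  then show ?thesis using F(4) by blast
qed

lemma vanishing_near_poles:
  assumes \<beta>: "0 < \<beta>" "\<beta> < pi / 2" and v: "vanishes_upto \<beta> \<omega>" and even: "\<And>x. x \<in> S2 \<Longrightarrow> \<omega> (- x) = \<omega> x"
    and x: "x \<in> S2" "cos \<beta> \<le> \<bar>x$3\<bar>"
  shows "\<omega> x = 0"
proof -
  have pos: "\<omega> x = 0" if x: "x \<in> S2" "cos \<beta> \<le> x$3" for x
  proof -
    have n: "(x$1)\<^sup>2 + (x$2)\<^sup>2 + (x$3)\<^sup>2 = 1"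
      using x(1) norm_split_horiz[of x] unfolding norm_horiz by simp
    then have "(x$3)\<^sup>2 \<le> 1" by (metis add_increasing le_add_same_cancel2 order_refl sum_power2_ge_zero)
    then have x3: "\<bar>x$3\<bar> \<le> 1" by (simp add: abs_square_le_1)
    define \<theta> where "\<theta> = arccos (x$3)"
    have c: "cos \<theta> = x$3" unfolding \<theta>_def using x3 by (intro cos_arccos) auto
    have "\<theta> \<in> {0..\<beta>}"
    proof -
      have "\<theta> \<le> arccos (cos \<beta>)" unfolding \<theta>_def using x(2) x3 \<beta> by (intro arccos_le_arccos) auto
      then show ?thesis using \<beta> x3 unfolding \<theta>_def by (auto simp: arccos_cos arccos_lbound)
    qed
    then have s0: "0 \<le> sin \<theta>" using \<beta> by (intro sin_ge_zero) auto
    have s2: "(x$1)\<^sup>2 + (x$2)\<^sup>2 = (sin \<theta>)\<^sup>2" using n c sin_squared_eq[of \<theta>] by simp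
    obtain \<mu> where \<mu>: "0 \<le> \<mu>" "\<mu> < 2 * pi" "x$1 = sin \<theta> * cos \<mu>" "x$2 = sin \<theta> * sin \<mu>"
    proof (cases "sin \<theta> = 0")
      case True
      then have "x$1 = 0" "x$2 = 0" using s2 by auto
      then show ?thesis using True by (intro that[of 0]) auto
    next
      case False
      have "(x$1 / sin \<theta>)\<^sup>2 + (x$2 / sin \<theta>)\<^sup>2 = 1"
        unfolding power_divide add_divide_distrib[symmetric] s2 using False by simp
      then obtain \<mu> where "0 \<le> \<mu>" "\<mu> < 2 * pi" "x$1 / sin \<theta> = cos \<mu>" "x$2 / sin \<theta> = sin \<mu>"
        using sincos_total_2pi by blast
      then show ?thesis using False by (intro that[of \<mu>]) (auto simp: field_simps)
    qed
    have "x = sph \<theta> \<mu>" unfolding sph_def vec_eq_iff forall_3 vector_3 using \<mu> c by simp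
    then show ?thesis using v \<open>\<theta> \<in> {0..\<beta>}\<close> \<mu> unfolding vanishes_upto_def by auto
  qed
  show ?thesis
  proof (cases "0 \<le> x$3")
    case True then show ?thesis using pos x by simp
  next
    case False
    then have "\<omega> (- x) = 0" using x by (intro pos) auto
    then show ?thesis using even x by simp
  qed
qed

text \<open>Paired with the transform of \<open>flat_gauss t\<close>, the function with angle function \<open>\<omega>\<close> stays bounded: it is at most
\<open>M / |z|\<close>, and for given \<open>z\<close> it is supported in a vertical segment of length \<open>2 c |z|\<close>, so only a Gaussian
of fixed mass remains to be integrated. On the other side \<open>\<omega>' \<ge> \<delta> > 0\<close> by compactness of the sphere, and the pairing
is at least \<open>\<delta>\<close> times the integral of \<open>flat_gauss_log_lower_bound\<close>.\<close>

lemma no_positive_transform: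
  assumes \<beta>: "0 < \<beta>" "\<beta> < pi / 2" and adm: "admissible \<omega>" and v: "vanishes_upto \<beta> \<omega>"
    and af: "angle_fourier 1 \<omega> \<omega>'" and pos: "\<And>\<xi>. \<xi> \<in> S2 \<Longrightarrow> 0 < \<omega>' \<xi>"
  shows False
proof -
  have ev: "\<And>x. x \<in> S2 \<Longrightarrow> \<omega> (- x) = \<omega> x" and sm: "smooth_on_S2 \<omega>" "smooth_on_S2 \<omega>'"
    using adm af unfolding admissible_def angle_fourier_def by auto
  have ne: "S2 \<noteq> {}" by simp
  have cS: "compact S2" by simp
  obtain F where F: "continuous_on S2 F" "\<forall>x\<in>S2. F x = \<omega> x" using smooth_on_S2_continuous[OF sm(1)] by blast
  obtain F' where F': "continuous_on S2 F'" "\<forall>x\<in>S2. F' x = \<omega>' x" using smooth_on_S2_continuous[OF sm(2)] by blast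
  have "bounded (F ` S2)" "bounded (F' ` S2)"
    using compact_continuous_image[OF F(1) cS] compact_continuous_image[OF F'(1) cS] by (simp_all only: compact_imp_bounded)
  then obtain M M' where "\<forall>x\<in>S2. \<bar>F x\<bar> \<le> M" "\<forall>x\<in>S2. \<bar>F' x\<bar> \<le> M'" by (auto simp: bounded_iff)
  then have M: "\<bar>\<omega> x\<bar> \<le> M" and M': "\<bar>\<omega>' x\<bar> \<le> M'" if "x \<in> S2" for x using F(2) F'(2) that by auto
  have M0: "0 \<le> M" and M'0: "0 \<le> M'" using M M' ne by (meson abs_ge_zero order_trans ex_in_conv)+
  obtain x0 where x0: "x0 \<in> S2" "\<forall>y\<in>S2. F' x0 \<le> F' y" using continuous_attains_inf[OF cS ne F'(1)] by blast
  define \<delta> where "\<delta> = \<omega>' x0"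
  have \<delta>: "\<delta> > 0" "\<And>x. x \<in> S2 \<Longrightarrow> \<delta> \<le> \<omega>' x" unfolding \<delta>_def using pos x0 F'(2) by auto
  have sgnS: "sgn x \<in> S2" if "x \<noteq> 0" for x :: "real^3" using that by (simp add: norm_sgn)
  define c where "c = cos \<beta> / sin \<beta>"
  have sb: "0 < sin \<beta>" "0 < cos \<beta>" using \<beta> by (auto intro: sin_gt_zero cos_gt_zero)
  have c0: "0 < c" unfolding c_def using sb by simp
  have hb: "norm (homog (- 1) \<omega> (coords u)) \<le> M / norm (fst u) * indicator {- c * norm (fst u)..c * norm (fst u)} (snd u)"
    if u: "fst u \<noteq> 0" for u
  proof -
    let ?x = "coords u"
    have n2: "(norm ?x)\<^sup>2 = (norm (fst u))\<^sup>2 + (snd u)\<^sup>2" unfolding norm_split_horiz by simp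
    have nz: "norm (fst u) > 0" using u by simp
    then have np: "(norm ?x)\<^sup>2 > 0" unfolding n2 by (simp add: add_pos_nonneg)
    then have x0: "?x \<noteq> 0" by auto
    have le: "norm (fst u) \<le> norm ?x" by (rule power2_le_imp_le) (simp_all add: n2)
    show ?thesis
    proof (cases "\<bar>snd u\<bar> \<le> c * norm (fst u)")
      case True
      have "norm (homog (- 1) \<omega> ?x) = norm ?x powr (- 1) * \<bar>\<omega> (sgn ?x)\<bar>" unfolding homog_def by (simp only: norm_of_real abs_mult abs_of_nonneg[OF powr_ge_zero])
      also have "\<dots> = \<bar>\<omega> (sgn ?x)\<bar> / norm ?x" by (subst powr_minus_one) auto
      also have "\<dots> \<le> M / norm (fst u)" using M[OF sgnS[OF x0]] le nz M0 by (intro frac_le) auto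
      finally show ?thesis using True by (simp add: indicator_def abs_le_iff)
    next
      case False
      then have "(c * norm (fst u))\<^sup>2 \<le> \<bar>snd u\<bar>\<^sup>2" using c0 by (intro power_mono) auto
      then have "(cos \<beta>)\<^sup>2 * (norm (fst u))\<^sup>2 \<le> (sin \<beta>)\<^sup>2 * (snd u)\<^sup>2"
        unfolding c_def using sb by (simp add: power_mult_distrib power_divide field_simps)
      then have "(cos \<beta>)\<^sup>2 * (norm ?x)\<^sup>2 \<le> ((sin \<beta>)\<^sup>2 + (cos \<beta>)\<^sup>2) * (snd u)\<^sup>2"
        unfolding n2 by (simp only: distrib_left distrib_right add_mono order_refl)
      then have "(cos \<beta> * norm ?x)\<^sup>2 \<le> \<bar>snd u\<bar>\<^sup>2" by (simp add: power_mult_distrib)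
      then have "cos \<beta> * norm ?x \<le> \<bar>snd u\<bar>" by (rule power2_le_imp_le) simp
      then have "cos \<beta> \<le> \<bar>snd u\<bar> / norm ?x" using x0 by (simp add: pos_le_divide_eq)
      also have "\<dots> = \<bar>sgn ?x $ 3\<bar>" by (simp add: sgn_div_norm abs_mult divide_inverse mult.commute)
      finally have "\<omega> (sgn ?x) = 0" using vanishing_near_poles[OF \<beta> v ev sgnS[OF x0]] by blast
      then show ?thesis using M0 nz by (simp add: homog_def)
    qed
  qed
  have L: "norm (regular_distr (homog (- 1) \<omega>) (fourier (flat_gauss t))) \<le> 2 * c * M" if t: "0 < t" "t \<le> 1" for t
  proof -
    let ?f = "\<lambda>x. homog (- 1) \<omega> x * fourier (flat_gauss t) x"
    let ?b = "\<lambda>u::plane\<times>real. M / norm (fst u) * indicator {p. \<bar>snd p\<bar> \<le> c * norm (fst p)} u * (exp (- pi * (norm (fst u))\<^sup>2 / t) / t)"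
    have [measurable]: "{p::plane\<times>real. \<bar>snd p\<bar> \<le> c * norm (fst p)} \<in> sets borel"
      by (intro borel_closed closed_Collect_le continuous_intros)
    have mb: "?b \<in> borel_measurable borel" by measurable
    have uncoords: "\<exists>u. x = coords u" for x :: "real^3"
      by (intro exI[of _ "((x$1, x$2), x$3)"]) (simp add: vec_eq_iff forall_3)
    have fb: "norm (?f (coords u)) \<le> ?b u" if "fst u \<noteq> 0" for u
    proof -
      have "norm (fourier (flat_gauss t) (coords u)) = exp (- pi * (norm (fst u))\<^sup>2 / t) / t * exp (- pi * (snd u)\<^sup>2)"
        using fourier_flat_gauss[OF t, of "fst u" "snd u"] t by (simp add: norm_mult norm_divide)
      also have "\<dots> \<le> exp (- pi * (norm (fst u))\<^sup>2 / t) / t * 1" using t by (intro mult_left_mono) auto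
      finally have "norm (?f (coords u)) \<le> (M / norm (fst u) * indicator {- c * norm (fst u)..c * norm (fst u)} (snd u)) * (exp (- pi * (norm (fst u))\<^sup>2 / t) / t)"
        unfolding norm_mult using hb[OF that] M0 by (intro mult_mono) auto
      moreover have "indicator {- c * norm (fst u)..c * norm (fst u)} (snd u) = (indicator {p. \<bar>snd p\<bar> \<le> c * norm (fst p)} u :: real)"
        by (auto simp: indicator_def)
      ultimately show ?thesis by simp
    qed
    have "ennreal (norm (LBINT x. ?f x)) \<le> (\<integral>\<^sup>+x. ennreal (norm (?f x)) \<partial>lborel)"
      by (cases "integrable lborel ?f") (auto intro: integral_norm_bound_ennreal simp: not_integrable_integral_eq)
    also have "\<dots> \<le> (\<integral>\<^sup>+x. ennreal (?b (horiz x, x$3)) \<partial>lborel)"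
    proof (rule nn_integral_mono_AE)
      have "AE x::real^3 in lborel. x \<bullet> axis 1 1 \<noteq> 0" by (rule AE_inner_neq) simp
      then show "AE x in lborel. ennreal (norm (?f x)) \<le> ennreal (?b (horiz x, x$3))"
      proof eventually_elim
        case (elim x)
        obtain u where u: "x = coords u" using uncoords by blast
        have "fst u \<noteq> 0" using elim unfolding u by (auto simp: inner_axis zero_prod_def)
        from fb[OF this] show ?case unfolding u by (intro ennreal_leI) simp
      qed
    qed
    also have "\<dots> = (\<integral>\<^sup>+u. ennreal (?b u) \<partial>lborel)"
    proof -
      have "(\<lambda>x. (horiz x, x$3)) \<in> borel_measurable borel"
        by (intro borel_measurable_continuous_onI continuous_intros)
      from measurable_compose[OF this mb] have "(\<lambda>x. ennreal (?b (horiz x, x$3))) \<in> borel_measurable borel" by measurable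
      from lborel_nn_integral_coords[OF this] show ?thesis by simp
    qed
    also have "\<dots> = (\<integral>\<^sup>+z. \<integral>\<^sup>+w. ennreal (?b (z, w)) \<partial>lborel \<partial>lborel)"
      using mb by (intro lborel_nn_integral_fst[symmetric]) measurable
    also have "\<dots> \<le> (\<integral>\<^sup>+z. ennreal (2 * c * M / t * exp (- pi * (1 / t) * (norm (z::plane))\<^sup>2)) \<partial>lborel)"
    proof (rule nn_integral_mono)
      fix z :: "plane"
      show "(\<integral>\<^sup>+w. ennreal (?b (z, w)) \<partial>lborel) \<le> ennreal (2 * c * M / t * exp (- pi * (1 / t) * (norm z)\<^sup>2))"
      proof (cases "z = 0")
        case False
        then have nz: "norm z > 0" by simp
        let ?C = "M / norm z * (exp (- pi * (norm z)\<^sup>2 / t) / t)"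
        have C0: "0 \<le> ?C" using M0 t by simp
        have "(\<integral>\<^sup>+w. ennreal (?b (z, w)) \<partial>lborel) = (\<integral>\<^sup>+w. ennreal ?C * indicator {- (c * norm z)..c * norm z} w \<partial>lborel)"
          by (intro nn_integral_cong) (auto simp: indicator_def abs_le_iff)
        also have "\<dots> = ennreal ?C * ennreal (2 * (c * norm z))"
          using c0 by (subst nn_integral_cmult_indicator) auto
        also have "\<dots> = ennreal (2 * c * M / t * exp (- pi * (1 / t) * (norm z)\<^sup>2))"
          unfolding ennreal_mult'[OF C0, symmetric]
          by (rule arg_cong[where f=ennreal]) (use nz in \<open>simp add: mult_ac\<close>)
        finally show ?thesis by simp
      qed (use M0 c0 t in simp)
    qed
    also have "\<dots> = ennreal (LBINT z. 2 * c * M / t * exp (- pi * (1 / t) * (norm (z::plane))\<^sup>2))"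
      by (intro nn_integral_eq_integral integrable_mult_right integrable_gauss2) (use t M0 c0 in auto)
    also have "(LBINT z. 2 * c * M / t * exp (- pi * (1 / t) * (norm (z::plane))\<^sup>2)) = 2 * c * M / t * (1 / (1 / t))"
      using t by (subst integral_mult_right_zero, subst integral_gauss2) auto
    also have "\<dots> = 2 * c * M" using t by simp
    finally show ?thesis unfolding regular_distr_def using M0 c0 by (simp add: ennreal_le_iff)
  qed
  have R: "\<delta> * (pi / sqrt 2 * ln ((1 + t) / t)) \<le> norm (regular_distr (homog (- 3 + 1) \<omega>') (flat_gauss t))" if t: "0 < t" "t \<le> 1" for t
  proof -
    define e where "e = (\<lambda>x::real^3. exp (- pi * t * (norm (horiz x))\<^sup>2) * exp (- pi * 1 * (x$3)\<^sup>2))"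
    define G where "G = (\<lambda>x::real^3. norm x powr (- 2) * \<omega>' (sgn x) * e x)"
    have em[measurable]: "e \<in> borel_measurable borel" unfolding e_def by measurable
    have ncoords: "norm (coords u) = norm u" for u
    proof -
      have "(norm (coords u))\<^sup>2 = (norm u)\<^sup>2" unfolding norm_split_horiz norm_prod_def[of u] by (simp add: sum_power2_ge_zero)
      then show ?thesis by simp
    qed
    have Gm: "G \<in> borel_measurable borel"
    proof -
      have "(\<lambda>x. indicator (- {0}) x *\<^sub>R F' (sgn x)) \<in> borel_measurable borel"
      proof (rule borel_measurable_continuous_on_indicator)
        have "continuous_on (- {0}) (sgn :: real^3 \<Rightarrow> _)"
          unfolding sgn_div_norm[abs_def] by (intro continuous_intros) auto
        from continuous_on_compose2[OF F'(1) this] show "continuous_on (- {0}) (\<lambda>x. F' (sgn x))" using sgnS by blast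
      qed auto
      then have "(\<lambda>x. norm x powr (- 2) * (indicator (- {0}) x *\<^sub>R F' (sgn x)) * e x) \<in> borel_measurable borel" by measurable
      moreover have "(\<lambda>x. norm x powr (- 2) * (indicator (- {0}) x *\<^sub>R F' (sgn x)) * e x) = G"
      proof
        fix x :: "real^3"
        show "norm x powr (- 2) * (indicator (- {0}) x *\<^sub>R F' (sgn x)) * e x = G x"
          unfolding G_def using F'(2) sgnS[of x] by (cases "x = 0") auto
      qed
      ultimately show ?thesis by simp
    qed
    let ?k = "\<lambda>u::plane\<times>real. norm u powr (- 2) * exp (- pi * t * (norm u)\<^sup>2)"
    let ?m = "\<lambda>u::plane\<times>real. norm u powr (- 2) * (exp (- pi * t * (norm (fst u))\<^sup>2) * exp (- pi * 1 * (snd u)\<^sup>2))"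
    have ec: "e (coords u) = exp (- pi * t * (norm (fst u))\<^sup>2) * exp (- pi * 1 * (snd u)\<^sup>2)" for u unfolding e_def by simp
    have mk: "?m u \<le> ?k u" for u
    proof -
      have "(norm u)\<^sup>2 = (norm (fst u))\<^sup>2 + (snd u)\<^sup>2" by (simp add: norm_prod_def)
      then have "exp (- pi * t * (norm u)\<^sup>2) = exp (- pi * t * (norm (fst u))\<^sup>2) * exp (- pi * t * (snd u)\<^sup>2)"
        by (simp add: distrib_left exp_add[symmetric])
      moreover have "exp (- pi * 1 * (snd u)\<^sup>2) \<le> exp (- pi * t * (snd u)\<^sup>2)" using t by (simp add: mult_left_le_one_le)
      ultimately show ?thesis by (simp add: mult_left_mono)
    qed
    have k: "integrable lborel ?k" by (rule integrable_powr_gauss3[OF t(1)])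
    have m: "integrable lborel ?m"
    proof (rule Bochner_Integration.integrable_bound[OF k])
      show "AE u in lborel. norm (?m u) \<le> norm (?k u)" using mk by (intro AE_I2) (simp add: abs_mult)
    qed measurable
    have Gle: "\<bar>G (coords u)\<bar> \<le> M' * ?m u" and Gge: "\<delta> * ?m u \<le> G (coords u)" for u
    proof -
      have "\<bar>G (coords u)\<bar> \<le> M' * ?m u \<and> \<delta> * ?m u \<le> G (coords u)"
      proof (cases "coords u = 0")
        case True
        then have "norm u = 0" using ncoords[of u] by simp
        then show ?thesis unfolding G_def True by simp
      next
        case False
        from sgnS[OF this] have 1: "\<bar>\<omega>' (sgn (coords u))\<bar> \<le> M'" "\<delta> \<le> \<omega>' (sgn (coords u))" using M' \<delta>(2) by auto
        have 2: "G (coords u) = \<omega>' (sgn (coords u)) * ?m u" unfolding G_def ec ncoords by simp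
        have 3: "0 \<le> ?m u" by simp
        show ?thesis unfolding 2 abs_mult abs_of_nonneg[OF 3] using mult_right_mono[OF 1(1) 3] mult_right_mono[OF 1(2) 3] by simp
      qed
      then show "\<bar>G (coords u)\<bar> \<le> M' * ?m u" "\<delta> * ?m u \<le> G (coords u)" by auto
    qed
    have Gc: "integrable lborel (\<lambda>u. G (coords u))"
    proof (rule Bochner_Integration.integrable_bound[OF integrable_mult_right[OF m, of M']])
      show "(\<lambda>u. G (coords u)) \<in> borel_measurable lborel" using measurable_compose[OF measurable_coords Gm] by simp
      show "AE u in lborel. norm (G (coords u)) \<le> norm (M' * ?m u)"
        by (rule AE_I2, unfold real_norm_def, rule order_trans[OF Gle abs_ge_self])
    qed
    have "\<delta> * (pi / sqrt 2 * ln ((1 + t) / t)) \<le> \<delta> * (LBINT u. ?m u)"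
    proof -
      have "ennreal (pi / sqrt 2 * ln ((1 + t) / t)) \<le> ennreal (LBINT u. ?m u)"
        using flat_gauss_log_lower_bound[OF t(1)] by (subst (asm) nn_integral_eq_integral[OF m]) auto
      then have "pi / sqrt 2 * ln ((1 + t) / t) \<le> (LBINT u. ?m u)" by (subst (asm) ennreal_le_iff) auto
      then show ?thesis using \<delta>(1) by (intro mult_left_mono) auto
    qed
    also have "\<dots> = (LBINT u. \<delta> * ?m u)" by (rule integral_mult_right_zero[symmetric])
    also have "\<dots> \<le> (LBINT u. G (coords u))" by (intro integral_mono integrable_mult_right m Gc Gge)
    also have "\<dots> = (LBINT x. G x)" by (rule lborel_integral_coords[OF Gm, symmetric])
    also have "\<dots> \<le> norm (of_real (LBINT x. G x) :: complex)" by simp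
    also have "of_real (LBINT x. G x) = regular_distr (homog (- 3 + 1) \<omega>') (flat_gauss t)"
      unfolding regular_distr_def integral_complex_of_real[symmetric] homog_def flat_gauss_def G_def e_def by simp
    finally show ?thesis .
  qed
  \<comment> \<open>the width is chosen such that the logarithmic lower bound exceeds the upper bound by 1\<close>
  define Y where "Y = (2 * c * M + 1) / (\<delta> * (pi / sqrt 2))"
  define t where "t = exp (- \<bar>Y\<bar>)"
  have t: "0 < t" "t \<le> 1" unfolding t_def by auto
  have "Y \<le> ln (1 / t)" unfolding t_def by (simp add: ln_div)
  also have "\<dots> \<le> ln ((1 + t) / t)" using t by (subst ln_le_cancel_iff) (auto simp: divide_right_mono)
  finally have Y: "Y \<le> ln ((1 + t) / t)" .
  have "2 * c * M + 1 = \<delta> * (pi / sqrt 2 * Y)" unfolding Y_def using \<delta>(1) by simp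
  also have "\<dots> \<le> \<delta> * (pi / sqrt 2 * ln ((1 + t) / t))" using Y \<delta>(1) by (intro mult_left_mono) auto
  also have "\<dots> \<le> norm (regular_distr (homog (- 3 + 1) \<omega>') (flat_gauss t))" by (rule R[OF t])
  also have "\<dots> = norm (regular_distr (homog (- 1) \<omega>) (fourier (flat_gauss t)))"
    using af schwartz_flat_gauss[OF t] unfolding angle_fourier_def fourier_distr_def by simp
  also have "\<dots> \<le> 2 * c * M" by (rule L[OF t])
  finally show False by simp
qed

section \<open>The choice of the profiles\<close>

lemma integral_pos_on_open:
  fixes f :: "'a::euclidean_space \<Rightarrow> real"
  assumes f: "integrable lborel f" "\<And>x. 0 \<le> f x" and S: "open S" "S \<noteq> {}" "\<And>x. x \<in> S \<Longrightarrow> 0 < f x"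
  shows "0 < (LBINT x. f x)"
proof -
  have "(LBINT x. f x) \<noteq> 0"
  proof
    assume "(LBINT x. f x) = 0"
    then have "AE x in lborel. f x = 0" using integral_nonneg_eq_0_iff_AE[OF f(1)] f(2) by auto
    then have "AE x in lborel. x \<notin> S" by eventually_elim (use S(3) in force)
    then have "S \<in> null_sets lborel" using S(1) by (subst AE_iff_null_sets) auto
    then have "negligible S" by (simp add: negligible_iff_null_sets null_sets_completionI)
    then show False using open_not_negligible S by blast
  qed
  moreover have "0 \<le> (LBINT x. f x)" using f(2) by simp
  ultimately show ?thesis by simp
qed

definition disc :: "real \<Rightarrow> real \<Rightarrow> real" where "disc d t = bump (1 - t / d\<^sup>2)"

lemma disc_nonneg: "0 \<le> disc d t" unfolding disc_def by (rule bump_nonneg)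

lemma disc_antimono: "s \<le> t \<Longrightarrow> disc d t \<le> disc d s"
  unfolding disc_def by (intro bump_mono) (simp add: divide_right_mono)

lemma disc_pos: "0 < d \<Longrightarrow> t < d\<^sup>2 \<Longrightarrow> 0 < disc d t"
  unfolding disc_def by (rule bump_pos) simp

lemma disc_eq_0: "0 < d \<Longrightarrow> d\<^sup>2 \<le> t \<Longrightarrow> disc d t = 0"
  unfolding disc_def by (rule bump_eq_0) simp

lemma disc_scale: "0 < d \<Longrightarrow> disc d (d\<^sup>2 * t) = disc 1 t"
  unfolding disc_def by simp

lemma ndiff_disc: "ndiff UNIV n (disc d)"
proof -
  have "ndiff UNIV n (\<lambda>t::real. 1 + (- 1 / d\<^sup>2) * t)"
    by (intro ndiff_intros open_UNIV bounded_linear_ident)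
  then have "ndiff UNIV n (\<lambda>t. bump (1 + (- 1 / d\<^sup>2) * t))"
    using ndiff_compose[OF open_UNIV, of "\<lambda>t. 1 + (- 1 / d\<^sup>2) * t" UNIV n bump] ndiff_bump by auto
  then show ?thesis unfolding disc_def[abs_def] by simp
qed

lemma radial_profile_disc: "0 < d \<Longrightarrow> d \<le> T \<Longrightarrow> radial_profile (disc d) T"
proof
  assume d: "0 < d" "d \<le> T"
  then show "0 < T" by simp
  show "ndiff UNIV n (disc d)" for n by (rule ndiff_disc)
  fix t assume "T\<^sup>2 \<le> t"
  moreover have "d\<^sup>2 \<le> T\<^sup>2" using d by (intro power_mono) auto
  ultimately have "d\<^sup>2 \<le> t" by (rule order_trans[rotated])
  then show "disc d t = 0" using d by (intro disc_eq_0) auto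
qed

lemma integrable_disc_line: "integrable lborel (\<lambda>q::real. disc 1 (p\<^sup>2 + q\<^sup>2))"
proof -
  have c: "continuous_on UNIV (disc 1)" using ndiff_continuous_on[OF ndiff_disc[of 0]] .
  have "integrable lborel (\<lambda>q::real. (\<lambda>t. disc 1 (p\<^sup>2 + t)) ((norm q)\<^sup>2))"
  proof (rule integrable_profile[where T=1])
    show "continuous_on UNIV (\<lambda>t. disc 1 (p\<^sup>2 + t))"
      by (intro continuous_on_compose2[OF c] continuous_intros) auto
    show "disc 1 (p\<^sup>2 + t) = 0" if "1\<^sup>2 \<le> t" for t using that by (intro disc_eq_0) (auto simp: add_increasing)
  qed simp
  then show ?thesis by simp
qed

text \<open>Discs of all sizes have the same height, so the line integrals scale with the diameter.\<close>

lemma radon_disc_scale: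
  assumes d: "0 < d"
  shows "radon (disc d) p = d * radon (disc 1) (p / d)"
proof -
  have "radon (disc d) p = \<bar>d\<bar> *\<^sub>R (LBINT q. disc d (p\<^sup>2 + (0 + d * q)\<^sup>2))"
    unfolding radon_def using d by (intro lborel_integral_real_affine) simp
  also have "(LBINT q. disc d (p\<^sup>2 + (0 + d * q)\<^sup>2)) = radon (disc 1) (p / d)"
  proof -
    have "p\<^sup>2 + (0 + d * q)\<^sup>2 = d\<^sup>2 * ((p / d)\<^sup>2 + q\<^sup>2)" for q
      using d by (simp add: power_divide power_mult_distrib distrib_left)
    then show ?thesis unfolding radon_def using disc_scale[OF d] by simp
  qed
  finally show ?thesis using d by simp
qed

lemma radon_disc_nonneg: "0 \<le> radon (disc 1) p"
  unfolding radon_def by (simp add: disc_nonneg)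

lemma radon_disc_antimono:
  assumes "\<bar>p\<bar> \<le> \<bar>p'\<bar>" shows "radon (disc 1) p' \<le> radon (disc 1) p"
proof -
  have "p\<^sup>2 \<le> p'\<^sup>2" using assms by (simp add: abs_le_square_iff)
  then show ?thesis unfolding radon_def
    by (intro integral_mono integrable_disc_line disc_antimono) simp
qed

lemma radon_disc_pos:
  assumes "\<bar>p\<bar> < 1" shows "0 < radon (disc 1) p"
  unfolding radon_def
proof (rule integral_pos_on_open[OF integrable_disc_line disc_nonneg])
  let ?S = "{q::real. p\<^sup>2 + q\<^sup>2 < 1}"
  show "open ?S" by (intro open_Collect_less continuous_intros)
  have "p\<^sup>2 < 1" using assms by (simp add: abs_square_less_1)
  then have "0 \<in> ?S" by simp
  then show "?S \<noteq> {}" by blast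
  show "0 < disc 1 (p\<^sup>2 + q\<^sup>2)" if "q \<in> ?S" for q using that by (intro disc_pos) auto
qed

text \<open>The dent has height of order \<open>1 / e\<close> and width \<open>e\<close>, so that its line integrals are of order \<open>m\<close> for every \<open>e\<close>.\<close>

definition dented :: "real \<Rightarrow> real \<Rightarrow> real \<Rightarrow> real \<Rightarrow> real" where
  "dented T m e t = disc T t + (- (m / e)) * disc e t"

lemma radial_profile_dented:
  assumes "0 < T" "0 < e" "e \<le> T" shows "radial_profile (dented T m e) T"
proof -
  interpret A: radial_profile "disc T" T by (rule radial_profile_disc) (use assms in auto)
  interpret B: radial_profile "disc e" T by (rule radial_profile_disc) (use assms in auto)
  show ?thesis
  proof
    show "0 < T" by fact
    show "ndiff UNIV n (dented T m e)" for n unfolding dented_def[abs_def]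
      by (intro ndiff_add ndiff_mult ndiff_const open_UNIV ndiff_disc)
    show "dented T m e t = 0" if "T\<^sup>2 \<le> t" for t
      unfolding dented_def using A.h_support[OF that] B.h_support[OF that] by simp
  qed
qed

lemma radon_dented:
  assumes "0 < T" "0 < e" "e \<le> T"
  shows "radon (dented T m e) p = T * radon (disc 1) (p / T) - m * radon (disc 1) (p / e)"
proof -
  have i: "integrable lborel (\<lambda>q. disc d (p\<^sup>2 + q\<^sup>2))" if "0 < d" for d
  proof -
    have "d\<^sup>2 * ((p / d)\<^sup>2 + (0 + (1 / d) * q)\<^sup>2) = p\<^sup>2 + q\<^sup>2" for q
      using that by (simp add: power_divide power_mult_distrib distrib_left)
    then have "disc d (p\<^sup>2 + q\<^sup>2) = disc 1 ((p / d)\<^sup>2 + (0 + (1 / d) * q)\<^sup>2)" for q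
      using disc_scale[OF that] by metis
    then show ?thesis using lborel_integrable_real_affine[OF integrable_disc_line[of "p / d"], of "1 / d" 0] that by simp
  qed
  have "radon (dented T m e) p = radon (disc T) p + (LBINT q. (- (m / e)) * disc e (p\<^sup>2 + q\<^sup>2))"
    unfolding radon_def dented_def using i assms by (intro Bochner_Integration.integral_add integrable_mult_right) auto
  also have "(LBINT q. (- (m / e)) * disc e (p\<^sup>2 + q\<^sup>2)) = (- (m / e)) * radon (disc e) p"
    unfolding radon_def by (rule integral_mult_right_zero)
  finally show ?thesis using assms radon_disc_scale[of T p] radon_disc_scale[of e p] by simp
qed

text \<open>With this mass the largest line integral of the dent, attained on lines through the centre, equals the line
integral of the wide disc at distance \<open>T / 2\<close>.\<close>

definition dent_mass :: "real \<Rightarrow> real" where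
  "dent_mass T = T * radon (disc 1) (1 / 2) / radon (disc 1) 0"

lemma dent_mass_pos: "0 < T \<Longrightarrow> 0 < dent_mass T"
  unfolding dent_mass_def by (simp add: radon_disc_pos)

text \<open>Lines at distance at least \<open>e\<close> miss the dent. The others pass within \<open>T / 2\<close> of the centre, where the line
integrals of the wide disc are at least as large as the largest one of the dent.\<close>

lemma radon_dented_nonneg:
  assumes "0 < T" "0 < e" "e \<le> T / 2"
  shows "0 \<le> radon (dented T (dent_mass T) e) p"
proof -
  have eT: "e \<le> T" using assms by simp
  have "dent_mass T * radon (disc 1) (p / e) \<le> T * radon (disc 1) (p / T)"
  proof (cases "\<bar>p\<bar> < e")
    case True
    have "dent_mass T * radon (disc 1) (p / e) \<le> dent_mass T * radon (disc 1) 0"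
      using dent_mass_pos[OF assms(1)] by (intro mult_left_mono radon_disc_antimono) auto
    also have "\<dots> = T * radon (disc 1) (1 / 2)" unfolding dent_mass_def using radon_disc_pos[of 0] by simp
    also have "\<dots> \<le> T * radon (disc 1) (p / T)"
      using assms True by (intro mult_left_mono radon_disc_antimono) (auto simp: field_simps)
    finally show ?thesis .
  next
    case False
    interpret radial_profile "disc 1" 1 by (rule radial_profile_disc) auto
    have "1\<^sup>2 \<le> (p / e)\<^sup>2" using False assms by (subst abs_le_square_iff[symmetric]) (auto simp: field_simps)
    then have "radon (disc 1) (p / e) = 0" by (rule radon_eq_0)
    then show ?thesis using assms radon_disc_nonneg[of "p / T"] by simp
  qed
  then show ?thesis unfolding radon_dented[OF assms(1,2) eT] by simp
qed

text \<open>This is where \<open>s < 2\<close> enters: \<open>e powr (s - 2)\<close> is unbounded as \<open>e\<close> tends to \<open>0\<close>.\<close>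

lemma small_radius:
  fixes s T m :: real
  assumes s: "s < 2" and T: "0 < T" and m: "0 < m"
  obtains e where "0 < e" "e \<le> T / 2" "m * e < T\<^sup>2" "T powr (s - 1) < m * e powr (s - 2)"
proof -
  \<comment> \<open>the radius at which the last inequality becomes an equality\<close>
  define b where "b = (T powr (s - 1) / m) powr (1 / (s - 2))"
  have b: "0 < b" unfolding b_def using T m by simp
  have bp: "b powr (s - 2) = T powr (s - 1) / m" unfolding b_def using s T m by (simp add: powr_powr)
  define X where "X = min (T / 2) (min (T\<^sup>2 / m) b)"
  have "0 < X" unfolding X_def using T m b by simp
  moreover have "X \<le> T / 2" unfolding X_def by (rule min.cobounded1)
  moreover have "X \<le> T\<^sup>2 / m" unfolding X_def by (rule order_trans[OF min.cobounded2 min.cobounded1])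
  moreover have "X \<le> b" unfolding X_def by (rule order_trans[OF min.cobounded2 min.cobounded2])
  ultimately have X: "0 < X" "X \<le> T / 2" "X \<le> T\<^sup>2 / m" "X \<le> b" by blast+
  define e where "e = X / 2"
  have e: "0 < e" unfolding e_def using X by simp
  have "e < b" "e \<le> T / 2" "e < T\<^sup>2 / m" using X unfolding e_def by linarith+
  moreover have "b powr (s - 2) < e powr (s - 2)" using \<open>e < b\<close> e s by (intro powr_less_mono2_neg) auto
  ultimately show ?thesis using e m unfolding bp by (intro that[of e]) (auto simp: field_simps)
qed

lemma cone_hat_disc_pos:
  assumes s: "1 < s" "s < 3" and T: "0 < T" and \<xi>: "\<xi> \<noteq> 0"
  shows "0 < cone_hat s (disc T) \<xi>"
proof -
  interpret radial_profile "disc T" T by (rule radial_profile_disc) (use T in auto)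
  let ?f = "\<lambda>a::plane. disc T ((norm a)\<^sup>2) * norm (horiz \<xi> + \<xi>$3 *\<^sub>R a) powr (s - 3)"
  have i: "integrable lborel ?f"
  proof (cases "\<xi>$3 = 0")
    case True
    have "integrable lborel (\<lambda>a::plane. disc T ((norm a)\<^sup>2) * norm (horiz \<xi>) powr (s - 3))"
      by (intro integrable_mult_left h_integrable)
    then show ?thesis using True by simp
  next
    case False
    have "- 2 * ((3 - s) / 2) = s - 3" by simp
    moreover have "integrable lborel (\<lambda>a. disc T ((norm a)\<^sup>2) * norm (horiz \<xi> + \<xi>$3 *\<^sub>R a) powr (- 2 * ((3 - s) / 2)))"
      by (rule integrable_kernel) (use s False in auto)
    ultimately show ?thesis by (simp only:)
  qed
  let ?S = "ball 0 T \<inter> {a. horiz \<xi> + \<xi>$3 *\<^sub>R a \<noteq> 0}"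
  have "0 < (LBINT a. ?f a)"
  proof (rule integral_pos_on_open[OF i])
    show "open ?S" by (intro open_Int open_ball open_Collect_neq continuous_intros)
    show "?S \<noteq> {}"
    proof (cases "horiz \<xi> = 0")
      case True
      then have "\<xi>$3 \<noteq> 0" using \<xi> horiz_eq_0 by blast
      then have "horiz \<xi> + \<xi>$3 *\<^sub>R (T / 2, 0) \<noteq> 0" using T True by (simp add: zero_prod_def)
      moreover have "norm (T / 2, 0::real) < T" using T by (simp add: norm_Pair)
      ultimately have "(T / 2, 0) \<in> ?S" unfolding Int_iff mem_ball_0 mem_Collect_eq by blast
      then show ?thesis by blast
    next
      case False
      then have "0 \<in> ?S" using T by simp
      then show ?thesis by blast
    qed
    show "0 < ?f a" if "a \<in> ?S" for a
    proof -
      have "(norm a)\<^sup>2 < T\<^sup>2" using that by (intro power_strict_mono) auto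
      then show ?thesis using that disc_pos[OF T] by simp
    qed
    show "0 \<le> ?f a" for a by (simp add: disc_nonneg)
  qed
  then show ?thesis unfolding cone_hat_def using riesz_const_pos[OF s] by simp
qed

text \<open>At the pole the transform is the Riesz potential of the profile at the origin, which is of order
\<open>d powr (s - 1)\<close> for a disc of radius \<open>d\<close>. Dividing by the width of the dent gives \<open>e powr (s - 2)\<close>.\<close>

lemma cone_hat_dented_pole:
  assumes s: "1 < s" "s < 2" and T: "0 < T" "0 < e" "e \<le> T" and m: "T powr (s - 1) < m * e powr (s - 2)"
  shows "cone_hat s (dented T m e) (axis 3 1) < 0"
proof -
  define J where "J = (\<lambda>d. LBINT a. disc d ((norm (a::plane))\<^sup>2) * norm a powr (s - 3))"
  have i: "integrable lborel (\<lambda>a::plane. disc d ((norm a)\<^sup>2) * norm a powr (s - 3))" if d: "0 < d" for d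
  proof -
    interpret radial_profile "disc d" d by (rule radial_profile_disc) (use d in auto)
    have "- 2 * ((3 - s) / 2) = s - 3" by simp
    moreover have "integrable lborel (\<lambda>a::plane. disc d ((norm a)\<^sup>2) * norm (0 + (1::real) *\<^sub>R a) powr (- 2 * ((3 - s) / 2)))"
      by (rule integrable_kernel) (use s in auto)
    ultimately show ?thesis by (simp only: scaleR_one add_0)
  qed
  have J: "J d = d powr (s - 1) * J 1" if d: "0 < d" for d
  proof -
    have [measurable]: "disc d \<in> borel_measurable borel" 
      using ndiff_continuous_on[OF ndiff_disc[of 0]] by (rule borel_measurable_continuous_onI)
    have "J d = \<bar>d\<bar>^DIM(plane) *\<^sub>R (LBINT a. disc d ((norm (0 + d *\<^sub>R (a::plane)))\<^sup>2) * norm (0 + d *\<^sub>R a) powr (s - 3))"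
      unfolding J_def by (rule lborel_integral_affine) (use d in \<open>simp, measurable\<close>)
    also have "(\<lambda>a::plane. disc d ((norm (0 + d *\<^sub>R a))\<^sup>2) * norm (0 + d *\<^sub>R a) powr (s - 3)) =
       (\<lambda>a. d powr (s - 3) * (disc 1 ((norm a)\<^sup>2) * norm a powr (s - 3)))"
    proof
      fix a :: "plane"
      have "disc d ((norm (0 + d *\<^sub>R a))\<^sup>2) = disc 1 ((norm a)\<^sup>2)"
        using disc_scale[OF d] d by (simp add: power_mult_distrib)
      moreover have "norm (0 + d *\<^sub>R a) powr (s - 3) = d powr (s - 3) * norm a powr (s - 3)"
        using d by (simp add: powr_mult)
      ultimately show "disc d ((norm (0 + d *\<^sub>R a))\<^sup>2) * norm (0 + d *\<^sub>R a) powr (s - 3) =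
          d powr (s - 3) * (disc 1 ((norm a)\<^sup>2) * norm a powr (s - 3))"
        by (simp only: mult.left_commute)
    qed
    also have "(LBINT a. d powr (s - 3) * (disc 1 ((norm (a::plane))\<^sup>2) * norm a powr (s - 3))) = d powr (s - 3) * J 1"
      unfolding J_def by (rule integral_mult_right_zero)
    also have "\<bar>d\<bar>^DIM(plane) *\<^sub>R (d powr (s - 3) * J 1) = (d powr 2 * d powr (s - 3)) * J 1"
      using d by (simp add: power2_eq_square)
    also have "d powr 2 * d powr (s - 3) = d powr (s - 1)" by (simp flip: powr_add)
    finally show ?thesis .
  qed
  have J1: "0 < J 1" unfolding J_def
  proof (rule integral_pos_on_open[OF i])
    let ?S = "ball 0 1 - {0} :: plane set"
    show "open ?S" by auto
    have "norm (1/2::real, 0::real) < 1" "(1/2::real, 0::real) \<noteq> 0" by (simp_all add: norm_Pair zero_prod_def)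
    then have "(1/2, 0) \<in> ?S" unfolding Diff_iff mem_ball_0 by blast
    then show "?S \<noteq> {}" by blast
    show "0 < disc 1 ((norm a)\<^sup>2) * norm a powr (s - 3)" if "a \<in> ?S" for a
    proof -
      have "(norm a)\<^sup>2 < 1\<^sup>2" using that by (intro power_strict_mono) auto
      then show ?thesis using that disc_pos[of 1] by simp
    qed
    show "0 \<le> disc 1 ((norm a)\<^sup>2) * norm a powr (s - 3)" for a :: "plane" by (simp add: disc_nonneg)
  qed simp
  have p: "horiz (axis 3 1) = 0" by (simp add: horiz_def axis_def zero_prod_def)
  have "(LBINT a. dented T m e ((norm (a::plane))\<^sup>2) * norm (horiz (axis 3 1) + (axis 3 1 :: real^3)$3 *\<^sub>R a) powr (s - 3))
    = (LBINT a. disc T ((norm (a::plane))\<^sup>2) * norm a powr (s - 3) + (- (m / e)) * (disc e ((norm a)\<^sup>2) * norm a powr (s - 3)))"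
    unfolding dented_def p by (simp add: axis_def distrib_right mult.assoc left_diff_distrib)
  also have "\<dots> = J T + (LBINT a. (- (m / e)) * (disc e ((norm (a::plane))\<^sup>2) * norm a powr (s - 3)))"
    unfolding J_def using T by (intro Bochner_Integration.integral_add integrable_mult_right i)
  also have "(LBINT a. (- (m / e)) * (disc e ((norm (a::plane))\<^sup>2) * norm a powr (s - 3))) = (- (m / e)) * J e"
    unfolding J_def by (rule integral_mult_right_zero)
  also have "J T + (- (m / e)) * J e = (T powr (s - 1) - m * (e powr (s - 1) / e)) * J 1"
    unfolding J[OF T(1)] J[OF T(2)] by (simp add: algebra_simps)
  also have "e powr (s - 1) / e = e powr (s - 2)" using T by (simp add: powr_diff power2_eq_square)
  also have "(T powr (s - 1) - m * e powr (s - 2)) * J 1 < 0" using m J1 by (intro mult_neg_pos) auto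
  finally show ?thesis unfolding cone_hat_def using riesz_const_pos[of s] s by (simp add: mult_pos_neg)
qed

text \<open>On the equator the kernel is constant and the transform is the total mass of the profile, in which the dent
contributes only \<open>m * e\<close>.\<close>

lemma cone_hat_dented_equator:
  assumes s: "1 < s" "s < 3" and T: "0 < T" "0 < e" and m: "m * e < T\<^sup>2"
  shows "0 < cone_hat s (dented T m e) (axis 1 1)"
proof -
  define A where "A = (\<lambda>d. LBINT a. disc d ((norm (a::plane))\<^sup>2))"
  have i: "integrable lborel (\<lambda>a::plane. disc d ((norm a)\<^sup>2))" if d: "0 < d" for d
  proof -
    interpret radial_profile "disc d" d by (rule radial_profile_disc) (use d in auto)
    show ?thesis by (rule h_integrable)
  qed
  have A: "A d = d\<^sup>2 * A 1" if d: "0 < d" for d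
  proof -
    have [measurable]: "disc d \<in> borel_measurable borel" 
      using ndiff_continuous_on[OF ndiff_disc[of 0]] by (rule borel_measurable_continuous_onI)
    have "A d = \<bar>d\<bar>^DIM(plane) *\<^sub>R (LBINT a. disc d ((norm (0 + d *\<^sub>R (a::plane)))\<^sup>2))"
      unfolding A_def by (rule lborel_integral_affine) (use d in \<open>simp, measurable\<close>)
    moreover have "disc d ((norm (0 + d *\<^sub>R a))\<^sup>2) = disc 1 ((norm a)\<^sup>2)" for a :: "plane"
      using disc_scale[OF d] d by (simp add: power_mult_distrib)
    moreover have "\<bar>d\<bar>^DIM(plane) = d\<^sup>2" by (simp add: power2_eq_square)
    ultimately show ?thesis unfolding A_def by (simp only: real_scaleR_def)
  qed
  have A1: "0 < A 1" unfolding A_def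
  proof (rule integral_pos_on_open[OF i])
    show "0 < disc 1 ((norm a)\<^sup>2)" if "a \<in> ball 0 1" for a :: "plane"
    proof -
      have "(norm a)\<^sup>2 < 1\<^sup>2" using that by (intro power_strict_mono) auto
      then show ?thesis by (intro disc_pos) auto
    qed
  qed (auto simp: disc_nonneg)
  have p: "horiz (axis 1 1) = (1, 0)" "(axis 1 1 :: real^3)$3 = 0" by (simp_all add: horiz_def axis_def)
  have "(LBINT a. dented T m e ((norm (a::plane))\<^sup>2) * norm (horiz (axis 1 1) + (axis 1 1 :: real^3)$3 *\<^sub>R a) powr (s - 3))
    = (LBINT a. disc T ((norm (a::plane))\<^sup>2) + (- (m / e)) * disc e ((norm a)\<^sup>2))"
    unfolding dented_def p by (simp add: norm_Pair)
  also have "\<dots> = A T + (LBINT a. (- (m / e)) * disc e ((norm (a::plane))\<^sup>2))"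
    unfolding A_def using T by (intro Bochner_Integration.integral_add integrable_mult_right i)
  also have "(LBINT a. (- (m / e)) * disc e ((norm (a::plane))\<^sup>2)) = (- (m / e)) * A e"
    unfolding A_def by (rule integral_mult_right_zero)
  also have "A T + (- (m / e)) * A e = (T\<^sup>2 - m * e) * A 1"
    unfolding A[OF T(1)] A[OF T(2)] using T by (simp add: algebra_simps power2_eq_square)
  finally show ?thesis unfolding cone_hat_def using riesz_const_pos[OF s] A1 m by simp
qed

lemma cone_hat1_dented_pole:
  assumes "0 < e" "e < m"
  shows "cone_hat1 (dented T m e) (axis 3 1) < 0"
proof -
  have "horiz (axis 3 1) = 0" "(axis 3 1 :: real^3)$3 = 1" by (simp_all add: horiz_def axis_def zero_prod_def)
  then have "cone_hat1 (dented T m e) (axis 3 1) = (1 - m / e) * bump 1"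
    unfolding cone_hat1_def dented_def disc_def by (simp add: algebra_simps)
  also have "\<dots> < 0" using assms bump_pos[of 1] by (intro mult_neg_pos) auto
  finally show ?thesis .
qed

text \<open>A direction of slope \<open>T / 2\<close> is outside the dent and inside the wide disc.\<close>

lemma cone_hat1_dented_pos:
  assumes T: "0 < T" "0 < e" "e \<le> T / 2"
  shows "\<exists>\<xi>\<in>S2. 0 < cone_hat1 (dented T m e) \<xi>"
proof -
  let ?x = "coords ((T / 2, 0), 1)"
  have x0: "?x \<noteq> 0" by (metis coords_nth(3) snd_conv zero_index zero_neq_one)
  have "e\<^sup>2 \<le> (T / 2)\<^sup>2" using T by (intro power_mono) auto
  then have "disc e ((T / 2)\<^sup>2) = 0" using T by (intro disc_eq_0) auto
  moreover have "0 < disc T ((T / 2)\<^sup>2)" using T by (intro disc_pos) (auto simp: power_divide)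
  moreover have "cone_hat1 (dented T m e) ?x = dented T m e ((T / 2)\<^sup>2)" unfolding cone_hat1_def using T by (simp add: norm_Pair)
  ultimately have "0 < cone_hat1 (dented T m e) ?x" unfolding dented_def by simp
  moreover have "cone_hat1 (dented T m e) (inverse (norm ?x) *\<^sub>R ?x) = inverse (norm ?x) powr (- 3 + 1) * cone_hat1 (dented T m e) ?x"
    using x0 by (intro cone_hat1_scaleR) simp
  ultimately have "0 < cone_hat1 (dented T m e) (inverse (norm ?x) *\<^sub>R ?x)" using x0 by simp
  moreover have "inverse (norm ?x) *\<^sub>R ?x \<in> S2" using x0 by simp
  ultimately show ?thesis by blast
qed

section \<open>Positive and sign-changing transforms\<close>

theorem theorem5p1:
  fixes \<theta>\<^sub>0 :: real
  assumes "0 < \<theta>\<^sub>0" and "\<theta>\<^sub>0 < pi / 2"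
  shows
    "(\<forall>s::real. 1 < s \<and> s < 2 \<longrightarrow>
        (\<exists>\<omega>\<^sub>1 \<omega>\<^sub>1'. admissible \<omega>\<^sub>1 \<and> vanishes_upto (pi / 2 - \<theta>\<^sub>0) \<omega>\<^sub>1 \<and>
           angle_fourier s \<omega>\<^sub>1 \<omega>\<^sub>1' \<and> (\<forall>\<xi>\<in>S2. 0 < \<omega>\<^sub>1' \<xi>)) \<and>
        (\<exists>\<omega>\<^sub>2 \<omega>\<^sub>2'. admissible \<omega>\<^sub>2 \<and> vanishes_upto (pi / 2 - \<theta>\<^sub>0) \<omega>\<^sub>2 \<and>
           angle_fourier s \<omega>\<^sub>2 \<omega>\<^sub>2' \<and> (\<exists>\<xi>\<in>S2. 0 < \<omega>\<^sub>2' \<xi>) \<and> (\<exists>\<xi>\<in>S2. \<omega>\<^sub>2' \<xi> < 0))) \<and>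
     (\<exists>\<omega>\<^sub>1 \<omega>\<^sub>1'. admissible \<omega>\<^sub>1 \<and> vanishes_upto (pi / 2 - \<theta>\<^sub>0) \<omega>\<^sub>1 \<and>
        angle_fourier 1 \<omega>\<^sub>1 \<omega>\<^sub>1' \<and> (\<forall>\<xi>\<in>S2. 0 \<le> \<omega>\<^sub>1' \<xi>)) \<and>
     (\<exists>\<omega>\<^sub>2 \<omega>\<^sub>2'. admissible \<omega>\<^sub>2 \<and> vanishes_upto (pi / 2 - \<theta>\<^sub>0) \<omega>\<^sub>2 \<and>
        angle_fourier 1 \<omega>\<^sub>2 \<omega>\<^sub>2' \<and> (\<exists>\<xi>\<in>S2. 0 < \<omega>\<^sub>2' \<xi>) \<and> (\<exists>\<xi>\<in>S2. \<omega>\<^sub>2' \<xi> < 0)) \<and>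
     \<not> (\<exists>\<omega>\<^sub>1 \<omega>\<^sub>1'. admissible \<omega>\<^sub>1 \<and> vanishes_upto (pi / 2 - \<theta>\<^sub>0) \<omega>\<^sub>1 \<and>
        angle_fourier 1 \<omega>\<^sub>1 \<omega>\<^sub>1' \<and> (\<forall>\<xi>\<in>S2. 0 < \<omega>\<^sub>1' \<xi>))"
proof -
  \<comment> \<open>the polar angle is at most pi / 2 - theta0 exactly where x3 is at least T times the horizontal distance\<close>
  define T where "T = tan \<theta>\<^sub>0"
  have T: "0 < T" unfolding T_def using assms by (rule tan_gt_zero)
  have rd: "0 \<le> radon (disc T) p" for p
    unfolding radon_disc_scale[OF T, of p] using T by (intro mult_nonneg_nonneg radon_disc_nonneg) auto
  interpret D: radial_profile "disc T" T by (rule radial_profile_disc) (use T in auto)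
  have S2_nz: "\<xi> \<noteq> 0" if "\<xi> \<in> S2" for \<xi> :: "real^3" using that by auto
  have ax: "axis 1 1 \<in> S2" "axis 3 1 \<in> S2" by simp_all
  have pos: "\<exists>\<omega>\<^sub>1 \<omega>\<^sub>1'. admissible \<omega>\<^sub>1 \<and> vanishes_upto (pi / 2 - \<theta>\<^sub>0) \<omega>\<^sub>1 \<and>
       angle_fourier s \<omega>\<^sub>1 \<omega>\<^sub>1' \<and> (\<forall>\<xi>\<in>S2. 0 < \<omega>\<^sub>1' \<xi>)" if s: "1 < s" "s < 2" for s
  proof (intro exI conjI ballI)
    show "admissible (cone_fun s (disc T))" by (rule D.admissible_cone_fun[OF rd])
    show "vanishes_upto (pi / 2 - \<theta>\<^sub>0) (cone_fun s (disc T))" by (rule D.vanishes_upto_cone_fun[OF assms T_def])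
    show "angle_fourier s (cone_fun s (disc T)) (cone_hat s (disc T))" by (rule D.angle_fourier_cone) (use s in auto)
    show "0 < cone_hat s (disc T) \<xi>" if "\<xi> \<in> S2" for \<xi> using s T S2_nz[OF that] by (intro cone_hat_disc_pos) auto
  qed
  have nonneg: "\<exists>\<omega>\<^sub>1 \<omega>\<^sub>1'. admissible \<omega>\<^sub>1 \<and> vanishes_upto (pi / 2 - \<theta>\<^sub>0) \<omega>\<^sub>1 \<and>
       angle_fourier 1 \<omega>\<^sub>1 \<omega>\<^sub>1' \<and> (\<forall>\<xi>\<in>S2. 0 \<le> \<omega>\<^sub>1' \<xi>)"
  proof (intro exI conjI ballI)
    show "admissible (cone_fun 1 (disc T))" by (rule D.admissible_cone_fun[OF rd])
    show "vanishes_upto (pi / 2 - \<theta>\<^sub>0) (cone_fun 1 (disc T))" by (rule D.vanishes_upto_cone_fun[OF assms T_def])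
    show "angle_fourier 1 (cone_fun 1 (disc T)) (cone_hat1 (disc T))" by (rule D.angle_fourier_cone_1)
    show "0 \<le> cone_hat1 (disc T) \<xi>" for \<xi> unfolding cone_hat1_def by (simp add: disc_nonneg)
  qed
  have mixed: "\<exists>\<omega>\<^sub>2 \<omega>\<^sub>2'. admissible \<omega>\<^sub>2 \<and> vanishes_upto (pi / 2 - \<theta>\<^sub>0) \<omega>\<^sub>2 \<and>
       angle_fourier s \<omega>\<^sub>2 \<omega>\<^sub>2' \<and> (\<exists>\<xi>\<in>S2. 0 < \<omega>\<^sub>2' \<xi>) \<and> (\<exists>\<xi>\<in>S2. \<omega>\<^sub>2' \<xi> < 0)" if s: "1 \<le> s" "s < 2" for s
  proof -
    obtain e where e: "0 < e" "e \<le> T / 2" "dent_mass T * e < T\<^sup>2" "T powr (s - 1) < dent_mass T * e powr (s - 2)"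
      using small_radius[OF s(2) T dent_mass_pos[OF T]] .
    have eT: "e \<le> T" using e T by simp
    define h where "h = dented T (dent_mass T) e"
    interpret R: radial_profile h T unfolding h_def by (rule radial_profile_dented[OF T e(1) eT])
    have adm: "admissible (cone_fun s h)"
      by (rule R.admissible_cone_fun) (unfold h_def, rule radon_dented_nonneg[OF T e(1,2)])
    have van: "vanishes_upto (pi / 2 - \<theta>\<^sub>0) (cone_fun s h)" by (rule R.vanishes_upto_cone_fun[OF assms T_def])
    have witness: ?thesis if "angle_fourier s (cone_fun s h) w" "\<exists>\<xi>\<in>S2. 0 < w \<xi>" "w (axis 3 1) < 0" for w
      using adm van ax(2) that by blast
    show ?thesis
    proof (cases "s = 1")
      case True
      have "e < dent_mass T" using e(1,4) True T by (simp add: powr_minus_one field_simps)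
      then have "cone_hat1 h (axis 3 1) < 0" unfolding h_def by (rule cone_hat1_dented_pole[OF e(1)])
      moreover have "\<exists>\<xi>\<in>S2. 0 < cone_hat1 h \<xi>" unfolding h_def by (rule cone_hat1_dented_pos[OF T e(1,2)])
      ultimately show ?thesis using R.angle_fourier_cone_1 True by (intro witness[of "cone_hat1 h"]) simp_all
    next
      case False
      then have s1: "1 < s" "s < 3" using s by auto
      have "cone_hat s h (axis 3 1) < 0" unfolding h_def by (rule cone_hat_dented_pole[OF s1(1) s(2) T e(1) eT e(4)])
      moreover have "0 < cone_hat s h (axis 1 1)" unfolding h_def by (rule cone_hat_dented_equator[OF s1 T e(1,3)])
      ultimately show ?thesis using R.angle_fourier_cone[OF s1] ax(1) by (intro witness[of "cone_hat s h"]) blast+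
    qed
  qed
  have "\<not> (\<exists>\<omega>\<^sub>1 \<omega>\<^sub>1'. admissible \<omega>\<^sub>1 \<and> vanishes_upto (pi / 2 - \<theta>\<^sub>0) \<omega>\<^sub>1 \<and>
        angle_fourier 1 \<omega>\<^sub>1 \<omega>\<^sub>1' \<and> (\<forall>\<xi>\<in>S2. 0 < \<omega>\<^sub>1' \<xi>))"
  proof clarify
    fix \<omega>\<^sub>1 \<omega>\<^sub>1'
    assume "admissible \<omega>\<^sub>1" "vanishes_upto (pi / 2 - \<theta>\<^sub>0) \<omega>\<^sub>1" "angle_fourier 1 \<omega>\<^sub>1 \<omega>\<^sub>1'" "\<forall>\<xi>\<in>S2. 0 < \<omega>\<^sub>1' \<xi>"
    then show False using assms by (intro no_positive_transform[of "pi / 2 - \<theta>\<^sub>0" \<omega>\<^sub>1 \<omega>\<^sub>1']) auto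
  qed
  then show ?thesis using pos nonneg mixed by simp
qed

end
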